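(* Let $E$ be a closed subset of $\mathbb{R}^d$ with Borel $\sigma$-algebra $\mathcal{B}$, let $(U^\alpha)_{\alpha>0}$ be an Engelbert resolvent on $(E,\mathcal{B})$ with associated cone $\mathcal{R}_+$, put $\mathcal{R}=\mathcal{R}_+-\mathcal{R}_+$, assume $C_0(E)\subset \mathrm{cl}(\mathcal{R})$, and let $(p_t)_{t\ge 0}$ be the corresponding Engelbert transition function. For each probability measure $\mu$ on $(E,\mathcal{B})$ let $\mathbb{P}_\mu$ be the probability measure on $(\mathcal{W},\mathcal{G}^0)$ such that, with $\mathbb{E}_\mu$ the corresponding expectation, for all bounded $\mathcal{B}$-measurable $f$ and all $s,t\ge 0$, $\mathbb{E}_\mu\{f(Y_{t+s})\mid\mathcal{G}^0_s\}=P_tf(Y_s)$ $\mathbb{P}_\mu$-a.s. and $\mathbb{E}_\mu f(Y_t)=\int\mu(dx)\,P_tf(x)$; denote also by $\mathbb{P}_\mu$ its extension to $(\mathcal{W},\mathcal{G})$. Then for each probability measure $\mu$ on $(E,\mathcal{B})$, each stopping time $\tau$ and each bounded $\mathcal{G}$-measurable function $Z$ on $\mathcal{W}$, $$\mathbb{E}_\mu\{\theta_\tau Z\mid\mathcal{G}_\tau\}=\mathbb{E}_{Y_\tau}Z\qquad \mathbb{P}_\mu\text{-a.s. on }\{\tau<\infty\}.$$ Also, $\mathcal{G}_t=\bigcap_{s>t}\mathcal{G}_s$ for all $t\ge 0$.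
   Context: A kernel on $(E,\mathcal{B})$ is a function $k:E\times\mathcal{B}\to\mathbb{R}$ that is $\mathcal{B}$-measurable in the first variable and a signed measure of finite total variation in the second; it is stochastic if each $k(x,\cdot)$ is a probability measure. Composition: $k*k'(x,B)=\int k(x,dy)k'(y,B)$. The operator on bounded measurable functions corresponding to a kernel is denoted by the corresponding capital letter, e.g. $P_tf(x)=\int p_t(x,dy)f(y)$. $\mathcal{B}$ also denotes the bounded $\mathcal{B}$-measurable functions and $\mathcal{B}^+$ the nonnegative ones. A Markov resolvent is a family of kernels $(u^\alpha)_{\alpha>0}$ such that $\alpha u^\alpha$ is stochastic for every $\alpha>0$ and $u^\beta-u^\alpha=(\alpha-\beta)u^\alpha*u^\beta$. A function $f\in\mathcal{B}^+$ is $\alpha$-supermedian if $f\ge(\beta-\alpha)U^\beta f$ for all $\beta>0$. $C^+(E)$ is the set of bounded nonnegative continuous functions on $E$; $C_0(E)$ is the set of bounded continuous functions on $E$ tending to zero at infinity ($C_0(E)=C(E)$ if $E$ is bounded); $\mathrm{cl}$ denotes closure in the sup norm. A Markov resolvent $U^\alpha$ on $(E,\mathcal{B})$ is an Engelbert resolvent (with associated cone $\mathcal{R}_+$) if $\mathcal{R}_+$ is a convex subcone of $C^+(E)$ that contains the nonnegative constants and separates points of $E$, $U^\alpha\mathcal{R}_+\subset\mathcal{R}_+$ for all $\alpha>0$, and every $f\in\mathcal{R}_+$ is $\alpha$-supermedian for some $\alpha>0$. A Markov transition function $(p_t)_{t\ge0}$ is a family of stochastic kernels with $(t,x)\mapsto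 p_t(x,B)$ jointly measurable for each $B \in \mathcal{B}$ and $p_{s+t}=p_s*p_t$ ($p_0$ is not required to be the identity kernel). The Engelbert transition function corresponding to $U^\alpha$ is the unique Markov transition function such that: (i) $U^\alpha f=\int_0^\infty e^{-\alpha t}P_tf\,dt$ for all $\alpha>0$, $f\in\mathcal{B}$; (ii) for every $f\in\mathcal{R}_+$ there is $\alpha>0$ with $e^{-\alpha t}P_tf\le f$ for all $t\ge0$; (iii) for all $x\in E$, $f\in\mathcal{R}$, $t\mapsto P_tf(x)$ is right continuous on $[0,\infty)$. $\mathcal{W}$ is the space of all functions $[0,\infty)\to E$ that are right continuous with left-hand limits; $Y_t(w)=w(t)$; $\mathcal{G}^0=\sigma\{Y_t: t\ge0\}$; $\mathcal{G}^0_t=\sigma\{Y_s:0\le s\le t\}$. For a probability $\mu$ on $(E,\mathcal{B})$, $\mathcal{G}^\mu$ is the completion of $\mathcal{G}^0$ with respect to $\mathbb{P}_\mu$, $N^\mu=\{B\in\mathcal{G}^\mu:\mathbb{P}_\mu(B)=0\}$, $\mathcal{G}^\mu_t=\sigma(\mathcal{G}^0_t\cup N^\mu)$, $\mathcal{G}_t=\bigcap_\mu\mathcal{G}^\mu_t$, $\mathcal{G}=\bigcap_\mu\mathcal{G}^\mu$ (intersections over all probability measures $\mu$ on $(E,\mathcal{B})$). The shift is $(\theta_tw)(s)=w(t+s)$ and $\theta_tZ(w)=Z(\theta_tw)$; $\theta_\tau Z(w)=Z(\theta_{\tau(w)}w)$ on $\{\tau<\infty\}$. For $x\in E$, $\mathbb{E}_x=\mathbb{E}_{\delta_x}$,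 and $\mathbb{E}_{Y_\tau}Z$ is the function $x\mapsto\mathbb{E}_xZ$ evaluated at $Y_\tau$. A stopping time is a map $\tau:\mathcal{W}\to[0,\infty]$ with $\{\tau\le t\}\in\mathcal{G}_t$ for all $t\ge0$, and $\mathcal{G}_\tau$ is the collection of $A\in\mathcal{G}$ with $A\cap\{\tau\le t\}\in\mathcal{G}_t$ for all $t\ge0$. *)

theory Defs
  imports "HOL-Probability.Probability"
begin

section \<open>Kernels, resolvents and transition functions\<close>

text \<open>
  All kernels that occur are nonnegative (a Markov resolvent is a positive multiple of stochastic
  kernels), so a kernel on \<open>M\<close> is rendered as a map \<open>k\<close> from points to measures; \<open>k x\<close> is irrelevant
  for \<open>x\<close> outside \<open>space M\<close>. Stochastic kernels are the measurable maps into \<open>prob_algebra M\<close>.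

  A function on \<open>E\<close> whose identity matters (membership in a cone) is extensional, i.e.\ equal to
  \<open>undefined\<close> outside \<open>E\<close>, so that it is determined by its values on \<open>E\<close>.
\<close>

abbreviation borel_of :: "'a::topological_space set \<Rightarrow> 'a measure" where
  "borel_of E \<equiv> restrict_space borel E"

definition bounded_measurable :: "'a measure \<Rightarrow> ('a \<Rightarrow> real) set" where
  "bounded_measurable M = {f \<in> borel_measurable M. bounded (f ` space M)}"

abbreviation stochastic_kernel :: "'a measure \<Rightarrow> ('a \<Rightarrow> 'a measure) \<Rightarrow> bool" where
  "stochastic_kernel M k \<equiv> k \<in> M \<rightarrow>\<^sub>M prob_algebra M"

definition kernel_comp :: "('a \<Rightarrow> 'a measure) \<Rightarrow> ('a \<Rightarrow> 'a measure) \<Rightarrow> 'a \<Rightarrow> 'a set \<Rightarrow> real" where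
  "kernel_comp k k' x B = (LINT y|k x. measure (k' y) B)"

definition kernel_op :: "'a measure \<Rightarrow> ('a \<Rightarrow> 'a measure) \<Rightarrow> ('a \<Rightarrow> real) \<Rightarrow> 'a \<Rightarrow> real" where
  "kernel_op M k f = (\<lambda>x\<in>space M. LINT y|k x. f y)"

definition markov_resolvent :: "'a measure \<Rightarrow> (real \<Rightarrow> 'a \<Rightarrow> 'a measure) \<Rightarrow> bool" where
  "markov_resolvent M u \<longleftrightarrow>
     (\<forall>\<alpha>>0. stochastic_kernel M (\<lambda>x. scale_measure (ennreal \<alpha>) (u \<alpha> x))) \<and>
     (\<forall>\<alpha>>0. \<forall>\<beta>>0. \<forall>x\<in>space M. \<forall>B\<in>sets M.
        measure (u \<beta> x) B - measure (u \<alpha> x) B = (\<alpha> - \<beta>) * kernel_comp (u \<alpha>) (u \<beta>) x B)"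

definition supermedian :: "'a measure \<Rightarrow> (real \<Rightarrow> 'a \<Rightarrow> 'a measure) \<Rightarrow> real \<Rightarrow> ('a \<Rightarrow> real) \<Rightarrow> bool" where
  "supermedian M u \<alpha> f \<longleftrightarrow>
     f \<in> bounded_measurable M \<and> (\<forall>x\<in>space M. 0 \<le> f x) \<and>
     (\<forall>\<beta>>0. \<forall>x\<in>space M. (\<beta> - \<alpha>) * kernel_op M (u \<beta>) f x \<le> f x)"

definition C_plus :: "'a::topological_space set \<Rightarrow> ('a \<Rightarrow> real) set" where
  "C_plus E = {f \<in> extensional E. continuous_on E f \<and> bounded (f ` E) \<and> (\<forall>x\<in>E. 0 \<le> f x)}"

text \<open>If \<open>E\<close> is bounded, the filter below is \<open>bot\<close> and the condition at infinity is void.\<close>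

definition C_zero :: "'a::real_normed_vector set \<Rightarrow> ('a \<Rightarrow> real) set" where
  "C_zero E = {f \<in> extensional E. continuous_on E f \<and> bounded (f ` E) \<and>
     (f \<longlongrightarrow> 0) (inf at_infinity (principal E))}"

definition sup_closure :: "'a set \<Rightarrow> ('a \<Rightarrow> real) set \<Rightarrow> ('a \<Rightarrow> real) set" where
  "sup_closure E S = {f \<in> extensional E. \<forall>e>0. \<exists>g\<in>S. \<forall>x\<in>E. \<bar>f x - g x\<bar> \<le> e}"

definition cone_diff :: "'a set \<Rightarrow> ('a \<Rightarrow> real) set \<Rightarrow> ('a \<Rightarrow> real) set" where
  "cone_diff E Rp = {\<lambda>x\<in>E. f x - g x | f g. f \<in> Rp \<and> g \<in> Rp}"

definition engelbert_resolvent ::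
  "'a::topological_space set \<Rightarrow> (real \<Rightarrow> 'a \<Rightarrow> 'a measure) \<Rightarrow> ('a \<Rightarrow> real) set \<Rightarrow> bool" where
  "engelbert_resolvent E u Rp \<longleftrightarrow>
     markov_resolvent (borel_of E) u \<and>
     Rp \<subseteq> C_plus E \<and>
     (\<forall>f\<in>Rp. \<forall>g\<in>Rp. (\<lambda>x\<in>E. f x + g x) \<in> Rp) \<and>
     (\<forall>f\<in>Rp. \<forall>c\<ge>0. (\<lambda>x\<in>E. c * f x) \<in> Rp) \<and>
     (\<forall>c\<ge>0. (\<lambda>x\<in>E. c) \<in> Rp) \<and>
     (\<forall>x\<in>E. \<forall>y\<in>E. x \<noteq> y \<longrightarrow> (\<exists>f\<in>Rp. f x \<noteq> f y)) \<and>
     (\<forall>\<alpha>>0. \<forall>f\<in>Rp. kernel_op (borel_of E) (u \<alpha>) f \<in> Rp) \<and>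
     (\<forall>f\<in>Rp. \<exists>\<alpha>>0. supermedian (borel_of E) u \<alpha> f)"

definition markov_transition_function :: "'a measure \<Rightarrow> (real \<Rightarrow> 'a \<Rightarrow> 'a measure) \<Rightarrow> bool" where
  "markov_transition_function M p \<longleftrightarrow>
     (\<forall>t\<ge>0. stochastic_kernel M (p t)) \<and>
     (\<forall>B\<in>sets M. (\<lambda>(t, x). measure (p t x) B) \<in> borel_measurable (borel_of {0..} \<Otimes>\<^sub>M M)) \<and>
     (\<forall>s\<ge>0. \<forall>t\<ge>0. \<forall>x\<in>space M. \<forall>B\<in>sets M.
        measure (p (s + t) x) B = kernel_comp (p s) (p t) x B)"

definition engelbert_transition_function ::
  "'a::topological_space set \<Rightarrow> (real \<Rightarrow> 'a \<Rightarrow> 'a measure) \<Rightarrow> ('a \<Rightarrow> real) set \<Rightarrow>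
     (real \<Rightarrow> 'a \<Rightarrow> 'a measure) \<Rightarrow> bool" where
  "engelbert_transition_function E u Rp p \<longleftrightarrow>
     markov_transition_function (borel_of E) p \<and>
     (\<forall>\<alpha>>0. \<forall>f\<in>bounded_measurable (borel_of E). \<forall>x\<in>E.
        kernel_op (borel_of E) (u \<alpha>) f x =
          (LINT t:{0..}|lborel. exp (- \<alpha> * t) * kernel_op (borel_of E) (p t) f x)) \<and>
     (\<forall>f\<in>Rp. \<exists>\<alpha>>0. \<forall>t\<ge>0. \<forall>x\<in>E. exp (- \<alpha> * t) * kernel_op (borel_of E) (p t) f x \<le> f x) \<and>
     (\<forall>x\<in>E. \<forall>f\<in>cone_diff E Rp. \<forall>t\<ge>0.
        continuous (at_right t) (\<lambda>r. kernel_op (borel_of E) (p r) f x))"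

section \<open>Path space and the Markov laws\<close>

text \<open>Left-hand limits of paths lie in \<open>E\<close> automatically when \<open>E\<close> is closed.\<close>

definition cadlag :: "'a::topological_space set \<Rightarrow> (real \<Rightarrow> 'a) set" where
  "cadlag E = {w \<in> {0..} \<rightarrow>\<^sub>E E.
     (\<forall>t\<ge>0. (w \<longlongrightarrow> w t) (at_right t)) \<and> (\<forall>t>0. \<exists>l. (w \<longlongrightarrow> l) (at_left t))}"

definition shift :: "real \<Rightarrow> (real \<Rightarrow> 'a) \<Rightarrow> real \<Rightarrow> 'a" where
  "shift t w = (\<lambda>s\<in>{0..}. w (t + s))"

text \<open>
  \<open>coord_algebra E T\<close> is generated by the coordinates with index in \<open>T\<close>: the paper's
  $\mathcal{G}^0$ is \<open>coord_algebra E {0..}\<close> and its $\mathcal{G}^0_t$ is \<open>coord_algebra E {0..t}\<close>.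
\<close>

definition coord_algebra :: "'a::topological_space set \<Rightarrow> real set \<Rightarrow> (real \<Rightarrow> 'a) measure" where
  "coord_algebra E T = sigma (cadlag E)
     {(\<lambda>w. w t) -` B \<inter> cadlag E | t B. t \<in> T \<and> B \<in> sets (borel_of E)}"

text \<open>The measure \<open>Q\<close> is $\mathbb{P}_\mu$. There is no initial condition \<open>Y\<^sub>0 \<sim> \<mu>\<close>, as \<open>p 0\<close> need not be
  the identity kernel.\<close>

definition markov_law ::
  "'a::topological_space set \<Rightarrow> (real \<Rightarrow> 'a \<Rightarrow> 'a measure) \<Rightarrow> 'a measure \<Rightarrow> (real \<Rightarrow> 'a) measure \<Rightarrow> bool" where
  "markov_law E p \<mu> Q \<longleftrightarrow>
     Q \<in> space (prob_algebra (coord_algebra E {0..})) \<and>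
     (\<forall>f\<in>bounded_measurable (borel_of E).
        (\<forall>s\<ge>0. \<forall>t\<ge>0. AE w in Q.
           real_cond_exp Q (coord_algebra E {0..s}) (\<lambda>w. f (w (t + s))) w =
             kernel_op (borel_of E) (p t) f (w s)) \<and>
        (\<forall>t\<ge>0. (LINT w|Q. f (w t)) = (LINT x|\<mu>. kernel_op (borel_of E) (p t) f x)))"

section \<open>Augmented filtration\<close>

text \<open>Below, \<open>P\<close> is the family of laws, \<open>P \<mu>\<close> being $\mathbb{P}_\mu$ on $\mathcal{G}^0$.\<close>

definition aug_mu ::
  "'a::topological_space set \<Rightarrow> ('a measure \<Rightarrow> (real \<Rightarrow> 'a) measure) \<Rightarrow> 'a measure \<Rightarrow> real \<Rightarrow> (real \<Rightarrow> 'a) measure"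
where
  "aug_mu E P \<mu> t =
     sigma (cadlag E) (sets (coord_algebra E {0..t}) \<union> null_sets (completion (P \<mu>)))"

definition aug_at ::
  "'a::topological_space set \<Rightarrow> ('a measure \<Rightarrow> (real \<Rightarrow> 'a) measure) \<Rightarrow> real \<Rightarrow> (real \<Rightarrow> 'a) measure" where
  "aug_at E P t = sigma (cadlag E)
     {A. A \<subseteq> cadlag E \<and> (\<forall>\<mu>\<in>space (prob_algebra (borel_of E)). A \<in> sets (aug_mu E P \<mu> t))}"

definition aug_all ::
  "'a::topological_space set \<Rightarrow> ('a measure \<Rightarrow> (real \<Rightarrow> 'a) measure) \<Rightarrow> (real \<Rightarrow> 'a) measure" where
  "aug_all E P = sigma (cadlag E)
     {A. A \<subseteq> cadlag E \<and> (\<forall>\<mu>\<in>space (prob_algebra (borel_of E)). A \<in> sets (completion (P \<mu>)))}"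

text \<open>
  Stopping times take values in \<open>[0,\<infinity>]\<close>, so the library's \<open>stopping_time\<close> and \<open>pre_sigma\<close> need the
  filtration indexed by \<open>ennreal\<close>; its value at \<open>\<infinity>\<close> is $\mathcal{G}$. The lemmas \<open>stopping_time_aug\<close> and
  \<open>sets_pre_sigma_aug\<close> spell out the resulting notions.
\<close>

definition aug_filtration ::
  "'a::topological_space set \<Rightarrow> ('a measure \<Rightarrow> (real \<Rightarrow> 'a) measure) \<Rightarrow> ennreal \<Rightarrow> (real \<Rightarrow> 'a) measure" where
  "aug_filtration E P t = (if t = \<infinity> then aug_all E P else aug_at E P (enn2real t))"

abbreviation stopped_algebra ::
  "'a::topological_space set \<Rightarrow> ('a measure \<Rightarrow> (real \<Rightarrow> 'a) measure) \<Rightarrow> ((real \<Rightarrow> 'a) \<Rightarrow> ennreal) \<Rightarrow>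
     (real \<Rightarrow> 'a) measure" where
  "stopped_algebra E P \<tau> \<equiv> filtration.pre_sigma (cadlag E) (aug_filtration E P) \<tau>"

text \<open>The extension of $\mathbb{P}_\mu$ to $\mathcal{G}$.\<close>

definition ext_law ::
  "'a::topological_space set \<Rightarrow> ('a measure \<Rightarrow> (real \<Rightarrow> 'a) measure) \<Rightarrow> 'a measure \<Rightarrow> (real \<Rightarrow> 'a) measure" where
  "ext_law E P \<mu> = restr_to_subalg (completion (P \<mu>)) (aug_all E P)"

text \<open>\<open>\<theta>\<^sub>\<tau> Z\<close> is defined on \<open>{\<tau> < \<infinity>}\<close> only and is extended by \<open>0\<close>.\<close>

definition shift_rv ::
  "((real \<Rightarrow> 'a) \<Rightarrow> ennreal) \<Rightarrow> ((real \<Rightarrow> 'a) \<Rightarrow> real) \<Rightarrow> (real \<Rightarrow> 'a) \<Rightarrow> real" where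
  "shift_rv \<tau> Z w = (if \<tau> w < \<infinity> then Z (shift (enn2real (\<tau> w)) w) else 0)"

definition expect_from ::
  "'a::topological_space set \<Rightarrow> ('a measure \<Rightarrow> (real \<Rightarrow> 'a) measure) \<Rightarrow> 'a \<Rightarrow> ((real \<Rightarrow> 'a) \<Rightarrow> real) \<Rightarrow> real" where
  "expect_from E P x Z = (LINT w|ext_law E P (return (borel_of E) x). Z w)"

section \<open>The sigma-algebras spelled out\<close>

lemma space_coord_algebra [simp]: "space (coord_algebra E T) = cadlag E"
  unfolding coord_algebra_def by (rule space_measure_of) auto

lemma sets_coord_algebra_mono:
  assumes "S \<subseteq> T"
  shows "sets (coord_algebra E S) \<subseteq> sets (coord_algebra E T)"
proof -
  have "sigma_sets (cadlag E) {(\<lambda>w. w t) -` B \<inter> cadlag E | t B. t \<in> S \<and> B \<in> sets (borel_of E)}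
     \<subseteq> sigma_sets (cadlag E) {(\<lambda>w. w t) -` B \<inter> cadlag E | t B. t \<in> T \<and> B \<in> sets (borel_of E)}"
    using assms by (intro sigma_sets_mono') blast
  moreover have "sets (coord_algebra E U) =
      sigma_sets (cadlag E) {(\<lambda>w. w t) -` B \<inter> cadlag E | t B. t \<in> U \<and> B \<in> sets (borel_of E)}" for U
    unfolding coord_algebra_def by (rule sets_measure_of) auto
  ultimately show ?thesis by simp
qed

lemma sigma_algebra_Inter_sets:
  assumes "\<And>i. i \<in> I \<Longrightarrow> space (F i) = \<Omega>"
  shows "sigma_algebra \<Omega> {A. A \<subseteq> \<Omega> \<and> (\<forall>i\<in>I. A \<in> sets (F i))}"
  unfolding sigma_algebra_iff2
proof (intro conjI ballI allI impI)
  fix s assume s: "s \<in> {A. A \<subseteq> \<Omega> \<and> (\<forall>i\<in>I. A \<in> sets (F i))}"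
  have "\<Omega> - s \<in> sets (F i)" if "i \<in> I" for i
    using s that assms[OF that] sets.compl_sets[of s "F i"] by auto
  then show "\<Omega> - s \<in> {A. A \<subseteq> \<Omega> \<and> (\<forall>i\<in>I. A \<in> sets (F i))}" by auto
qed auto

context
  fixes E :: "'a::topological_space set" and P :: "'a measure \<Rightarrow> (real \<Rightarrow> 'a) measure"
  assumes P: "\<And>\<mu>. \<mu> \<in> space (prob_algebra (borel_of E)) \<Longrightarrow>
    P \<mu> \<in> space (prob_algebra (coord_algebra E {0..}))"
begin

lemma P_space: "\<mu> \<in> space (prob_algebra (borel_of E)) \<Longrightarrow> space (P \<mu>) = cadlag E"
  and P_sets: "\<mu> \<in> space (prob_algebra (borel_of E)) \<Longrightarrow> sets (P \<mu>) = sets (coord_algebra E {0..})"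
  using P[of \<mu>] sets_eq_imp_space_eq[of "P \<mu>" "coord_algebra E {0..}"]
  by (auto simp: space_prob_algebra)

lemma aug_mu_generator:
  assumes "\<mu> \<in> space (prob_algebra (borel_of E))"
  shows "sets (coord_algebra E {0..t}) \<union> null_sets (completion (P \<mu>)) \<subseteq> Pow (cadlag E)"
  using sets.space_closed[of "coord_algebra E {0..t}"] sets.space_closed[of "completion (P \<mu>)"]
    P_space[OF assms] by auto

lemma space_aug_mu: "\<mu> \<in> space (prob_algebra (borel_of E)) \<Longrightarrow> space (aug_mu E P \<mu> t) = cadlag E"
  unfolding aug_mu_def by (rule space_measure_of) (rule aug_mu_generator)

lemma sets_aug_mu: "\<mu> \<in> space (prob_algebra (borel_of E)) \<Longrightarrow> sets (aug_mu E P \<mu> t) =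
    sigma_sets (cadlag E) (sets (coord_algebra E {0..t}) \<union> null_sets (completion (P \<mu>)))"
  unfolding aug_mu_def by (rule sets_measure_of) (rule aug_mu_generator)

lemma sets_aug_mu_mono:
  assumes "\<mu> \<in> space (prob_algebra (borel_of E))" "s \<le> t"
  shows "sets (aug_mu E P \<mu> s) \<subseteq> sets (aug_mu E P \<mu> t)"
  using sets_coord_algebra_mono[of "{0..s}" "{0..t}" E] assms
  by (auto simp: sets_aug_mu intro!: sigma_sets_mono')

lemma sets_aug_mu_completion:
  assumes "\<mu> \<in> space (prob_algebra (borel_of E))"
  shows "sets (aug_mu E P \<mu> t) \<subseteq> sets (completion (P \<mu>))"
proof -
  have "sets (coord_algebra E {0..t}) \<union> null_sets (completion (P \<mu>)) \<subseteq> sets (completion (P \<mu>))"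
    using sets_coord_algebra_mono[of "{0..t}" "{0..}" E] P_sets[OF assms] by auto
  from sets.sigma_sets_subset[OF this] show ?thesis
    using assms by (simp add: sets_aug_mu P_space)
qed

lemma sets_aug_at: "sets (aug_at E P t) =
    {A. A \<subseteq> cadlag E \<and> (\<forall>\<mu>\<in>space (prob_algebra (borel_of E)). A \<in> sets (aug_mu E P \<mu> t))}"
  unfolding aug_at_def
  by (intro sigma_algebra.sets_measure_of_eq sigma_algebra_Inter_sets space_aug_mu)

lemma sets_aug_all: "sets (aug_all E P) =
    {A. A \<subseteq> cadlag E \<and> (\<forall>\<mu>\<in>space (prob_algebra (borel_of E)). A \<in> sets (completion (P \<mu>)))}"
  unfolding aug_all_def
  by (intro sigma_algebra.sets_measure_of_eq sigma_algebra_Inter_sets) (simp add: P_space)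

lemma space_aug_at: "space (aug_at E P t) = cadlag E"
  unfolding aug_at_def by (rule space_measure_of) auto

lemma space_aug_all: "space (aug_all E P) = cadlag E"
  unfolding aug_all_def by (rule space_measure_of) auto

lemma filtration_aug: "filtration (cadlag E) (aug_filtration E P)"
proof
  show "space (aug_filtration E P i) = cadlag E" for i
    by (simp add: aug_filtration_def space_aug_at space_aug_all)
  fix i j :: ennreal assume "i \<le> j"
  then have "j \<noteq> \<infinity> \<Longrightarrow> enn2real i \<le> enn2real j" "j \<noteq> \<infinity> \<Longrightarrow> i \<noteq> \<infinity>"
    by (auto simp: enn2real_mono top.not_eq_extremum top_unique)
  then show "sets (aug_filtration E P i) \<le> sets (aug_filtration E P j)"
    using sets_aug_mu_mono sets_aug_mu_completion
    by (auto simp: aug_filtration_def sets_aug_at sets_aug_all subset_iff)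
qed

lemma stopping_time_aug:
  "stopping_time (aug_filtration E P) \<tau> \<longleftrightarrow>
     (\<forall>t\<ge>0. {w \<in> cadlag E. \<tau> w \<le> ennreal t} \<in> sets (aug_at E P t))"
proof -
  have "stopping_time (aug_filtration E P) \<tau> \<longleftrightarrow>
      (\<forall>t. {w \<in> cadlag E. \<tau> w \<le> t} \<in> sets (aug_filtration E P t))"
    by (simp add: stopping_time_def pred_def filtration.space_F[OF filtration_aug])
  also have "\<dots> \<longleftrightarrow> (\<forall>t\<ge>0. {w \<in> cadlag E. \<tau> w \<le> ennreal t} \<in> sets (aug_at E P t))"
  proof safe
    fix t :: real
    assume *: "\<forall>t. {w \<in> cadlag E. \<tau> w \<le> t} \<in> sets (aug_filtration E P t)" and "0 \<le> t"
    then show "{w \<in> cadlag E. \<tau> w \<le> ennreal t} \<in> sets (aug_at E P t)"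
      using *[rule_format, of "ennreal t"] by (simp add: aug_filtration_def)
  next
    fix t :: ennreal
    assume "\<forall>t\<ge>0. {w \<in> cadlag E. \<tau> w \<le> ennreal t} \<in> sets (aug_at E P t)"
    then show "{w \<in> cadlag E. \<tau> w \<le> t} \<in> sets (aug_filtration E P t)"
      using sets.top[of "aug_all E P"]
      by (cases t) (auto simp: aug_filtration_def space_aug_all)
  qed
  finally show ?thesis .
qed

lemma sets_pre_sigma_aug:
  assumes "stopping_time (aug_filtration E P) \<tau>"
  shows "sets (stopped_algebra E P \<tau>) =
    {A \<in> sets (aug_all E P). \<forall>t\<ge>0. {w \<in> A. \<tau> w \<le> ennreal t} \<in> sets (aug_at E P t)}"
  unfolding filtration.sets_pre_sigma[OF filtration_aug assms]
proof safe
  fix A assume *: "\<forall>t. {w \<in> A. \<tau> w \<le> t} \<in> sets (aug_filtration E P t)"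
  show "A \<in> sets (aug_all E P)"
    using *[rule_format, of \<infinity>] by (simp add: aug_filtration_def)
  fix t :: real assume "0 \<le> t"
  then show "{w \<in> A. \<tau> w \<le> ennreal t} \<in> sets (aug_at E P t)"
    using *[rule_format, of "ennreal t"] by (simp add: aug_filtration_def)
next
  fix A and t :: ennreal
  assume "A \<in> sets (aug_all E P)"
    and "\<forall>t\<ge>0. {w \<in> A. \<tau> w \<le> ennreal t} \<in> sets (aug_at E P t)"
  then show "{w \<in> A. \<tau> w \<le> t} \<in> sets (aug_filtration E P t)"
    by (cases t) (auto simp: aug_filtration_def)
qed

end

end

theory Submission
  imports Defs
begin

text \<open>
  Approximating a random time \<open>T\<close> from the right by times with values in a grid, the simple Markov
  property and right continuity of paths give, for \<open>f\<close> in the cone,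
  $E \int_0^\infty e^{-\alpha t} f(Y_{T+t}) dt = E\, U^\alpha f(Y_T)$ on each event of the past of \<open>T\<close>,
  because \<open>U\<^sup>\<alpha> f\<close> is again continuous. Both \<open>E f(Y\<^bsub>T+t\<^esub>)\<close> and \<open>E P\<^sub>t f(Y\<^sub>T)\<close> are right continuous in \<open>t\<close> and have the
  same Laplace transform, so they agree; as the differences of cone elements approximate
  \<open>C\<^sub>0(E)\<close>, the two laws agree. Applying this to the optional times \<open>T + s\<close> in turn yields all
  finite-dimensional distributions of the shifted path. A universally measurable \<open>Z\<close> is replaced by a Borel
  modification with respect to the law started from the distribution of \<open>Y\<^sub>T\<close>. Right continuity of the
  filtration is the case of a constant time \<open>T\<close>.
\<close>

section \<open>Uniqueness of transforms and measures\<close>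

text \<open>P_t f need not be continuous for f in the cone, so one cannot let grid times tend to T
  in E P_t f(Y) at a fixed t. The resolvent preserves the cone, hence averaging over an exponential
  time comes before the limit, and right continuity in t recovers the fixed time afterwards.
  Conditional expectations are postponed to the end: an event A of the past restricts the measure,
  and finite measures on E are compared, namely the law of Y at T + s on A and the image under
  \<open>p s\<close> of the law of Y at T on A. Random times need only satisfy that A \<inter> {T <
  t} lies in the past of t. This class contains stopping times where they are finite, is closed
  under adding constants and under restricting A by the position at T, and contains a constant time
  t with any event in the right limit of the filtration at t. Thus right continuity follows from the
  strong Markov property, and then serves to show that the position at a stopping time is measurable
  with respect to its past. As \<open>p 0\<close> may move points, the path started from \<mu> has
  at time 0 the law \<open>\<mu> \<bind> p 0\<close>; even the case s = 0 has content.\<close>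

text \<open>In the variable exp (- t) the transforms at integer rates are moments on [0,1]. By
  Weierstrass approximation g is orthogonal to every continuous function of exp (- t), and a bump
  just to the right of a, where g keeps its sign, rules out g a \<noteq> 0.\<close>

lemma exponential_transform_eq_0:
  fixes g :: "real \<Rightarrow> real"
  assumes meas [measurable]: "g \<in> borel_measurable borel" and bd: "\<And>t. \<bar>g t\<bar> \<le> C"
    and zero: "\<And>n::nat. (\<integral>t. g t \<partial>density lborel (exponential_density (real (Suc n)))) = 0"
    and rc: "(g \<longlongrightarrow> g a) (at_right a)" and a: "0 \<le> a"
  shows "g a = 0"
proof (rule ccontr)
  assume ga: "g a \<noteq> 0"
  define D where "D = density lborel (exponential_density 1)"
  interpret D: prob_space D
    unfolding D_def by (rule prob_space_exponential_density) simp
  have setsD [measurable_cong]: "sets D = sets borel" by (simp add: D_def)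
  have AED: "AE t in D. 0 \<le> t"
    unfolding D_def by (subst AE_density) (auto simp: exponential_density_def)
  have intD: "\<And>(f :: real \<Rightarrow> real) B. f \<in> borel_measurable borel \<Longrightarrow> (\<And>t. 0 \<le> t \<Longrightarrow> \<bar>f t\<bar> \<le> B) \<Longrightarrow>
    integrable D (\<lambda>t. f t * g t)"
  proof -
    fix f :: "real \<Rightarrow> real" and B assume [measurable]: "f \<in> borel_measurable borel"
      and B: "\<And>t. 0 \<le> t \<Longrightarrow> \<bar>f t\<bar> \<le> B"
    show "integrable D (\<lambda>t. f t * g t)"
    proof (rule D.integrable_const_bound[where B = "B * C"])
      show "AE t in D. norm (f t * g t) \<le> B * C"
        using AED
        by eventually_elim (auto simp: abs_mult intro!: mult_mono bd B order_trans[OF abs_ge_zero B])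
    qed simp
  qed
  \<comment> \<open>The density with rate n + 1 is (n + 1) exp (- n t) times the density with rate
    1, so it yields the n-th moment.\<close>
  have mono: "(\<integral>t. exp (- t) ^ n * g t \<partial>D) = 0" for n
  proof -
    have "(\<integral>t. g t \<partial>density lborel (exponential_density (real (Suc n)))) =
        (\<integral>t. exponential_density (real (Suc n)) t * g t \<partial>lborel)"
      by (subst integral_density) (auto simp: exponential_density_def)
    also have "\<dots> = (\<integral>t. real (Suc n) * (exponential_density 1 t * (exp (- t) ^ n * g t)) \<partial>lborel)"
      by (intro Bochner_Integration.integral_cong refl)
        (auto simp: exponential_density_def exp_of_nat_mult[symmetric] exp_add[symmetric] algebra_simps)
    also have "\<dots> = real (Suc n) * (\<integral>t. exp (- t) ^ n * g t \<partial>D)"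
      unfolding D_def by (subst integral_density) (auto simp: exponential_density_def)
    finally show ?thesis using zero[of n] by simp
  qed
  have cont0: "(\<integral>t. \<phi> (exp (- t)) * g t \<partial>D) = 0" if \<phi>: "continuous_on UNIV \<phi>" for \<phi> :: "real \<Rightarrow> real"
  proof -
    have [measurable]: "\<phi> \<in> borel_measurable borel" using \<phi> by (rule borel_measurable_continuous_onI)
    obtain B where B: "\<And>x. x \<in> {0..1} \<Longrightarrow> \<bar>\<phi> x\<bar> \<le> B"
      using compact_imp_bounded[OF compact_continuous_image[OF continuous_on_subset[OF \<phi>] compact_Icc[of 0 1]]]
      unfolding bounded_iff by (metis UNIV_I imageI real_norm_def subsetI)
    have "\<bar>\<integral>t. \<phi> (exp (- t)) * g t \<partial>D\<bar> \<le> e * C" if e: "0 < e" for e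
    proof -
      obtain q where q: "real_polynomial_function q" "\<And>x. x \<in> {0..1} \<Longrightarrow> \<bar>\<phi> x - q x\<bar> < e"
        using Stone_Weierstrass_real_polynomial_function[OF compact_Icc[of 0 1] continuous_on_subset[OF \<phi>] e]
        by auto
      obtain c N where c: "q = (\<lambda>x. \<Sum>i\<le>N. c i * x ^ i)"
        using q(1) by (auto simp: real_polynomial_function_iff_sum)
      have [measurable]: "q \<in> borel_measurable borel" unfolding c by measurable
      have iq: "integrable D (\<lambda>t. exp (- t) ^ i * g t)" for i
        by (intro intD[of _ 1]) (auto intro: power_le_one)
      have "(\<integral>t. q (exp (- t)) * g t \<partial>D) = (\<integral>t. (\<Sum>i\<le>N. c i * (exp (- t) ^ i * g t)) \<partial>D)"
        unfolding c by (simp add: sum_distrib_right mult.assoc)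
      also have "\<dots> = 0"
        by (subst Bochner_Integration.integral_sum) (auto simp: mono intro!: iq)
      finally have q0: "(\<integral>t. q (exp (- t)) * g t \<partial>D) = 0" .
      have i1: "integrable D (\<lambda>t. \<phi> (exp (- t)) * g t)"
        using B by (intro intD[of _ B]) auto
      have i2: "integrable D (\<lambda>t. q (exp (- t)) * g t)"
        unfolding c using iq by (auto simp: sum_distrib_right mult.assoc intro!: Bochner_Integration.integrable_sum)
      have "\<bar>\<integral>t. \<phi> (exp (- t)) * g t \<partial>D\<bar> = \<bar>\<integral>t. \<phi> (exp (- t)) * g t - q (exp (- t)) * g t \<partial>D\<bar>"
        using q0 by (simp add: Bochner_Integration.integral_diff[OF i1 i2])
      also have "\<dots> \<le> (\<integral>t. \<bar>\<phi> (exp (- t)) * g t - q (exp (- t)) * g t\<bar> \<partial>D)"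
        by (rule integral_abs_bound)
      also have "\<dots> \<le> (\<integral>t. e * C \<partial>D)"
      proof (rule integral_mono_AE)
        show "integrable D (\<lambda>t. \<bar>\<phi> (exp (- t)) * g t - q (exp (- t)) * g t\<bar>)" using i1 i2 by simp
        show "AE t in D. \<bar>\<phi> (exp (- t)) * g t - q (exp (- t)) * g t\<bar> \<le> e * C"
          using AED
        proof eventually_elim
          case (elim t)
          then have "\<bar>\<phi> (exp (- t)) - q (exp (- t))\<bar> \<le> e" using q(2)[of "exp (- t)"] by simp
          then show ?case
            unfolding left_diff_distrib[symmetric] abs_mult using e by (intro mult_mono bd) auto
        qed
      qed simp
      finally show ?thesis by (simp add: D.prob_space)
    qed
    note * = this
    have C: "0 \<le> C" using bd[of 0] by linarith
    show ?thesis
    proof (rule ccontr)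
      assume "(\<integral>t. \<phi> (exp (- t)) * g t \<partial>D) \<noteq> 0"
      then have pos: "0 < \<bar>\<integral>t. \<phi> (exp (- t)) * g t \<partial>D\<bar>" (is "0 < ?I") by simp
      \<comment> \<open>This choice of e leaves at most half of \<open>?I\<close>; the summand 1
        keeps the denominator positive when C = 0.\<close>
      have "?I \<le> ?I / (2 * (C + 1)) * C" using pos C by (intro *) auto
      also have "\<dots> < ?I" using pos C by (simp add: field_simps add_nonneg_pos)
      finally show False by simp
    qed
  qed
  \<comment> \<open>Multiplying by g a makes the function positive just to the right of a, whatever
    the sign of g a.\<close>
  have "((\<lambda>t. g t * g a) \<longlongrightarrow> g a * g a) (at_right a)" by (intro tendsto_intros rc)
  moreover have "0 < g a * g a" using ga by (auto simp: zero_less_mult_iff)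
  ultimately have "\<forall>\<^sub>F t in at_right a. 0 < g t * g a" by (rule order_tendstoD)
  then obtain b where b: "a < b" "\<And>t. a < t \<Longrightarrow> t < b \<Longrightarrow> 0 < g t * g a"
    unfolding eventually_at_right_field by auto
  \<comment> \<open>As a function of exp (- t), the product is positive exactly between its zeros
    exp (- b) and exp (- a), that is, for a < t < b.\<close>
  define \<phi> where "\<phi> = (\<lambda>x. max 0 ((x - exp (- b)) * (exp (- a) - x)))"
  have \<phi>: "continuous_on UNIV \<phi>" unfolding \<phi>_def by (intro continuous_intros)
  have [measurable]: "\<phi> \<in> borel_measurable borel" using \<phi> by (rule borel_measurable_continuous_onI)
  have pos: "0 < \<phi> (exp (- t)) \<longleftrightarrow> a < t \<and> t < b" for t
    using b(1) by (auto simp: \<phi>_def zero_less_mult_iff less_max_iff_disj)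
  have \<phi>0: "0 \<le> \<phi> x" for x by (simp add: \<phi>_def)
  have nn: "0 \<le> \<phi> (exp (- t)) * g t * g a" for t
  proof (cases "a < t \<and> t < b")
    case True
    then show ?thesis using b(2)[of t] \<phi>0[of "exp (- t)"] by (simp add: mult.assoc)
  next
    case False
    then have "\<phi> (exp (- t)) = 0" using pos[of t] \<phi>0[of "exp (- t)"] by auto
    then show ?thesis by simp
  qed
  obtain B where B: "\<And>x. x \<in> {0..1} \<Longrightarrow> \<bar>\<phi> x\<bar> \<le> B"
    using compact_imp_bounded[OF compact_continuous_image[OF continuous_on_subset[OF \<phi>] compact_Icc[of 0 1]]]
    unfolding bounded_iff by (metis UNIV_I imageI real_norm_def subsetI)
  have i: "integrable D (\<lambda>t. \<phi> (exp (- t)) * g t)" using B by (intro intD[of _ B]) auto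
  have "(\<integral>t. \<phi> (exp (- t)) * g t * g a \<partial>D) = 0" using cont0[OF \<phi>] by simp
  then have "AE t in D. \<phi> (exp (- t)) * g t * g a = 0"
    using nn i by (subst (asm) integral_nonneg_eq_0_iff_AE) auto
  then have "AE t in D. \<not> (a < t \<and> t < b)"
  proof eventually_elim
    case (elim t)
    then show ?case using b(2)[of t] pos[of t] by auto
  qed
  then have "AE t in lborel. 0 < exponential_density 1 t \<longrightarrow> \<not> (a < t \<and> t < b)"
    unfolding D_def by (subst (asm) AE_density) (auto simp: exponential_density_def)
  then have "AE t in lborel. t \<notin> {a<..<b}"
    by eventually_elim (use a in \<open>auto simp: exponential_density_def\<close>)
  then have "emeasure lborel {a<..<b} = 0"
    by (subst (asm) AE_iff_measurable[where N = "{a<..<b}"]) auto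
  then show False using b(1) by simp
qed

text \<open>Compact subsets of E are stable under intersection and generate its Borel sets, because
  a closed set is the union of its intersections with balls of integer radius; the same balls
  exhaust E.\<close>

lemma borel_of_eqI_compact:
  fixes E :: "'a::euclidean_space set"
  assumes E: "closed E" and M: "finite_measure M" "sets M = sets (borel_of E)" "sets N = sets (borel_of E)"
    and eq: "\<And>K. compact K \<Longrightarrow> K \<subseteq> E \<Longrightarrow> emeasure M K = emeasure N K"
  shows "M = N"
proof -
  let ?G = "{K. compact K \<and> K \<subseteq> E}"
  have comp: "closed K \<Longrightarrow> compact (K \<inter> cball 0 n)" for n :: real and K :: "'a set" by (simp add: closed_Int_compact)
  have gen: "sets (borel_of E) = sigma_sets E ?G"
  proof (rule antisym)
    show "sigma_sets E ?G \<subseteq> sets (borel_of E)"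
    proof -
      have "?G \<subseteq> sets (borel_of E)"
        by (auto simp: sets_restrict_space intro!: image_eqI[OF _ borel_compact])
      from sets.sigma_sets_subset[OF this] show ?thesis by (simp add: space_restrict_space)
    qed
    have "sets (borel :: 'a measure) = sigma_sets UNIV {K. closed K}"
      by (simp add: borel_eq_closed)
    moreover have "(\<inter>) E ` sigma_sets UNIV {K. closed K} = sigma_sets E ((\<inter>) E ` {K. closed K})"
      using E by (intro sigma_sets_Int) auto
    ultimately have "sets (borel_of E) = sigma_sets E ((\<inter>) E ` {K. closed K})"
      by (simp add: sets_restrict_space)
    also have "\<dots> \<subseteq> sigma_sets E ?G"
    proof (rule sigma_sets_mono, safe)
      fix K :: "'a set" assume K: "closed K"
      have "E \<inter> K = (\<Union>n::nat. (E \<inter> K) \<inter> cball 0 (real n))"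
        using real_arch_simple by (auto simp: dist_norm)
      moreover have "(E \<inter> K) \<inter> cball 0 (real n) \<in> ?G" for n :: nat using E K comp by auto
      ultimately show "E \<inter> K \<in> sigma_sets E ?G"
        by (metis (no_types, lifting) sigma_sets.Basic sigma_sets.Union)
    qed
    finally show "sets (borel_of E) \<subseteq> sigma_sets E ?G" .
  qed
  show ?thesis
  proof (rule measure_eqI_generator_eq[where E = ?G and \<Omega> = E and A = "\<lambda>n. E \<inter> cball 0 (real n)"])
    show "Int_stable ?G" by (auto simp: Int_stable_def)
    show "(\<Union>i. E \<inter> cball 0 (real i)) = E" using real_arch_simple by (auto simp: dist_norm)
    show "emeasure M (E \<inter> cball 0 (real i)) \<noteq> \<infinity>" for i
      using M(1) by (simp add: finite_measure.emeasure_eq_measure)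
  qed (use E eq gen M comp in auto)
qed

text \<open>The indicator of a nonempty compact K is the limit of the functions max 0 (1 - n dist(x,
  K)), which for n \<ge> 1 vanish at distance at least 1 from K and hence tend to 0 at
  infinity.\<close>

lemma borel_of_eqI_C_zero:
  fixes E :: "'a::euclidean_space set"
  assumes E: "closed E" and M: "finite_measure M" "sets M = sets (borel_of E)"
    and N: "finite_measure N" "sets N = sets (borel_of E)"
    and eq: "\<And>f. f \<in> C_zero E \<Longrightarrow> (\<integral>x. f x \<partial>M) = (\<integral>x. f x \<partial>N)"
  shows "M = N"
proof (rule borel_of_eqI_compact[OF E M N(2)])
  fix K assume K: "compact K" "K \<subseteq> E"
  show "emeasure M K = emeasure N K"
  \<comment> \<open>\<open>infdist\<close> to the empty set is 0, so there the approximating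
    functions would be constantly 1.\<close>
  proof (cases "K = {}")
    case False
    define f where "f = (\<lambda>n x. max 0 (1 - real n * infdist x K))"
    have cont: "continuous_on UNIV (f n)" for n unfolding f_def by (intro continuous_intros)
    then have [measurable]: "f n \<in> borel_measurable borel" for n by (rule borel_measurable_continuous_onI)
    have bd: "\<bar>f n x\<bar> \<le> 1" for n x by (auto simp: f_def infdist_nonneg)
    have lim: "(\<lambda>n. f n x) \<longlonglongrightarrow> indicator K x" for x
    proof (cases "x \<in> K")
      case False
      then have pos: "0 < infdist x K"
        using K(1) \<open>K \<noteq> {}\<close> in_closed_iff_infdist_zero[of K x] infdist_nonneg[of x K]
        by (auto simp: compact_imp_closed less_le)
      obtain N where N: "1 < real N * infdist x K" using reals_Archimedean3[OF pos] by auto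
      have "f n x = 0" if "N \<le> n" for n
      proof -
        have "real N * infdist x K \<le> real n * infdist x K" using that pos by (intro mult_right_mono) auto
        then show ?thesis using N by (simp add: f_def)
      qed
      then show ?thesis using False
        by (intro tendsto_eventually) (auto simp: eventually_sequentially)
    qed (simp add: f_def)
    obtain r where r: "K \<subseteq> cball 0 r" 
      using compact_imp_bounded[OF K(1)] by (auto simp: bounded_iff subset_iff)
    have far: "f n x = 0" if n: "1 \<le> n" and x: "r + 1 \<le> norm x" for n x
    proof -
      have "1 \<le> infdist x K"
        unfolding infdist_notempty[OF False]
      proof (rule cINF_greatest[OF False])
        fix y assume "y \<in> K"
        then have "norm y \<le> r" using r by auto
        then show "1 \<le> dist x y" using x norm_triangle_ineq2[of x y] by (simp add: dist_norm)
      qed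
      then have "1 * 1 \<le> real n * infdist x K" using n by (intro mult_mono) auto
      then show ?thesis by (simp add: f_def)
    qed
    \<comment> \<open>The index starts at 1: the function for n = 0 is constantly 1 and does not
      tend to 0 when E is unbounded.\<close>
    have C0: "restrict (f (Suc n)) E \<in> C_zero E" for n
    proof -
      have "\<forall>\<^sub>F x in inf at_infinity (principal E). restrict (f (Suc n)) E x = 0"
        unfolding eventually_inf_principal eventually_at_infinity
        using far[of "Suc n"] by (intro exI[of _ "r + 1"]) auto
      then have "(restrict (f (Suc n)) E \<longlongrightarrow> 0) (inf at_infinity (principal E))"
        by (rule tendsto_eventually)
      moreover have "bounded (restrict (f (Suc n)) E ` E)" using bd by (auto simp: bounded_iff)
      moreover have "continuous_on E (restrict (f (Suc n)) E)"
        using continuous_on_subset[OF cont, of E "Suc n"] by (rule continuous_on_eq) auto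
      ultimately show ?thesis by (simp add: C_zero_def)
    qed
    have KL: "(\<lambda>n. \<integral>x. restrict (f (Suc n)) E x \<partial>L) \<longlonglongrightarrow> measure L K"
      if L: "finite_measure L" "sets L = sets (borel_of E)" for L
    proof -
      interpret L: finite_measure L by fact
      note L(2)[measurable_cong]
      have sp: "space L = E" using sets_eq_imp_space_eq[OF L(2)] by (simp add: space_restrict_space)
      have [measurable]: "f n \<in> borel_measurable L" for n
        by (simp add: measurable_cong_sets[OF L(2) refl] measurable_restrict_space1)
      have Ks [measurable]: "K \<in> sets L" using K by (auto simp: L(2) sets_restrict_space borel_compact)
      have "(\<lambda>n. \<integral>x. f (Suc n) x \<partial>L) \<longlonglongrightarrow> (\<integral>x. indicator K x \<partial>L)"
        using bd by (intro integral_dominated_convergence[where w = "\<lambda>_. 1"])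
          (auto simp: Ks intro!: LIMSEQ_Suc lim)
      moreover have "(\<integral>x. restrict (f (Suc n)) E x \<partial>L) = (\<integral>x. f (Suc n) x \<partial>L)" for n
        by (intro Bochner_Integration.integral_cong) (auto simp: sp)
      ultimately show ?thesis using sets.sets_into_space[OF Ks] by (simp add: Int_absorb2)
    qed
    have "measure M K = measure N K"
      using KL[OF N] LIMSEQ_unique[OF KL[OF M]] unfolding eq[OF C0] by blast
    then show ?thesis using M(1) N(1) by (simp add: finite_measure.emeasure_eq_measure)
  qed simp
qed

section \<open>Transition function and resolvent\<close>

lemma (in finite_measure) abs_integral_le:
  fixes f :: "'a \<Rightarrow> real"
  assumes [measurable]: "f \<in> borel_measurable M" and bd: "\<And>x. x \<in> space M \<Longrightarrow> \<bar>f x\<bar> \<le> C"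
  shows "\<bar>\<integral>x. f x \<partial>M\<bar> \<le> C * measure M (space M)"
proof -
  have "integrable M f" using bd by (intro integrable_const_bound[where B = C]) auto
  have "\<bar>\<integral>x. f x \<partial>M\<bar> \<le> (\<integral>x. \<bar>f x\<bar> \<partial>M)" by (rule integral_abs_bound)
  also have "\<dots> \<le> (\<integral>x. C \<partial>M)"
    using bd \<open>integrable M f\<close> by (intro integral_mono) auto
  finally show ?thesis by (simp add: mult.commute)
qed

locale engelbert_process =
  fixes E :: "'a::euclidean_space set"
    and u :: "real \<Rightarrow> 'a \<Rightarrow> 'a measure"
    and Rp :: "('a \<Rightarrow> real) set"
    and p :: "real \<Rightarrow> 'a \<Rightarrow> 'a measure"
    and P :: "'a measure \<Rightarrow> (real \<Rightarrow> 'a) measure"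
  assumes closed_E: "closed E"
    and resolvent: "engelbert_resolvent E u Rp"
    and C_zero_subset: "C_zero E \<subseteq> sup_closure E (cone_diff E Rp)"
    and transition: "engelbert_transition_function E u Rp p"
    and law: "\<And>\<mu>. \<mu> \<in> space (prob_algebra (borel_of E)) \<Longrightarrow> markov_law E p \<mu> (P \<mu>)"
begin

abbreviation M where "M \<equiv> borel_of E"

lemma space_M [simp]: "space M = E"
  by (simp add: space_restrict_space)

lemma p_prob [measurable]: "0 \<le> t \<Longrightarrow> p t \<in> M \<rightarrow>\<^sub>M prob_algebra M"
  using transition by (simp add: engelbert_transition_function_def markov_transition_function_def)

lemma p_subprob: "0 \<le> t \<Longrightarrow> p t \<in> M \<rightarrow>\<^sub>M subprob_algebra M"
  by (intro measurable_prob_algebraD p_prob)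

lemma p_D:
  assumes "0 \<le> t" "x \<in> E"
  shows "prob_space (p t x)" "sets (p t x) = sets M" "space (p t x) = E"
proof -
  show "prob_space (p t x)" "sets (p t x) = sets M"
    using measurable_space[OF p_prob[OF assms(1)], of x] assms(2) by (auto simp: space_prob_algebra)
  from sets_eq_imp_space_eq[OF this(2)] show "space (p t x) = E" by simp
qed

text \<open>Clamping time by \<open>max 0\<close> gives a kernel on the whole time line, so Fubini
  against densities on \<open>lborel\<close> applies without restricted spaces.\<close>

lemma p_joint: "(\<lambda>(t, x). p (max 0 t) x) \<in> borel \<Otimes>\<^sub>M M \<rightarrow>\<^sub>M subprob_algebra M"
proof (rule measurable_prob_algebraD, rule measurable_prob_algebra_generated)
  show "sets M = sigma_sets E (sets M)" using sets.sigma_sets_eq[of M] by simp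
  show "Int_stable (sets M)" by (auto simp: Int_stable_def)
  show "sets M \<subseteq> Pow E" using sets.space_closed[of M] by simp
  show "prob_space (case tx of (t, x) \<Rightarrow> p (max 0 t) x)" "sets (case tx of (t, x) \<Rightarrow> p (max 0 t) x) = sets M"
    if "tx \<in> space (borel \<Otimes>\<^sub>M M)" for tx
    using that p_D by (auto simp: space_pair_measure split: prod.split)
  fix B assume B: "B \<in> sets M"
  have 1: "(\<lambda>z. (max 0 (fst z), snd z)) \<in> borel \<Otimes>\<^sub>M M \<rightarrow>\<^sub>M borel_of {0::real..} \<Otimes>\<^sub>M M"
    by (intro measurable_Pair measurable_restrict_space2 measurable_snd) auto
  have 2: "(\<lambda>(t, x). measure (p t x) B) \<in> borel_measurable (borel_of {0..} \<Otimes>\<^sub>M M)"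
    using transition B by (simp add: engelbert_transition_function_def markov_transition_function_def)
  have "(\<lambda>tx. measure (case tx of (t, x) \<Rightarrow> p (max 0 t) x) B) \<in> borel_measurable (borel \<Otimes>\<^sub>M M)"
    using measurable_compose[OF 1 2] by (simp add: case_prod_beta')
  then have "(\<lambda>tx. ennreal (measure (case tx of (t, x) \<Rightarrow> p (max 0 t) x) B)) \<in> borel_measurable (borel \<Otimes>\<^sub>M M)"
    by simp
  then show "(\<lambda>tx. emeasure (case tx of (t, x) \<Rightarrow> p (max 0 t) x) B) \<in> borel_measurable (borel \<Otimes>\<^sub>M M)"
    by (rule measurable_cong[THEN iffD1, rotated])
      (use p_D(1) in \<open>auto simp: space_pair_measure finite_measure.emeasure_eq_measure prob_space_def split: prod.split\<close>)
qed

lemma bounded_measurableD: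
  assumes "f \<in> bounded_measurable M"
  shows "f \<in> borel_measurable M" "\<exists>C\<ge>0. \<forall>x\<in>E. \<bar>f x\<bar> \<le> C"
proof -
  show "f \<in> borel_measurable M" using assms by (simp add: bounded_measurable_def)
  obtain C where "\<forall>x\<in>E. \<bar>f x\<bar> \<le> C" using assms by (auto simp: bounded_measurable_def bounded_iff)
  then show "\<exists>C\<ge>0. \<forall>x\<in>E. \<bar>f x\<bar> \<le> C" by (intro exI[of _ "max 0 C"]) fastforce
qed

lemma integral_p_joint [measurable]:
  fixes f :: "'a \<Rightarrow> real"
  assumes "f \<in> borel_measurable M"
  shows "(\<lambda>(t, x). \<integral>y. f y \<partial>p (max 0 t) x) \<in> borel_measurable (borel \<Otimes>\<^sub>M M)"
  using measurable_compose[OF p_joint integral_measurable_subprob_algebra[OF assms]]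
  by (simp add: case_prod_beta')

lemma integral_p_measurable:
  fixes f :: "'a \<Rightarrow> real"
  assumes "f \<in> borel_measurable M" "0 \<le> t"
  shows "(\<lambda>x. \<integral>y. f y \<partial>p t x) \<in> borel_measurable M"
  by (rule measurable_compose[OF p_subprob integral_measurable_subprob_algebra]) (use assms in auto)

lemma abs_integral_p_le:
  fixes f :: "'a \<Rightarrow> real"
  assumes "f \<in> borel_measurable M" "\<forall>x\<in>E. \<bar>f x\<bar> \<le> C" "0 \<le> t" "x \<in> E"
  shows "\<bar>\<integral>y. f y \<partial>p t x\<bar> \<le> C"
proof -
  interpret prob_space "p t x" using p_D assms by blast
  have "\<bar>\<integral>y. f y \<partial>p t x\<bar> \<le> C * measure (p t x) (space (p t x))"
    using assms p_D[OF assms(3,4)]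
    by (intro abs_integral_le) (auto simp: measurable_cong_sets[OF p_D(2)[OF assms(3,4)] refl])
  then show ?thesis by (simp add: prob_space)
qed

lemma kernel_op_p: "x \<in> E \<Longrightarrow> kernel_op M (p t) f x = (\<integral>y. f y \<partial>p t x)"
  by (simp add: kernel_op_def)

lemma resolvent_eq: "0 < \<alpha> \<Longrightarrow> f \<in> bounded_measurable M \<Longrightarrow> x \<in> E \<Longrightarrow>
    kernel_op M (u \<alpha>) f x = (LINT t:{0..}|lborel. exp (- \<alpha> * t) * kernel_op M (p t) f x)"
  using transition unfolding engelbert_transition_function_def by (elim conjE) blast

text \<open>The exponential density is \<alpha> exp (- \<alpha> t) for t \<ge> 0, whence the factor
  \<alpha>: the value is the mean of P_t f(x) at an exponential time. With respect to this
  probability measure bounded functions of time are integrable.\<close>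

lemma kernel_op_u:
  assumes f: "f \<in> bounded_measurable M" and x: "x \<in> E" and \<alpha>: "0 < \<alpha>"
  shows "(\<integral>t. (\<integral>y. f y \<partial>p (max 0 t) x) \<partial>density lborel (exponential_density \<alpha>)) =
    \<alpha> * kernel_op M (u \<alpha>) f x"
proof -
  note bounded_measurableD(1)[OF f, measurable]
  have [measurable]: "(\<lambda>t. \<integral>y. f y \<partial>p (max 0 t) x) \<in> borel_measurable borel"
    using measurable_compose[OF measurable_Pair1' integral_p_joint[OF bounded_measurableD(1)[OF f]]] x
    by simp
  have "(\<integral>t. (\<integral>y. f y \<partial>p (max 0 t) x) \<partial>density lborel (exponential_density \<alpha>)) =
      (\<integral>t. exponential_density \<alpha> t * (\<integral>y. f y \<partial>p (max 0 t) x) \<partial>lborel)"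
    using \<alpha> by (subst integral_density) (auto simp: exponential_density_def)
  also have "\<dots> = (\<integral>t. \<alpha> * (indicator {0..} t * (exp (- \<alpha> * t) * kernel_op M (p t) f x)) \<partial>lborel)"
    using x by (intro Bochner_Integration.integral_cong)
      (auto simp: exponential_density_def kernel_op_p indicator_def mult.commute)
  also have "\<dots> = \<alpha> * (LINT t:{0..}|lborel. exp (- \<alpha> * t) * kernel_op M (p t) f x)"
    by (simp add: set_lebesgue_integral_def)
  also have "\<dots> = \<alpha> * kernel_op M (u \<alpha>) f x"
    by (subst resolvent_eq[OF \<alpha> f x]) (rule refl)
  finally show ?thesis .
qed

text \<open>Fubini carries the identity from points to a starting measure m. It is applied to the
  law at a grid time and to the law at T itself, hence the generality in m.\<close>

lemma integral_kernel_op_u: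
  assumes m: "finite_measure m" "sets m = sets M" and f: "f \<in> bounded_measurable M" and \<alpha>: "0 < \<alpha>"
  shows "(\<integral>t. (\<integral>x. (\<integral>y. f y \<partial>p (max 0 t) x) \<partial>m) \<partial>density lborel (exponential_density \<alpha>)) =
    (\<integral>x. \<alpha> * kernel_op M (u \<alpha>) f x \<partial>m)"
proof -
  let ?D = "density lborel (exponential_density \<alpha>)"
  interpret D: prob_space ?D using \<alpha> by (rule prob_space_exponential_density)
  interpret m: finite_measure m by fact
  interpret mD: pair_sigma_finite m ?D ..
  note m(2)[measurable_cong]
  have sp: "space m = E" using sets_eq_imp_space_eq[OF m(2)] by simp
  note bounded_measurableD(1)[OF f, measurable]
  obtain C where C: "\<forall>x\<in>E. \<bar>f x\<bar> \<le> C" using bounded_measurableD(2)[OF f] by auto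
  have [measurable]: "(\<lambda>(x, t). \<integral>y. f y \<partial>p (max 0 t) x) \<in> borel_measurable (m \<Otimes>\<^sub>M ?D)"
    using measurable_compose[OF measurable_pair_swap' integral_p_joint[of f]]
    by (simp add: case_prod_beta' cong: measurable_cong_sets)
  interpret fm: finite_measure "m \<Otimes>\<^sub>M ?D" by (intro finite_measure_pair_measure) unfold_locales
  have "integrable (m \<Otimes>\<^sub>M ?D) (\<lambda>(x, t). \<integral>y. f y \<partial>p (max 0 t) x)"
    by (rule fm.integrable_const_bound[where B = C])
      (auto intro!: AE_I2 abs_integral_p_le[OF _ C] simp: space_pair_measure sp)
  from mD.Fubini_integral[OF this]
  have "(\<integral>t. (\<integral>x. (\<integral>y. f y \<partial>p (max 0 t) x) \<partial>m) \<partial>?D) = (\<integral>x. (\<integral>t. (\<integral>y. f y \<partial>p (max 0 t) x) \<partial>?D) \<partial>m)" .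
  also have "\<dots> = (\<integral>x. \<alpha> * kernel_op M (u \<alpha>) f x \<partial>m)"
    by (intro Bochner_Integration.integral_cong refl kernel_op_u f \<alpha>) (simp add: sp)
  finally show ?thesis .
qed

lemma Rp_D:
  assumes "f \<in> Rp"
  shows "continuous_on E f" "f \<in> bounded_measurable M" "f \<in> cone_diff E Rp"
    "0 < \<alpha> \<Longrightarrow> kernel_op M (u \<alpha>) f \<in> Rp"
proof -
  have *: "f \<in> C_plus E" "(\<lambda>x\<in>E. 0) \<in> Rp" using assms resolvent by (auto simp: engelbert_resolvent_def)
  then show "continuous_on E f" "f \<in> bounded_measurable M"
    by (auto simp: C_plus_def bounded_measurable_def intro: borel_measurable_continuous_on_restrict)
  \<comment> \<open>Subtracting the zero constant puts f among the differences, for which right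
    continuity in time is given.\<close>
  have "f = (\<lambda>x\<in>E. f x - (\<lambda>x\<in>E. 0) x)"
    using *(1) by (auto simp: C_plus_def fun_eq_iff extensional_def)
  with * assms show "f \<in> cone_diff E Rp" unfolding cone_diff_def by blast
  show "0 < \<alpha> \<Longrightarrow> kernel_op M (u \<alpha>) f \<in> Rp"
    using assms resolvent by (auto simp: engelbert_resolvent_def)
qed

lemma integral_p_right_continuous:
  assumes "f \<in> Rp" "x \<in> E" "0 \<le> t"
  shows "((\<lambda>r. \<integral>y. f y \<partial>p r x) \<longlongrightarrow> (\<integral>y. f y \<partial>p t x)) (at_right t)"
  using transition Rp_D(3)[OF assms(1)] assms(2,3)
  by (auto simp: engelbert_transition_function_def continuous_within kernel_op_p)

text \<open>By linearity and uniform approximation, the cone determines finite measures on \<open>E\<close>.\<close>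

lemma measure_eqI_Rp:
  assumes m: "finite_measure m" "sets m = sets M" and n: "finite_measure n" "sets n = sets M"
    and eq: "\<And>f. f \<in> Rp \<Longrightarrow> (\<integral>x. f x \<partial>m) = (\<integral>x. f x \<partial>n)"
  shows "m = n"
proof (rule borel_of_eqI_C_zero[OF closed_E m n])
  fix f assume "f \<in> C_zero E"
  then have fc: "f \<in> sup_closure E (cone_diff E Rp)" "continuous_on E f" "bounded (f ` E)"
    using C_zero_subset by (auto simp: C_zero_def)
  interpret m: finite_measure m by fact
  interpret n: finite_measure n by fact
  note m(2)[measurable_cong] n(2)[measurable_cong]
  have sp: "space m = E" "space n = E" using sets_eq_imp_space_eq[OF m(2)] sets_eq_imp_space_eq[OF n(2)] by simp_all
  have fb: "f \<in> bounded_measurable M"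
    using fc by (auto simp: bounded_measurable_def intro: borel_measurable_continuous_on_restrict)
  note [measurable] = bounded_measurableD(1)[OF fb]
  have int: "integrable m h" "integrable n h" if h: "h \<in> bounded_measurable M" for h
  proof -
    obtain C where C: "\<forall>x\<in>E. \<bar>h x\<bar> \<le> C" using bounded_measurableD(2)[OF h] by auto
    note [measurable] = bounded_measurableD(1)[OF h]
    show "integrable m h" using C by (intro m.integrable_const_bound[where B = C]) (auto simp: sp)
    show "integrable n h" using C by (intro n.integrable_const_bound[where B = C]) (auto simp: sp)
  qed
  let ?c = "measure m E + measure n E"
  have "\<bar>(\<integral>x. f x \<partial>m) - (\<integral>x. f x \<partial>n)\<bar> \<le> e * ?c" if e: "0 < e" for e
  proof -
    obtain g where g: "g \<in> cone_diff E Rp" "\<forall>x\<in>E. \<bar>f x - g x\<bar> \<le> e"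
      using fc(1) e by (auto simp: sup_closure_def)
    then obtain f1 f2 where g': "f1 \<in> Rp" "f2 \<in> Rp" "g = (\<lambda>x\<in>E. f1 x - f2 x)" by (auto simp: cone_diff_def)
    note b = Rp_D(2)[OF g'(1)] Rp_D(2)[OF g'(2)]
    note [measurable] = bounded_measurableD(1)[OF b(1)] bounded_measurableD(1)[OF b(2)]
    have *: "\<bar>(\<integral>x. f x \<partial>l) - ((\<integral>x. f1 x \<partial>l) - (\<integral>x. f2 x \<partial>l))\<bar> \<le> e * measure l E"
      if l: "finite_measure l" "sets l = sets M" "integrable l f" "integrable l f1" "integrable l f2" for l
    proof -
      interpret l: finite_measure l by fact
      have spl: "space l = E" using sets_eq_imp_space_eq[OF l(2)] by simp
      note l(2)[measurable_cong]
      have "(\<integral>x. f x \<partial>l) - ((\<integral>x. f1 x \<partial>l) - (\<integral>x. f2 x \<partial>l)) = (\<integral>x. f x - (f1 x - f2 x) \<partial>l)"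
        using l(3-) by simp
      also have "\<bar>\<dots>\<bar> \<le> e * measure l (space l)"
        using g(2) by (intro l.abs_integral_le) (auto simp: spl g'(3))
      finally show ?thesis by (simp add: spl)
    qed
    show ?thesis
      using *[OF m int(1)[OF fb] int(1)[OF b(1)] int(1)[OF b(2)]]
        *[OF n int(2)[OF fb] int(2)[OF b(1)] int(2)[OF b(2)]]
        eq[OF g'(1)] eq[OF g'(2)] by (simp add: distrib_left)
  qed
  note * = this
  have "\<bar>(\<integral>x. f x \<partial>m) - (\<integral>x. f x \<partial>n)\<bar> \<le> 0 + e" if e: "0 < e" for e
  proof -
    have c: "0 \<le> ?c" by simp
    have le: "e / (c + 1) * c \<le> e" if "0 \<le> c" for c using e that by (simp add: field_simps)
    \<comment> \<open>The error is divided by \<open>?c + 1\<close> because the total mass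
      \<open>?c\<close> may be 0.\<close>
    have "\<bar>(\<integral>x. f x \<partial>m) - (\<integral>x. f x \<partial>n)\<bar> \<le> e / (?c + 1) * ?c"
      using e c by (intro *) (auto intro!: divide_pos_pos add_nonneg_pos)
    also have "\<dots> \<le> e" by (rule le[OF c])
    finally show ?thesis by simp
  qed
  from field_le_epsilon[OF this] show "(\<integral>x. f x \<partial>m) = (\<integral>x. f x \<partial>n)" by simp
qed

end

section \<open>Augmented filtration and optional times\<close>

lemma sets_coord_algebra:
  "sets (coord_algebra E T) = sigma_sets (cadlag E) {(\<lambda>w. w t) -` B \<inter> cadlag E | t B. t \<in> T \<and> B \<in> sets (borel_of E)}"
  unfolding coord_algebra_def by (rule sets_measure_of) auto

lemma cadlagD:
  assumes "w \<in> cadlag E" "0 \<le> t"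
  shows "w t \<in> E" "(w \<longlongrightarrow> w t) (at_right t)"
  using assms by (auto simp: cadlag_def)

lemma coord_measurable:
  assumes "T \<subseteq> {0..}" "t \<in> T"
  shows "(\<lambda>w. w t) \<in> coord_algebra E T \<rightarrow>\<^sub>M borel_of E"
proof (rule measurableI)
  fix B assume "B \<in> sets (borel_of E)"
  then show "(\<lambda>w. w t) -` B \<inter> space (coord_algebra E T) \<in> sets (coord_algebra E T)"
    using assms(2) by (auto simp: sets_coord_algebra)
qed (use assms cadlagD in \<open>auto simp: space_restrict_space\<close>)

text \<open>The least multiple of \<open>1 / (n + 1)\<close> that is strictly larger than \<open>x \<ge> 0\<close>.\<close>

definition next_grid :: "nat \<Rightarrow> real \<Rightarrow> real" where
  "next_grid n x = (real (nat \<lfloor>real (Suc n) * x\<rfloor>) + 1) / real (Suc n)"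

lemma next_grid_bounds:
  assumes "0 \<le> x"
  shows "x < next_grid n x" "next_grid n x \<le> x + 1 / real (Suc n)"
proof -
  define N where "N = real (Suc n)"
  have N: "0 < N" by (simp add: N_def)
  have *: "real (nat \<lfloor>N * x\<rfloor>) = real_of_int \<lfloor>N * x\<rfloor>" using assms N by simp
  have "real_of_int \<lfloor>N * x\<rfloor> \<le> N * x" "N * x < real_of_int \<lfloor>N * x\<rfloor> + 1" by linarith+
  then show "x < next_grid n x" "next_grid n x \<le> x + 1 / real (Suc n)"
    unfolding next_grid_def N_def[symmetric] * using N by (simp_all add: field_simps)
qed

lemma next_grid_tendsto:
  assumes "0 \<le> x"
  shows "(\<lambda>n. next_grid n x) \<longlonglongrightarrow> x"
proof (rule tendsto_sandwich)
  show "\<forall>\<^sub>F n in sequentially. x \<le> next_grid n x" using next_grid_bounds[OF assms] by (simp add: less_imp_le)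
  show "\<forall>\<^sub>F n in sequentially. next_grid n x \<le> x + 1 / real (Suc n)" using next_grid_bounds[OF assms] by simp
  show "(\<lambda>n. x + 1 / real (Suc n)) \<longlonglongrightarrow> x"
    using tendsto_add[OF tendsto_const LIMSEQ_inverse_real_of_nat, of x] by (simp add: field_simps)
qed simp

text \<open>Strictness of the lower grid bound keeps the approximants away from the limit point, so
  they may be inserted into right limits of paths; the offset t serves the times T + t.\<close>

lemma next_grid_at_right:
  assumes "0 \<le> x"
  shows "filterlim (\<lambda>n. next_grid n x + t) (at_right (x + t)) sequentially"
proof -
  have "(\<lambda>n. next_grid n x + t) \<longlonglongrightarrow> x + t" by (intro tendsto_intros next_grid_tendsto assms)
  then show ?thesis
    using next_grid_bounds(1)[OF assms] by (auto simp: filterlim_at less_imp_neq[symmetric] intro!: always_eventually)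
qed

locale engelbert_law = engelbert_process E u Rp p P
  for E :: "'a::euclidean_space set" and u Rp p P +
  fixes \<mu> :: "'a measure"
  assumes mu: "\<mu> \<in> space (prob_algebra (borel_of E))"

context engelbert_process
begin

abbreviation G0 where "G0 \<equiv> coord_algebra E {0..}"

lemma P_in: "\<mu> \<in> space (prob_algebra M) \<Longrightarrow> P \<mu> \<in> space (prob_algebra G0)"
  using law by (simp add: markov_law_def)

lemma Rp_path:
  assumes "f \<in> Rp" "w \<in> cadlag E" "0 \<le> t"
  shows "((\<lambda>s. f (w s)) \<longlongrightarrow> f (w t)) (at_right t)"
proof (rule continuous_on_tendsto_compose[OF Rp_D(1)[OF assms(1)] cadlagD(2)[OF assms(2,3)] cadlagD(1)[OF assms(2,3)]])
  have "\<forall>\<^sub>F s in at_right t. t < s" by (rule eventually_at_right_less)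
  then show "\<forall>\<^sub>F s in at_right t. w s \<in> E"
    by eventually_elim (use assms in \<open>simp add: cadlagD(1)\<close>)
qed

end

context engelbert_law
begin

abbreviation Pc where "Pc \<equiv> completion (P \<mu>)"
abbreviation F where "F t \<equiv> aug_mu E P \<mu> t"

lemma sets_P: "sets (P \<mu>) = sets G0"
  by (rule P_sets) (auto intro: P_in mu)

lemma space_P: "space (P \<mu>) = cadlag E"
  by (rule P_space) (auto intro: P_in mu)

lemma sets_F: "sets (F t) = sigma_sets (cadlag E) (sets (coord_algebra E {0..t}) \<union> null_sets Pc)"
  by (rule sets_aug_mu) (auto intro: P_in mu)

lemma space_F: "space (F t) = cadlag E"
  by (rule space_aug_mu) (auto intro: P_in mu)

lemma F_mono: "s \<le> t \<Longrightarrow> sets (F s) \<subseteq> sets (F t)"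
  by (rule sets_aug_mu_mono) (auto intro: P_in mu)

lemma F_Pc: "sets (F t) \<subseteq> sets Pc"
  by (rule sets_aug_mu_completion) (auto intro: P_in mu)

lemma prob_space_P: "prob_space (P \<mu>)"
  using P_in[OF mu] by (simp add: space_prob_algebra)

sublocale Pc: prob_space Pc
proof
  show "emeasure Pc (space Pc) = 1"
    using prob_space.emeasure_space_1[OF prob_space_P] by simp
qed

lemma coord_P: "0 \<le> s \<Longrightarrow> (\<lambda>w. w s) \<in> P \<mu> \<rightarrow>\<^sub>M M"
  using coord_measurable[of "{0..}" s E] by (simp add: measurable_cong_sets[OF sets_P refl])

lemma coord_Pc: "0 \<le> s \<Longrightarrow> (\<lambda>w. w s) \<in> Pc \<rightarrow>\<^sub>M M"
  by (rule measurable_completion[OF coord_P])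

lemma coord_F_sub: "sets (coord_algebra E {0..t}) \<subseteq> sets (F t)"
  by (auto simp: sets_F)

lemma coord_F:
  assumes "0 \<le> s" "s \<le> t"
  shows "(\<lambda>w. w s) \<in> F t \<rightarrow>\<^sub>M M"
  by (rule subsetD[OF measurable_mono[OF order_refl refl coord_F_sub]])
    (use coord_measurable[of "{0..t}" s E] assms in \<open>auto simp: space_F\<close>)

text \<open>Almost sure equality with a set of the raw past passes to complements and countable
  unions, and both kinds of generators of \<open>F t\<close> have this property.\<close>

lemma F_approx:
  assumes "A \<in> sets (F t)"
  shows "\<exists>A0\<in>sets (coord_algebra E {0..t}). AE w in Pc. w \<in> A \<longleftrightarrow> w \<in> A0"
  using assms unfolding sets_F
proof (induction rule: sigma_sets.induct)
  case (Basic a)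
  then show ?case
  proof
    assume "a \<in> null_sets Pc"
    then have "AE w in Pc. w \<in> a \<longleftrightarrow> w \<in> {}" using AE_not_in by force
    then show ?thesis by blast
  qed auto
next
  case (Compl a)
  then obtain A0 where A0: "A0 \<in> sets (coord_algebra E {0..t})" "AE w in Pc. w \<in> a \<longleftrightarrow> w \<in> A0" by auto
  have "AE w in Pc. w \<in> cadlag E - a \<longleftrightarrow> w \<in> cadlag E - A0" using A0(2) by eventually_elim auto
  moreover have "cadlag E - A0 \<in> sets (coord_algebra E {0..t})"
    using sets.compl_sets[OF A0(1)] by simp
  ultimately show ?case by blast
next
  case (Union a)
  then obtain A0 where A0: "\<And>i. A0 i \<in> sets (coord_algebra E {0..t})" "\<And>i. AE w in Pc. w \<in> a i \<longleftrightarrow> w \<in> A0 i"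
    by metis
  have "AE w in Pc. \<forall>i. w \<in> a i \<longleftrightarrow> w \<in> A0 i" using A0(2) by (simp add: AE_all_countable)
  then have "AE w in Pc. w \<in> (\<Union>i. a i) \<longleftrightarrow> w \<in> (\<Union>i. A0 i)" by eventually_elim auto
  moreover have "(\<Union>i. A0 i) \<in> sets (coord_algebra E {0..t})" using A0(1) by auto
  ultimately show ?case by blast
qed auto

text \<open>The two differences of A and \<open>A0\<close> are null sets, and \<open>F t\<close>
  contains all null sets.\<close>

lemma F_I_AE:
  assumes "A \<in> sets Pc" "A0 \<in> sets (F t)" "AE w in Pc. w \<in> A \<longleftrightarrow> w \<in> A0"
  shows "A \<in> sets (F t)"
proof -
  have A0: "A0 \<in> sets Pc" using assms(2) F_Pc by auto
  have "A - A0 \<in> null_sets Pc" "A0 - A \<in> null_sets Pc"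
    using assms A0 by (auto intro!: AE_iff_null_sets[THEN iffD2] elim!: eventually_mono)
  then have "A - A0 \<in> sets (F t)" "A0 - A \<in> sets (F t)" by (auto simp: sets_F)
  then have "(A0 \<union> (A - A0)) - (A0 - A) \<in> sets (F t)" using assms(2) by blast
  moreover have "(A0 \<union> (A - A0)) - (A0 - A) = A" by auto
  ultimately show ?thesis by simp
qed

text \<open>\<open>markov_law\<close> conditions on raw coordinates under the uncompleted law.
  Replacing A by an almost surely equal set of the raw past transfers the property to the augmented
  past, in integrated form.\<close>

lemma simple_markov:
  assumes A: "A \<in> sets (F r)" and r: "0 \<le> r" and t: "0 \<le> t" and f: "f \<in> bounded_measurable M"
  shows "(LINT w:A|Pc. f (w (r + t))) = (LINT w:A|Pc. \<integral>y. f y \<partial>p t (w r))"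
proof -
  obtain A0 where A0: "A0 \<in> sets (coord_algebra E {0..r})" "AE w in Pc. w \<in> A \<longleftrightarrow> w \<in> A0"
    using F_approx[OF A] by blast
  have [measurable]: "A \<in> sets Pc" using A F_Pc by auto
  have A0P [measurable]: "A0 \<in> sets (P \<mu>)"
    using A0(1) sets_coord_algebra_mono[of "{0..r}" "{0..}" E] by (auto simp: sets_P)
  then have [measurable]: "A0 \<in> sets Pc" by simp
  note [measurable] = bounded_measurableD(1)[OF f] coord_P[OF r] coord_P[of "r + t"] coord_Pc[OF r] coord_Pc[of "r + t"]
    integral_p_measurable[OF bounded_measurableD(1)[OF f] t]
  have [simp]: "0 \<le> r + t" using r t by simp
  obtain C where C: "\<forall>x\<in>E. \<bar>f x\<bar> \<le> C" using bounded_measurableD(2)[OF f] by auto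
  interpret P: prob_space "P \<mu>" by (rule prob_space_P)
  have sub: "subalgebra (P \<mu>) (coord_algebra E {0..r})"
    using sets_coord_algebra_mono[of "{0..r}" "{0..}" E] by (simp add: subalgebra_def space_P sets_P)
  interpret sub: finite_measure_subalgebra "P \<mu>" "coord_algebra E {0..r}"
    by unfold_locales (rule sub)
  have "integrable (P \<mu>) (\<lambda>w. f (w (r + t)))"
    using C r t by (intro P.integrable_const_bound[where B = C]) (auto simp: space_P cadlagD(1))
  then have "(LINT w:A0|P \<mu>. f (w (r + t))) =
      (LINT w:A0|P \<mu>. real_cond_exp (P \<mu>) (coord_algebra E {0..r}) (\<lambda>w. f (w (r + t))) w)"
    by (rule sub.real_cond_exp_intA) fact
  also have "\<dots> = (LINT w:A0|P \<mu>. \<integral>y. f y \<partial>p t (w r))"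
  proof (rule set_lebesgue_integral_cong_AE)
    have "AE w in P \<mu>. real_cond_exp (P \<mu>) (coord_algebra E {0..r}) (\<lambda>w. f (w (t + r))) w = kernel_op M (p t) f (w r)"
      using law[OF mu] f r t by (auto simp: markov_law_def)
    with AE_space
    show "AE w\<in>A0 in P \<mu>. real_cond_exp (P \<mu>) (coord_algebra E {0..r}) (\<lambda>w. f (w (r + t))) w = (\<integral>y. f y \<partial>p t (w r))"
      by eventually_elim (use r in \<open>auto simp: add.commute space_P kernel_op_p cadlagD(1)\<close>)
  qed measurable
  finally have eq: "(LINT w:A0|P \<mu>. f (w (r + t))) = (LINT w:A0|P \<mu>. \<integral>y. f y \<partial>p t (w r))" .
  have *: "(LINT w:A|Pc. g w) = (LINT w:A0|P \<mu>. g w)" if [measurable]: "g \<in> borel_measurable (P \<mu>)" for g :: "_ \<Rightarrow> real"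
  proof -
    have [measurable]: "g \<in> borel_measurable Pc" by (rule measurable_completion) fact
    have "(LINT w:A|Pc. g w) = (LINT w:A0|Pc. g w)"
      unfolding set_lebesgue_integral_def
    proof (rule integral_cong_AE)
      show "AE w in Pc. indicat_real A w *\<^sub>R g w = indicat_real A0 w *\<^sub>R g w"
        using A0(2) by eventually_elim (auto simp: indicator_def)
    qed measurable
    also have "\<dots> = (LINT w:A0|P \<mu>. g w)"
      unfolding set_lebesgue_integral_def by (rule integral_completion) measurable
    finally show ?thesis .
  qed
  have "(\<lambda>w. f (w (r + t))) \<in> borel_measurable (P \<mu>)" by measurable
  moreover have "(\<lambda>w. \<integral>y. f y \<partial>p t (w r)) \<in> borel_measurable (P \<mu>)" by measurable
  ultimately show ?thesis using eq * by metis
qed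

text \<open>\<open>T\<close> is an optional time on the event \<open>A\<close>, which lies in its past; its values off \<open>A\<close> are
  irrelevant.\<close>

definition optional_on :: "(real \<Rightarrow> 'a) set \<Rightarrow> ((real \<Rightarrow> 'a) \<Rightarrow> real) \<Rightarrow> bool" where
  "optional_on A T \<longleftrightarrow> A \<subseteq> cadlag E \<and> (\<forall>w\<in>A. 0 \<le> T w) \<and> (\<forall>t>0. {w \<in> A. T w < t} \<in> sets (F t))"

lemma optional_on_sets: assumes "optional_on A T" shows "A \<in> sets Pc"
proof -
  have "{w \<in> A. T w < real (Suc n)} \<in> sets Pc" for n
    using assms by (intro F_Pc[THEN subsetD, of _ "real (Suc n)"]) (auto simp: optional_on_def)
  then have "(\<Union>n. {w \<in> A. T w < real (Suc n)}) \<in> sets Pc" by blast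
  moreover have "(\<Union>n. {w \<in> A. T w < real (Suc n)}) = A"
  proof (intro equalityI subsetI)
    fix w assume "w \<in> A"
    moreover obtain n where "T w < real n" using reals_Archimedean2 by blast
    then have "T w < real (Suc n)" by simp
    ultimately show "w \<in> (\<Union>n. {w \<in> A. T w < real (Suc n)})" by blast
  qed auto
  ultimately show ?thesis by simp
qed

lemma optional_on_shift:
  assumes "optional_on A T" "0 \<le> s"
  shows "optional_on A (\<lambda>w. T w + s)"
  unfolding optional_on_def
proof (intro conjI ballI allI impI)
  fix t :: real assume "0 < t"
  show "{w \<in> A. T w + s < t} \<in> sets (F t)"
  proof (cases "s < t")
    case True
    then have "{w \<in> A. T w < t - s} \<in> sets (F (t - s))" using assms by (auto simp: optional_on_def)
    moreover have "{w \<in> A. T w < t - s} = {w \<in> A. T w + s < t}" by auto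
    ultimately show ?thesis using F_mono[of "t - s" t] assms(2) by auto
  next
    case False
    then have "{w \<in> A. T w + s < t} = {}" using assms by (force simp: optional_on_def)
    then show ?thesis by (simp only: sets.empty_sets)
  qed
qed (use assms in \<open>auto simp: optional_on_def\<close>)

text \<open>The value at T is the limit of values at grid times. The bound b controls which
  coordinates are used: b = \<infinity> serves the full algebra, and b = t shows that on {T < t} the
  value at T depends only on coordinates before t.\<close>

lemma eval_measurable:
  fixes b :: ereal
  assumes N: "space N = cadlag E" "\<And>s. 0 \<le> s \<Longrightarrow> ereal s < b \<Longrightarrow> (\<lambda>w. w s) \<in> N \<rightarrow>\<^sub>M M" and b: "0 < b"
    and D: "D \<subseteq> cadlag E" "\<And>w. w \<in> D \<Longrightarrow> 0 \<le> T w" "\<And>w. w \<in> D \<Longrightarrow> ereal (T w) < b"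
    and T [measurable]: "T \<in> borel_measurable (restrict_space N D)"
  shows "(\<lambda>w. w (T w)) \<in> restrict_space N D \<rightarrow>\<^sub>M M"
proof (rule measurable_restrict_space2)
  let ?N = "restrict_space N D"
  have sp: "space ?N = D" using N(1) D(1) by (auto simp: space_restrict_space)
  show "(\<lambda>w. w (T w)) \<in> space ?N \<rightarrow> E"
  proof
    fix w assume "w \<in> space ?N"
    then have "w \<in> cadlag E" "0 \<le> T w" using sp D by auto
    then show "w (T w) \<in> E" by (rule cadlagD(1))
  qed
  have meas: "(\<lambda>w. w s) \<in> borel_measurable ?N" if "0 \<le> s" "ereal s < b" for s
    using measurable_restrict_space1[OF N(2)[OF that], of D] unfolding measurable_restrict_space2_iff by blast
  \<comment> \<open>A grid time at or beyond b is replaced by time 0, whose coordinate is available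
    as 0 < b. Since T w < b strictly, this happens only for finitely many n.\<close>
  define X where "X = (\<lambda>n w. if ereal (next_grid n (T w)) < b then w (next_grid n (T w)) else w 0)"
  show "(\<lambda>w. w (T w)) \<in> borel_measurable ?N"
  proof (rule borel_measurable_LIMSEQ_metric)
    fix n
    have "(\<lambda>w. if ereal ((real k + 1) / real (Suc n)) < b then w ((real k + 1) / real (Suc n)) else w 0) \<in> borel_measurable ?N" for k
    proof (cases "ereal ((real k + 1) / real (Suc n)) < b")
      case True
      then have "(\<lambda>w. w ((real k + 1) / real (Suc n))) \<in> borel_measurable ?N"
        by (intro meas) simp_all
      with True show ?thesis by (simp only: if_True)
    next
      case False
      moreover have "(\<lambda>w. w 0) \<in> borel_measurable ?N"
        using b by (intro meas) (simp_all add: zero_ereal_def)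
      ultimately show ?thesis by (simp only: if_False)
    qed
    from measurable_compose_countable[OF this, of "\<lambda>w. nat \<lfloor>real (Suc n) * T w\<rfloor>"]
    show "X n \<in> borel_measurable ?N" unfolding X_def next_grid_def by measurable
  next
    fix w assume "w \<in> space ?N"
    then have w: "w \<in> cadlag E" "0 \<le> T w" "ereal (T w) < b" using sp D by auto
    have lim: "filterlim (\<lambda>n. next_grid n (T w)) (at_right (T w)) sequentially"
      using next_grid_at_right[OF w(2), of 0] by simp
    have "(\<lambda>n. ereal (next_grid n (T w))) \<longlonglongrightarrow> ereal (T w)" using next_grid_tendsto[OF w(2)] by simp
    then have "\<forall>\<^sub>F n in sequentially. ereal (next_grid n (T w)) < b" using w(3) by (rule order_tendstoD)
    then have "\<forall>\<^sub>F n in sequentially. w (next_grid n (T w)) = X n w" by eventually_elim (simp add: X_def)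
    moreover have "(\<lambda>n. w (next_grid n (T w))) \<longlonglongrightarrow> w (T w)"
      by (rule filterlim_compose[OF cadlagD(2)[OF w(1,2)] lim])
    ultimately show "(\<lambda>n. X n w) \<longlonglongrightarrow> w (T w)" by (rule Lim_transform_eventually[rotated])
  qed
qed

lemma optional_on_time:
  assumes T: "optional_on A T"
  shows "T \<in> borel_measurable (restrict_space Pc A)"
    and "0 < t \<Longrightarrow> T \<in> borel_measurable (restrict_space (F t) {w \<in> A. T w < t})"
proof -
  have A: "A \<subseteq> cadlag E" using T by (simp add: optional_on_def)
  have *: "{w \<in> A. T w < c} \<in> sets (F t)" if "c \<le> t" for c t
  proof (cases "0 < c")
    case True
    then show ?thesis using T F_mono[OF that] by (auto simp: optional_on_def)
  next
    case False
    then have "{w \<in> A. T w < c} = {}" using T by (force simp: optional_on_def)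
    then show ?thesis by (simp only: sets.empty_sets)
  qed
  show "T \<in> borel_measurable (restrict_space Pc A)"
    unfolding borel_measurable_iff_less
  proof
    fix c
    have "{w \<in> A. T w < c} \<in> sets Pc" using *[of c c] F_Pc by auto
    then show "{w \<in> space (restrict_space Pc A). T w < c} \<in> sets (restrict_space Pc A)"
      using optional_on_sets[OF T] A by (simp add: sets_restrict_space_iff space_restrict_space space_P Int_absorb2 Int_absorb1 subset_iff)
  qed
  assume t: "0 < t"
  show "T \<in> borel_measurable (restrict_space (F t) {w \<in> A. T w < t})"
    unfolding borel_measurable_iff_less
  proof
    fix c
    have "{w \<in> space (restrict_space (F t) {w \<in> A. T w < t}). T w < c} = {w \<in> A. T w < min c t}"
      using A by (auto simp: space_restrict_space space_F)
    moreover have "{w \<in> A. T w < t} \<inter> space (F t) = {w \<in> A. T w < t}" using A by (auto simp: space_F)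
    ultimately show "{w \<in> space (restrict_space (F t) {w \<in> A. T w < t}). T w < c} \<in> sets (restrict_space (F t) {w \<in> A. T w < t})"
      using *[of "min c t" t] *[of t t] by (subst sets_restrict_space_iff) auto
  qed
qed

lemma optional_on_eval:
  assumes T: "optional_on A T"
  shows "(\<lambda>w. w (T w)) \<in> restrict_space Pc A \<rightarrow>\<^sub>M M"
proof (rule eval_measurable[where b = \<infinity>])
  show "(\<lambda>w. w s) \<in> Pc \<rightarrow>\<^sub>M M" if "0 \<le> s" for s using that by (rule coord_Pc)
  show "A \<subseteq> cadlag E" "\<And>w. w \<in> A \<Longrightarrow> 0 \<le> T w" using T by (auto simp: optional_on_def)
  show "T \<in> borel_measurable (restrict_space Pc A)" by (rule optional_on_time[OF T])
qed (simp_all add: space_P)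

text \<open>A condition on the position at T belongs to the past of T. Hence constraints already met
  by the path can be absorbed into the event, which drives the induction over cylinders.\<close>

lemma optional_on_Int_eval:
  assumes T: "optional_on A T" and B: "B \<in> sets M"
  shows "optional_on {w \<in> A. w (T w) \<in> B} T"
  unfolding optional_on_def
proof (intro conjI ballI allI impI)
  fix t :: real assume t: "0 < t"
  let ?D = "{w \<in> A. T w < t}"
  have D: "?D \<in> sets (F t)" "?D \<subseteq> cadlag E" using T t by (auto simp: optional_on_def)
  have "(\<lambda>w. w (T w)) \<in> restrict_space (F t) ?D \<rightarrow>\<^sub>M M"
  proof (rule eval_measurable[where b = "ereal t"])
    show "(\<lambda>w. w s) \<in> F t \<rightarrow>\<^sub>M M" if "0 \<le> s" "ereal s < ereal t" for s
      using that by (intro coord_F) auto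
    show "\<And>w. w \<in> ?D \<Longrightarrow> 0 \<le> T w" using T by (auto simp: optional_on_def)
    show "T \<in> borel_measurable (restrict_space (F t) ?D)" using t by (rule optional_on_time(2)[OF T])
  qed (use D t in \<open>auto simp: space_F zero_ereal_def\<close>)
  from measurable_sets[OF this B]
  have "(\<lambda>w. w (T w)) -` B \<inter> space (restrict_space (F t) ?D) \<in> sets (F t)"
    using D by (subst (asm) sets_restrict_space_iff) (auto simp: space_F Int_absorb2)
  moreover have "(\<lambda>w. w (T w)) -` B \<inter> space (restrict_space (F t) ?D) = {w \<in> {w \<in> A. w (T w) \<in> B}. T w < t}"
    using D(2) by (auto simp: space_restrict_space space_F)
  ultimately show "{w \<in> {w \<in> A. w (T w) \<in> B}. T w < t} \<in> sets (F t)" by simp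
qed (use T in \<open>auto simp: optional_on_def\<close>)

end

section \<open>Strong Markov property of the one-dimensional laws\<close>

context engelbert_law
begin

text \<open>A sub-probability measure with the mass of A. Keeping A inside the measure replaces
  conditioning: an identity between such measures for all admissible A is an identity of conditional
  laws given the past of T.\<close>

definition law_at :: "(real \<Rightarrow> 'a) set \<Rightarrow> ((real \<Rightarrow> 'a) \<Rightarrow> real) \<Rightarrow> 'a measure" where
  "law_at A T = distr (restrict_space Pc A) M (\<lambda>w. w (T w))"

lemma sets_law_at [simp, measurable_cong]: "sets (law_at A T) = sets M"
  and space_law_at [simp]: "space (law_at A T) = E"
  by (simp_all add: law_at_def)

lemma optional_on_finite_measure: "optional_on A T \<Longrightarrow> finite_measure (restrict_space Pc A)"
  using finite_measure_restrict_space[of Pc A] optional_on_sets[of A T] Pc.finite_measure_axioms sets.sets_into_space[of A Pc]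
  by (simp add: Int_absorb2)

lemma space_optional_on: "optional_on A T \<Longrightarrow> space (restrict_space Pc A) = A"
  by (auto simp: space_restrict_space space_P optional_on_def)

lemma E_nonempty: "E \<noteq> {}"
  using prob_space.not_empty[of \<mu>] mu sets_eq_imp_space_eq[of \<mu> M] by (auto simp: space_prob_algebra)

lemma subprob_law_at:
  assumes T: "optional_on A T"
  shows "subprob_space (law_at A T)"
  unfolding law_at_def
proof (rule subprob_spaceI)
  have "emeasure (restrict_space Pc A) (space (restrict_space Pc A)) = emeasure Pc A"
    using optional_on_sets[OF T] sets.sets_into_space[OF optional_on_sets[OF T]]
    by (simp add: space_optional_on[OF T] emeasure_restrict_space Int_absorb2)
  also have "\<dots> \<le> 1" by (rule Pc.emeasure_le_1)
  finally show "emeasure (distr (restrict_space Pc A) M (\<lambda>w. w (T w))) (space (distr (restrict_space Pc A) M (\<lambda>w. w (T w)))) \<le> 1"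
    using emeasure_distr[OF optional_on_eval[OF T], of E] measurable_space[OF optional_on_eval[OF T]] sets.top[of M]
    by (simp add: space_optional_on[OF T] Int_absorb1 subset_iff)
qed (use E_nonempty in simp)

lemma finite_law_at: "optional_on A T \<Longrightarrow> finite_measure (law_at A T)"
  using subprob_law_at subprob_space.axioms(1) by blast

lemma integral_law_at:
  fixes f :: "'a \<Rightarrow> real"
  assumes "optional_on A T" "f \<in> borel_measurable M"
  shows "(\<integral>x. f x \<partial>law_at A T) = (\<integral>w. f (w (T w)) \<partial>restrict_space Pc A)"
  unfolding law_at_def by (rule integral_distr[OF optional_on_eval[OF assms(1)] assms(2)])

lemma set_integral_restrict:
  fixes f :: "(real \<Rightarrow> 'a) \<Rightarrow> real"
  assumes "A \<in> sets Pc"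
  shows "(\<integral>w. f w \<partial>restrict_space Pc A) = (LINT w:A|Pc. f w)"
  using assms sets.sets_into_space[OF assms]
  by (simp add: integral_restrict_space set_lebesgue_integral_def Int_absorb2)

lemma optional_on_eval_next_grid:
  assumes T: "optional_on A T" and s: "0 \<le> s"
  shows "(\<lambda>w. w (next_grid n (T w) + s)) \<in> restrict_space Pc A \<rightarrow>\<^sub>M M"
proof -
  have [measurable]: "T \<in> borel_measurable (restrict_space Pc A)" by (rule optional_on_time[OF T])
  have fl: "(\<lambda>w. nat \<lfloor>real (Suc n) * T w\<rfloor>) \<in> restrict_space Pc A \<rightarrow>\<^sub>M count_space UNIV"
    by measurable
  have "(\<lambda>w. w ((real k + 1) / real (Suc n) + s)) \<in> restrict_space Pc A \<rightarrow>\<^sub>M M" for k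
    using s by (intro measurable_restrict_space1 coord_Pc) simp
  from measurable_compose_countable[OF this fl]
  show ?thesis unfolding next_grid_def .
qed

text \<open>The grid time takes countably many values. On the event \<open>B k\<close> where it
  equals \<open>q k\<close> the simple Markov property applies, since \<open>B k\<close> lies in the
  past of \<open>q k\<close>; then the pieces are summed.\<close>

lemma next_grid_markov:
  assumes T: "optional_on A T" and t: "0 \<le> t" and f: "f \<in> bounded_measurable M"
  shows "(\<integral>w. f (w (next_grid n (T w) + t)) \<partial>restrict_space Pc A) =
    (\<integral>w. (\<integral>y. f y \<partial>p t (w (next_grid n (T w)))) \<partial>restrict_space Pc A)"
proof -
  define q where "q k = (real k + 1) / real (Suc n)" for k
  define B where "B k = {w \<in> A. nat \<lfloor>real (Suc n) * T w\<rfloor> = k}" for k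
  have A: "A \<in> sets Pc" by (rule optional_on_sets[OF T])
  have q0: "0 < q k" for k by (simp add: q_def)
  have BF: "B k \<in> sets (F (q k))" for k
  proof -
    \<comment> \<open>For k = 0 natural subtraction gives \<open>q (k - 1) = q 0\<close>, and
      removing {T < q 0} would leave nothing; the lower bound is then T \<ge> 0 on A.\<close>
    have "B k = {w \<in> A. T w < q k} - (if k = 0 then {} else {w \<in> A. T w < q (k - 1)})"
    proof (intro set_eqI)
      fix w
      show "w \<in> B k \<longleftrightarrow> w \<in> {w \<in> A. T w < q k} - (if k = 0 then {} else {w \<in> A. T w < q (k - 1)})"
      proof (cases "w \<in> A")
        case True
        then have "0 \<le> real (Suc n) * T w" using T by (auto simp: optional_on_def)
        then have "nat \<lfloor>real (Suc n) * T w\<rfloor> = k \<longleftrightarrow> real k \<le> real (Suc n) * T w \<and> real (Suc n) * T w < real k + 1"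
          by (auto simp: nat_eq_iff floor_eq_iff)
        also have "\<dots> \<longleftrightarrow> T w < q k \<and> (k = 0 \<or> \<not> T w < q (k - 1))"
          using \<open>0 \<le> real (Suc n) * T w\<close> by (cases k) (auto simp: q_def field_simps)
        finally show ?thesis using True by (auto simp: B_def)
      qed (simp add: B_def)
    qed
    moreover have "{w \<in> A. T w < q k} \<in> sets (F (q k))" using T q0 by (auto simp: optional_on_def)
    moreover have "{w \<in> A. T w < q (k - 1)} \<in> sets (F (q k))"
    proof -
      have "q (k - 1) \<le> q k" by (simp add: q_def divide_right_mono)
      moreover have "{w \<in> A. T w < q (k - 1)} \<in> sets (F (q (k - 1)))" using T q0 by (auto simp: optional_on_def)
      ultimately show ?thesis using F_mono by blast
    qed
    ultimately show ?thesis by auto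
  qed
  then have B: "B k \<in> sets Pc" for k using F_Pc by blast
  have UB: "(\<Union>k. B k) = A" by (auto simp: B_def)
  have disj: "i \<noteq> j \<Longrightarrow> B i \<inter> B j = {}" for i j by (auto simp: B_def)
  have next_grid: "next_grid n (T w) = q k" if "w \<in> B k" for w k using that by (auto simp: B_def next_grid_def q_def)
  obtain C where C: "\<forall>x\<in>E. \<bar>f x\<bar> \<le> C" using bounded_measurableD(2)[OF f] by auto
  note fm [measurable] = bounded_measurableD(1)[OF f]
  interpret Q: finite_measure "restrict_space Pc A" by (rule optional_on_finite_measure[OF T])
  have sp: "\<And>w. w \<in> space (restrict_space Pc A) \<Longrightarrow> w \<in> cadlag E \<and> 0 \<le> T w"
    using T by (auto simp: space_optional_on[OF T] optional_on_def)
  note ev = optional_on_eval_next_grid[OF T, where n = n]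
  have i1: "integrable (restrict_space Pc A) (\<lambda>w. f (w (next_grid n (T w) + t)))"
  proof (rule Q.integrable_const_bound[where B = C])
    show "AE w in restrict_space Pc A. norm (f (w (next_grid n (T w) + t))) \<le> C"
    proof (rule AE_I2)
      fix w assume "w \<in> space (restrict_space Pc A)"
      then have "w (next_grid n (T w) + t) \<in> E"
        using sp[of w] next_grid_bounds(1)[of "T w" n] t by (intro cadlagD(1)[of w]) auto
      then show "norm (f (w (next_grid n (T w) + t))) \<le> C" using C by simp
    qed
  qed (rule measurable_compose[OF ev[OF t] fm])
  have i2: "integrable (restrict_space Pc A) (\<lambda>w. \<integral>y. f y \<partial>p t (w (next_grid n (T w))))"
  proof (rule Q.integrable_const_bound[where B = C])
    show "AE w in restrict_space Pc A. norm (\<integral>y. f y \<partial>p t (w (next_grid n (T w)))) \<le> C"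
    proof (rule AE_I2)
      fix w assume "w \<in> space (restrict_space Pc A)"
      then have "w (next_grid n (T w)) \<in> E"
        using sp[of w] next_grid_bounds(1)[of "T w" n] by (intro cadlagD(1)[of w]) auto
      then show "norm (\<integral>y. f y \<partial>p t (w (next_grid n (T w)))) \<le> C"
        using abs_integral_p_le[OF fm C t] by simp
    qed
    show "(\<lambda>w. \<integral>y. f y \<partial>p t (w (next_grid n (T w)))) \<in> borel_measurable (restrict_space Pc A)"
      using measurable_compose[OF ev[of 0] integral_p_measurable[OF fm t]] by simp
  qed
  have split: "(\<integral>w. g w \<partial>restrict_space Pc A) = (\<Sum>k. LINT w:B k|Pc. g w)"
    if g: "integrable (restrict_space Pc A) g" for g :: "_ \<Rightarrow> real"
  proof -
    have "set_integrable Pc (\<Union>k. B k) g"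
      using g A unfolding UB set_integrable_def
      by (subst (asm) integrable_restrict_space) (simp_all only: sets.Int_space_eq2)
    then have "(LINT w:(\<Union>k. B k)|Pc. g w) = (\<Sum>k. LINT w:B k|Pc. g w)"
      by (intro lebesgue_integral_countable_add B disj)
    then show ?thesis by (simp only: UB set_integral_restrict[OF A])
  qed
  have "(LINT w:B k|Pc. f (w (next_grid n (T w) + t))) = (LINT w:B k|Pc. \<integral>y. f y \<partial>p t (w (next_grid n (T w))))" for k
  proof -
    have "(LINT w:B k|Pc. f (w (next_grid n (T w) + t))) = (LINT w:B k|Pc. f (w (q k + t)))"
      by (intro set_lebesgue_integral_cong B) (simp add: next_grid)
    also have "\<dots> = (LINT w:B k|Pc. \<integral>y. f y \<partial>p t (w (q k)))"
      using q0[of k] by (intro simple_markov BF t f) simp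
    also have "\<dots> = (LINT w:B k|Pc. \<integral>y. f y \<partial>p t (w (next_grid n (T w))))"
      by (intro set_lebesgue_integral_cong B) (simp add: next_grid)
    finally show ?thesis .
  qed
  then show ?thesis by (simp add: split[OF i1] split[OF i2])
qed

text \<open>Both sides are tested on the cone. Their integrals are right continuous in s and have
  equal exponential transforms. For s = 0 the law at T turns out to be invariant under
  \<open>p 0\<close>, although individual points need not be.\<close>

lemma strong_markov:
  assumes T: "optional_on A T" and s: "0 \<le> s"
  shows "law_at A (\<lambda>w. T w + s) = law_at A T \<bind> p s"
proof (rule measure_eqI_Rp)
  let ?Q = "restrict_space Pc A"
  interpret Q: finite_measure ?Q by (rule optional_on_finite_measure[OF T])
  interpret m: subprob_space "law_at A T" by (rule subprob_law_at[OF T])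
  have ps: "p s \<in> law_at A T \<rightarrow>\<^sub>M subprob_algebra M"
    using p_subprob[OF s] by (simp cong: measurable_cong_sets)
  show "finite_measure (law_at A (\<lambda>w. T w + s))" by (intro finite_law_at optional_on_shift T s)
  show "finite_measure (law_at A T \<bind> p s)"
    using subprob_space_bind[OF m.subprob_space_axioms ps] subprob_space.axioms(1) by blast
  show "sets (law_at A T \<bind> p s) = sets M"
    using E_nonempty sets_bind[OF _ _, of "law_at A T" "p s" M] p_D(2)[OF s] by simp
  fix f assume fR: "f \<in> Rp"
  have f: "f \<in> bounded_measurable M" by (rule Rp_D[OF fR])
  note fm [measurable] = bounded_measurableD(1)[OF f]
  obtain C where C: "\<forall>x\<in>E. \<bar>f x\<bar> \<le> C" "0 \<le> C" using bounded_measurableD(2)[OF f] by auto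
  have sp: "\<And>w. w \<in> space ?Q \<Longrightarrow> w \<in> cadlag E" "\<And>w. w \<in> space ?Q \<Longrightarrow> 0 \<le> T w"
    using T by (auto simp: space_optional_on[OF T] optional_on_def)
  have wE: "w (T w + r) \<in> E" if "w \<in> space ?Q" "0 \<le> r" for w r
    using sp[of w] that by (intro cadlagD(1)[of w]) auto
  have wD: "w (next_grid n (T w) + r) \<in> E" if "w \<in> space ?Q" "0 \<le> r" for w r n
    using sp[of w] that next_grid_bounds(1)[of "T w" n] by (intro cadlagD(1)[of w]) auto
  have mE: "(\<lambda>w. w (T w + r)) \<in> ?Q \<rightarrow>\<^sub>M M" if "0 \<le> r" for r
    by (rule optional_on_eval[OF optional_on_shift[OF T that]])
  note mD = optional_on_eval_next_grid[OF T]
  \<comment> \<open>\<open>h\<close> and \<open>k\<close> are the two sides as functions of time,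
    frozen at their value at 0 for negative times; \<open>hn n\<close> is \<open>k\<close> with the
    law at T replaced by the law \<open>N n\<close> at a grid time.\<close>
  define h where "h t = (\<integral>w. f (w (T w + max 0 t)) \<partial>?Q)" for t
  define k where "k t = (\<integral>x. (\<integral>y. f y \<partial>p (max 0 t) x) \<partial>law_at A T)" for t
  define N where "N n = distr ?Q M (\<lambda>w. w (next_grid n (T w)))" for n
  define hn where "hn n t = (\<integral>x. (\<integral>y. f y \<partial>p (max 0 t) x) \<partial>N n)" for n t
  have mD0: "(\<lambda>w. w (next_grid n (T w))) \<in> ?Q \<rightarrow>\<^sub>M M" for n using mD[of 0 n] by simp
  have N: "finite_measure (N n)" "sets (N n) = sets M" for n
    unfolding N_def by (auto intro!: Q.finite_measure_distr mD0)
  have hn: "hn n t = (\<integral>w. f (w (next_grid n (T w) + max 0 t)) \<partial>?Q)" for n t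
  proof -
    have "hn n t = (\<integral>w. (\<integral>y. f y \<partial>p (max 0 t) (w (next_grid n (T w)))) \<partial>?Q)"
      unfolding hn_def N_def by (rule integral_distr[OF mD0 integral_p_measurable[OF fm]]) simp
    then show ?thesis using next_grid_markov[OF T _ f, of "max 0 t" n] by simp
  qed
  have meas_int: "(\<lambda>t. \<integral>x. (\<integral>y. f y \<partial>p (max 0 t) x) \<partial>m) \<in> borel_measurable borel"
    if m: "finite_measure m" "sets m = sets M" for m
  proof -
    interpret m': finite_measure m by fact
    note m(2)[measurable_cong]
    show ?thesis
      using integral_p_joint[OF fm] by (intro m'.borel_measurable_lebesgue_integral) (simp cong: measurable_cong_sets)
  qed
  have hn_lim: "(\<lambda>n. hn n t) \<longlonglongrightarrow> h t" for t
    unfolding hn h_def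
  proof (rule integral_dominated_convergence[where w = "\<lambda>_. C"])
    show "AE w in ?Q. (\<lambda>n. f (w (next_grid n (T w) + max 0 t))) \<longlonglongrightarrow> f (w (T w + max 0 t))"
    proof (rule AE_I2)
      fix w assume w: "w \<in> space ?Q"
      then show "(\<lambda>n. f (w (next_grid n (T w) + max 0 t))) \<longlonglongrightarrow> f (w (T w + max 0 t))"
        using sp[of w] by (intro filterlim_compose[OF Rp_path[OF fR] next_grid_at_right]) auto
    qed
    show "\<And>n. AE w in ?Q. norm (f (w (next_grid n (T w) + max 0 t))) \<le> C"
      using C wD by (intro AE_I2) simp
    show "(\<lambda>w. f (w (T w + max 0 t))) \<in> borel_measurable ?Q"
      using measurable_compose[OF mE fm, of "max 0 t"] by simp
    show "\<And>n. (\<lambda>w. f (w (next_grid n (T w) + max 0 t))) \<in> borel_measurable ?Q"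
      using measurable_compose[OF mD fm, of "max 0 t"] by simp
  qed simp
  define V where "V = C * measure ?Q (space ?Q)"
  have h_bd: "\<bar>h t\<bar> \<le> V" for t
    unfolding h_def V_def
    using measurable_compose[OF mE fm, of "max 0 t"] C wE by (intro Q.abs_integral_le) auto
  have hn_bd: "\<bar>hn n t\<bar> \<le> V" for n t
    unfolding hn V_def
    using measurable_compose[OF mD fm, of "max 0 t"] C wD by (intro Q.abs_integral_le) auto
  have k_eq: "k t = (\<integral>w. (\<integral>y. f y \<partial>p (max 0 t) (w (T w))) \<partial>?Q)" for t
    unfolding k_def by (rule integral_law_at[OF T integral_p_measurable[OF fm]]) simp
  have k_bd: "\<bar>k t\<bar> \<le> V" for t
    unfolding k_eq V_def
    using measurable_compose[OF optional_on_eval[OF T] integral_p_measurable[OF fm], of "max 0 t"] abs_integral_p_le[OF fm C(1)] wE[of _ 0]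
    by (intro Q.abs_integral_le) auto
  have hn_meas [measurable]: "hn n \<in> borel_measurable borel" for n
    unfolding hn_def[abs_def] by (rule meas_int[OF N])
  \<comment> \<open>Measurability in time is inherited from \<open>hn n\<close>, a parameter
    integral of the jointly measurable kernel.\<close>
  have h_meas [measurable]: "h \<in> borel_measurable borel"
    by (rule borel_measurable_LIMSEQ_real[OF hn_lim hn_meas])
  have k_meas [measurable]: "k \<in> borel_measurable borel"
    unfolding k_def[abs_def] by (intro meas_int finite_law_at T) simp
  have transform: "(\<integral>t. h t \<partial>density lborel (exponential_density \<alpha>)) = (\<integral>t. k t \<partial>density lborel (exponential_density \<alpha>))"
    if \<alpha>: "0 < \<alpha>" for \<alpha>
  proof -
    let ?D = "density lborel (exponential_density \<alpha>)"
    interpret D: prob_space ?D using \<alpha> by (rule prob_space_exponential_density)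
    let ?U = "kernel_op M (u \<alpha>) f"
    have U: "?U \<in> Rp" using Rp_D(4)[OF fR \<alpha>] .
    note Ub = Rp_D(2)[OF U]
    note Um [measurable] = bounded_measurableD(1)[OF Ub]
    obtain C' where C': "\<forall>x\<in>E. \<bar>?U x\<bar> \<le> C'" using bounded_measurableD(2)[OF Ub] by auto
    have 1: "(\<lambda>n. \<integral>t. hn n t \<partial>?D) \<longlonglongrightarrow> (\<integral>t. h t \<partial>?D)"
      using hn_lim hn_bd by (intro integral_dominated_convergence[where w = "\<lambda>_. V"]) auto
    have 2: "(\<integral>t. hn n t \<partial>?D) = (\<integral>w. \<alpha> * ?U (w (next_grid n (T w))) \<partial>?Q)" for n
      unfolding hn_def integral_kernel_op_u[OF N f \<alpha>] unfolding N_def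
      by (rule integral_distr[OF mD0]) simp
    \<comment> \<open>Here the cone enters: \<open>?U\<close> belongs to it, so it is right
      continuous along paths. The integrand P_t f at a fixed t would not allow this limit.\<close>
    have 3: "(\<lambda>n. \<integral>w. \<alpha> * ?U (w (next_grid n (T w))) \<partial>?Q) \<longlonglongrightarrow> (\<integral>w. \<alpha> * ?U (w (T w)) \<partial>?Q)"
    proof (rule integral_dominated_convergence[where w = "\<lambda>_. \<alpha> * C'"])
      show "AE w in ?Q. (\<lambda>n. \<alpha> * ?U (w (next_grid n (T w)))) \<longlonglongrightarrow> \<alpha> * ?U (w (T w))"
      proof (rule AE_I2)
        fix w assume w: "w \<in> space ?Q"
        then have "filterlim (\<lambda>n. next_grid n (T w)) (at_right (T w)) sequentially"
          using next_grid_at_right[OF sp(2)[OF w], of 0] by simp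
        from filterlim_compose[OF Rp_path[OF U sp(1)[OF w] sp(2)[OF w]] this]
        show "(\<lambda>n. \<alpha> * ?U (w (next_grid n (T w)))) \<longlonglongrightarrow> \<alpha> * ?U (w (T w))" by (rule tendsto_mult_left)
      qed
      show "\<And>n. AE w in ?Q. norm (\<alpha> * ?U (w (next_grid n (T w)))) \<le> \<alpha> * C'"
        using C' wD[of _ 0] \<alpha> by (intro AE_I2) (simp add: abs_mult)
      show "(\<lambda>w. \<alpha> * ?U (w (T w))) \<in> borel_measurable ?Q"
        using measurable_compose[OF optional_on_eval[OF T] Um] by simp
      show "\<And>n. (\<lambda>w. \<alpha> * ?U (w (next_grid n (T w)))) \<in> borel_measurable ?Q"
        using measurable_compose[OF mD0 Um] by simp
    qed simp
    have 4: "(\<integral>t. k t \<partial>?D) = (\<integral>w. \<alpha> * ?U (w (T w)) \<partial>?Q)"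
      unfolding k_def integral_kernel_op_u[OF finite_law_at[OF T] sets_law_at f \<alpha>]
      by (rule integral_law_at[OF T]) simp
    show ?thesis unfolding 4 by (rule LIMSEQ_unique[OF 1 3[folded 2]])
  qed
  \<comment> \<open>Pointwise right continuity of P_t f(x) passes through the integral by dominated
    convergence, which is available for sequences.\<close>
  have k_rc: "(k \<longlongrightarrow> k s) (at_right s)"
    unfolding tendsto_at_iff_sequentially comp_def
  proof (intro allI impI)
    fix X :: "nat \<Rightarrow> real" assume X: "\<forall>i. X i \<in> {s<..} - {s}" "X \<longlonglongrightarrow> s"
    have lim: "filterlim X (at_right s) sequentially"
      using X by (auto simp: filterlim_at intro!: always_eventually)
    have X0: "0 \<le> X i" "max 0 (X i) = X i" for i using X(1) s by (auto simp: less_imp_le max_def not_le dest: spec[of _ i])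
    show "(\<lambda>i. k (X i)) \<longlonglongrightarrow> k s"
      unfolding k_def
    proof (rule integral_dominated_convergence[where w = "\<lambda>_. C"])
      show "AE x in law_at A T. (\<lambda>i. \<integral>y. f y \<partial>p (max 0 (X i)) x) \<longlonglongrightarrow> (\<integral>y. f y \<partial>p (max 0 s) x)"
        using s by (intro AE_I2) (auto simp: X0 max_absorb2 intro!: filterlim_compose[OF integral_p_right_continuous[OF fR] lim])
      show "\<And>i. AE x in law_at A T. norm (\<integral>y. f y \<partial>p (max 0 (X i)) x) \<le> C"
        using abs_integral_p_le[OF fm C(1)] by (intro AE_I2) simp
    qed (use integral_p_measurable[OF fm] in \<open>auto cong: measurable_cong_sets\<close>)
  qed
  have h_rc: "(h \<longlongrightarrow> h s) (at_right s)"
    unfolding tendsto_at_iff_sequentially comp_def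
  proof (intro allI impI)
    fix X :: "nat \<Rightarrow> real" assume X: "\<forall>i. X i \<in> {s<..} - {s}" "X \<longlonglongrightarrow> s"
    have X0: "0 \<le> X i" "max 0 (X i) = X i" for i using X(1) s by (auto simp: less_imp_le max_def not_le dest: spec[of _ i])
    show "(\<lambda>i. h (X i)) \<longlonglongrightarrow> h s"
      unfolding h_def
    proof (rule integral_dominated_convergence[where w = "\<lambda>_. C"])
      show "AE w in ?Q. (\<lambda>i. f (w (T w + max 0 (X i)))) \<longlonglongrightarrow> f (w (T w + max 0 s))"
      proof (rule AE_I2)
        fix w assume w: "w \<in> space ?Q"
        have "(\<lambda>i. T w + X i) \<longlonglongrightarrow> T w + s" by (intro tendsto_intros X)
        then have "filterlim (\<lambda>i. T w + X i) (at_right (T w + s)) sequentially"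
          using X(1) by (auto simp: filterlim_at intro!: always_eventually)
        from filterlim_compose[OF Rp_path[OF fR sp(1)[OF w]] this]
        show "(\<lambda>i. f (w (T w + max 0 (X i)))) \<longlonglongrightarrow> f (w (T w + max 0 s))"
          using sp(2)[OF w] s by (simp add: X0 max_absorb2)
      qed
      show "\<And>i. AE w in ?Q. norm (f (w (T w + max 0 (X i)))) \<le> C"
        using C wE by (intro AE_I2) simp
      show "(\<lambda>w. f (w (T w + max 0 s))) \<in> borel_measurable ?Q"
        using measurable_compose[OF mE fm, of "max 0 s"] by simp
      show "\<And>i. (\<lambda>w. f (w (T w + max 0 (X i)))) \<in> borel_measurable ?Q"
        using measurable_compose[OF mE fm] by simp
    qed simp
  qed
  \<comment> \<open>Only the integer rates n + 1 are used; the bound is V for each of the two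
    functions.\<close>
  have "h s - k s = 0"
  proof (rule exponential_transform_eq_0[where g = "\<lambda>t. h t - k t" and C = "V + V"])
    show "\<bar>h t - k t\<bar> \<le> V + V" for t using h_bd[of t] k_bd[of t] by linarith
    show "(\<integral>t. h t - k t \<partial>density lborel (exponential_density (real (Suc n)))) = 0" for n
    proof -
      interpret D: prob_space "density lborel (exponential_density (real (Suc n)))"
        by (rule prob_space_exponential_density) simp
      have "integrable (density lborel (exponential_density (real (Suc n)))) h"
        "integrable (density lborel (exponential_density (real (Suc n)))) k"
        using h_bd k_bd by (intro D.integrable_const_bound[where B = V] AE_I2; simp)+
      then show ?thesis using transform[of "real (Suc n)"] by simp
    qed
  qed (use s in \<open>auto intro!: tendsto_intros h_rc k_rc\<close>)
  then have "h s = k s" by simp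
  moreover have "(\<integral>x. f x \<partial>law_at A (\<lambda>w. T w + s)) = h s"
    using s by (simp add: integral_law_at[OF optional_on_shift[OF T s] fm] h_def max_absorb2)
  moreover have e1: "emeasure (p s x) E = 1" if "x \<in> E" for x
    using prob_space.emeasure_space_1[OF p_D(1)[OF s that]] p_D(3)[OF s that] by simp
  have "(\<integral>x. f x \<partial>(law_at A T \<bind> p s)) = k s"
    using s C E_nonempty unfolding k_def
    by (subst integral_bind[OF fm _ ps, of C 1])
      (auto simp: p_D max_absorb2 e1 intro!: AE_I2 finite_law_at[OF T])

  ultimately show "(\<integral>x. f x \<partial>law_at A (\<lambda>w. T w + s)) = (\<integral>x. f x \<partial>(law_at A T \<bind> p s))" by simp
qed simp

end

section \<open>The law of the shifted path\<close>

text \<open>The list entries carry the time increments, not the times; these make the Markov property an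
  induction on the list.\<close>

primrec cyl :: "(real \<times> 'a set) list \<Rightarrow> real \<Rightarrow> (real \<Rightarrow> 'a) \<Rightarrow> bool" where
  "cyl [] a w = True"
| "cyl (sB # l) a w = (w (a + fst sB) \<in> snd sB \<and> cyl l (a + fst sB) w)"

text \<open>Constraints are indexed by a set of times, which makes stability under intersection
  accessible; sorting the times converts this form into the increment lists of
  \<open>cyl\<close>.\<close>

definition cylinders :: "'a::topological_space set \<Rightarrow> (real \<Rightarrow> 'a) set set" where
  "cylinders E = {{w \<in> cadlag E. \<forall>t\<in>I. w t \<in> B t} | I B.
     finite I \<and> I \<subseteq> {0..} \<and> (\<forall>t\<in>I. B t \<in> sets (borel_of E))}"

lemma cylinders_Int_stable: "Int_stable (cylinders E)"
proof (rule Int_stableI)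
  fix X Y assume "X \<in> cylinders E" "Y \<in> cylinders E"
  then obtain I B J C where X: "X = {w \<in> cadlag E. \<forall>t\<in>I. w t \<in> B t}" "finite I" "I \<subseteq> {0..}" "\<forall>t\<in>I. B t \<in> sets (borel_of E)"
    and Y: "Y = {w \<in> cadlag E. \<forall>t\<in>J. w t \<in> C t}" "finite J" "J \<subseteq> {0..}" "\<forall>t\<in>J. C t \<in> sets (borel_of E)"
    unfolding cylinders_def by blast
  \<comment> \<open>A time constrained in only one of the two cylinders receives the dummy
    constraint E, which every path satisfies.\<close>
  define D where "D t = (if t \<in> I then B t else E) \<inter> (if t \<in> J then C t else E)" for t
  have "E \<in> sets (borel_of E)" using sets.top[of "borel_of E"] by (simp add: space_restrict_space)
  then have D: "D t \<in> sets (borel_of E)" for t using X(4) Y(4) by (simp add: D_def)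
  have "X \<inter> Y = {w \<in> cadlag E. \<forall>t\<in>I \<union> J. w t \<in> D t}"
  proof (intro set_eqI iffI)
    fix w assume w: "w \<in> X \<inter> Y"
    have "w t \<in> E" if "t \<in> I \<union> J" for t
      using w that X(1,3) Y(3) by (intro cadlagD(1)[of w]) auto
    with w show "w \<in> {w \<in> cadlag E. \<forall>t\<in>I \<union> J. w t \<in> D t}" by (auto simp: X(1) Y(1) D_def)
  qed (auto simp: X(1) Y(1) D_def split: if_splits)
  then show "X \<inter> Y \<in> cylinders E"
    unfolding cylinders_def using X(2,3) Y(2,3) D by (intro CollectI exI[of _ "I \<union> J"] exI[of _ D]) simp
qed

lemma cadlag_cylinders: "cadlag E \<in> cylinders E"
  unfolding cylinders_def by (intro CollectI exI[of _ "{}"]) simp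

lemma cylinders_subset: "cylinders E \<subseteq> Pow (cadlag E)"
  by (auto simp: cylinders_def)

lemma sets_coord_cylinders: "sets (coord_algebra E {0..}) = sigma_sets (cadlag E) (cylinders E)"
proof (rule antisym)
  show "sigma_sets (cadlag E) (cylinders E) \<subseteq> sets (coord_algebra E {0..})"
  proof -
    have "cylinders E \<subseteq> sets (coord_algebra E {0..})"
    proof
      fix X assume "X \<in> cylinders E"
      then obtain I B where X: "X = {w \<in> cadlag E. \<forall>t\<in>I. w t \<in> B t}" "finite I" "I \<subseteq> {0..}" "\<forall>t\<in>I. B t \<in> sets (borel_of E)"
        unfolding cylinders_def by blast
      have "{w \<in> space (coord_algebra E {0..}). \<forall>t\<in>I. w t \<in> B t} \<in> sets (coord_algebra E {0..})"
      proof (rule sets.sets_Collect_finite_All[OF _ X(2)])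
        fix t assume "t \<in> I"
        then show "{w \<in> space (coord_algebra E {0..}). w t \<in> B t} \<in> sets (coord_algebra E {0..})"
          using measurable_sets[OF coord_measurable[of "{0..}" t E], of "B t"] X(3,4)
          by (auto simp: vimage_def Int_def conj_commute)
      qed
      then show "X \<in> sets (coord_algebra E {0..})" by (simp add: X(1))
    qed
    from sets.sigma_sets_subset[OF this] show ?thesis by simp
  qed
  show "sets (coord_algebra E {0..}) \<subseteq> sigma_sets (cadlag E) (cylinders E)"
    unfolding sets_coord_algebra
  proof (rule sigma_sets_mono', rule subsetI)
    fix X assume "X \<in> {(\<lambda>w. w t) -` B \<inter> cadlag E |t B. t \<in> {0..} \<and> B \<in> sets (borel_of E)}"
    then obtain t B where "X = (\<lambda>w. w t) -` B \<inter> cadlag E" "t \<in> {0..}" "B \<in> sets (borel_of E)" by blast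
    then show "X \<in> cylinders E"
      unfolding cylinders_def by (intro CollectI exI[of _ "{t}"] exI[of _ "\<lambda>_. B"]) auto
  qed
qed

text \<open>The increment at a time t is t - a for the preceding time a; sortedness makes it
  nonnegative.\<close>

lemma cyl_of_times:
  assumes "sorted ts" "\<forall>t\<in>set ts. a \<le> t" "\<forall>t\<in>set ts. B t \<in> S"
  shows "\<exists>l\<in>lists ({0..} \<times> S). \<forall>w. cyl l a w \<longleftrightarrow> (\<forall>t\<in>set ts. w t \<in> B t)"
  using assms
proof (induction ts arbitrary: a)
  case Nil
  then show ?case by (intro bexI[of _ "[]"]) auto
next
  case (Cons t ts)
  have "\<exists>l\<in>lists ({0..} \<times> S). \<forall>w. cyl l t w \<longleftrightarrow> (\<forall>t\<in>set ts. w t \<in> B t)"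
    using Cons.prems by (intro Cons.IH) auto
  then obtain l where l: "l \<in> lists ({0..} \<times> S)" "\<forall>w. cyl l t w \<longleftrightarrow> (\<forall>t\<in>set ts. w t \<in> B t)"
    by blast
  then show ?case using Cons.prems by (intro bexI[of _ "(t - a, B t) # l"]) auto
qed

lemma cylinders_cyl:
  assumes "X \<in> cylinders E"
  shows "\<exists>l\<in>lists ({0..} \<times> sets (borel_of E)). X = {w \<in> cadlag E. cyl l 0 w}"
proof -
  obtain I B where X: "X = {w \<in> cadlag E. \<forall>t\<in>I. w t \<in> B t}" "finite I" "I \<subseteq> {0..}" "\<forall>t\<in>I. B t \<in> sets (borel_of E)"
    using assms unfolding cylinders_def by blast
  have "\<exists>l\<in>lists ({0..} \<times> sets (borel_of E)). \<forall>w. cyl l 0 w \<longleftrightarrow> (\<forall>t\<in>set (sorted_list_of_set I). w t \<in> B t)"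
    using X by (intro cyl_of_times) auto
  then show ?thesis using X(1,2) by auto
qed

lemma cyl_shift:
  assumes "l \<in> lists ({0..} \<times> S)" "0 \<le> a"
  shows "cyl l a (shift t w) \<longleftrightarrow> cyl l (t + a) w"
  using assms by (induction l arbitrary: a) (auto simp: shift_def add.assoc)

lemma shift_cadlag:
  assumes w: "w \<in> cadlag E" and t: "0 \<le> t"
  shows "shift t w \<in> cadlag E"
  unfolding cadlag_def
proof (intro CollectI conjI allI impI)
  show "shift t w \<in> {0..} \<rightarrow>\<^sub>E E" using w t by (auto simp: shift_def intro!: cadlagD(1)[of w])
next
  fix s :: real assume s: "0 \<le> s"
  have "filterlim (\<lambda>r. t + r) (at_right (t + s)) (at_right s)"
    unfolding filterlim_at by (auto intro!: tendsto_eq_intros simp: eventually_at_filter)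
  from filterlim_compose[OF cadlagD(2)[OF w] this] s t
  have "((\<lambda>r. w (t + r)) \<longlongrightarrow> w (t + s)) (at_right s)" by simp
  moreover have "\<forall>\<^sub>F r in at_right s. w (t + r) = shift t w r"
    using eventually_at_right_less[of s] by eventually_elim (use s in \<open>simp add: shift_def\<close>)
  ultimately have "(shift t w \<longlongrightarrow> w (t + s)) (at_right s)" by (rule Lim_transform_eventually)
  moreover have "shift t w s = w (t + s)" using s by (simp add: shift_def)
  ultimately show "(shift t w \<longlongrightarrow> shift t w s) (at_right s)" by simp
next
  fix s :: real assume s: "0 < s"
  then have "0 < t + s" using t by simp
  then obtain m where m: "(w \<longlongrightarrow> m) (at_left (t + s))" using w unfolding cadlag_def by blast
  have "filterlim (\<lambda>r. t + r) (at_left (t + s)) (at_left s)"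
    unfolding filterlim_at by (auto intro!: tendsto_eq_intros simp: eventually_at_filter)
  from filterlim_compose[OF m this] have "((\<lambda>r. w (t + r)) \<longlongrightarrow> m) (at_left s)" .
  moreover have "\<forall>\<^sub>F r in at_left s. w (t + r) = shift t w r"
    using eventually_at_left_real[OF s] by eventually_elim (simp add: shift_def)
  ultimately show "\<exists>m. (shift t w \<longlongrightarrow> m) (at_left s)"
    using Lim_transform_eventually by blast
qed

context engelbert_process
begin

text \<open>Iterated integrals giving the cylinder masses of the process started at x. A first
  increment 0 still integrates against \<open>p 0 x\<close>, not against the point mass at
  x.\<close>

primrec fdd :: "(real \<times> 'a set) list \<Rightarrow> 'a \<Rightarrow> ennreal" where
  "fdd [] x = 1"
| "fdd (sB # l) x = (\<integral>\<^sup>+y. indicator (snd sB) y * fdd l y \<partial>p (fst sB) x)"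

lemma fdd_measurable: "l \<in> lists ({0..} \<times> sets M) \<Longrightarrow> fdd l \<in> borel_measurable M"
proof (induction l)
  case (Cons sB l)
  then have [measurable]: "fdd l \<in> borel_measurable M" "snd sB \<in> sets M" and s: "0 \<le> fst sB" by auto
  have "(\<lambda>x. \<integral>\<^sup>+y. indicator (snd sB) y * fdd l y \<partial>p (fst sB) x) \<in> borel_measurable M"
    by (rule measurable_compose[OF p_subprob[OF s] nn_integral_measurable_subprob_algebra]) measurable
  then show ?case by simp
next
  case Nil
  have "fdd [] = (\<lambda>_. 1)" by (rule ext) simp
  then show ?case by simp
qed

end

context engelbert_law
begin

lemma nn_integral_law_at:
  assumes T: "optional_on A T" and f: "f \<in> borel_measurable M"
  shows "(\<integral>\<^sup>+x. f x \<partial>law_at A T) = (\<integral>\<^sup>+w. f (w (T w)) * indicator A w \<partial>Pc)"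
proof -
  have "A \<inter> space Pc \<in> sets Pc" using optional_on_sets[OF T] by blast
  then have "(\<integral>\<^sup>+w. f (w (T w)) * indicator A w \<partial>Pc) = (\<integral>\<^sup>+w. f (w (T w)) \<partial>restrict_space Pc A)"
    by (rule nn_integral_restrict_space[symmetric])
  then show ?thesis unfolding law_at_def by (simp add: nn_integral_distr[OF optional_on_eval[OF T]] f)
qed

lemma nn_integral_law_at_Int:
  assumes T: "optional_on A T" and B [measurable]: "B \<in> sets M" and f [measurable]: "f \<in> borel_measurable M"
  shows "(\<integral>\<^sup>+x. f x \<partial>law_at {w \<in> A. w (T w) \<in> B} T) = (\<integral>\<^sup>+x. indicator B x * f x \<partial>law_at A T)"
proof -
  have "(\<integral>\<^sup>+x. indicator B x * f x \<partial>law_at A T) = (\<integral>\<^sup>+w. indicator B (w (T w)) * f (w (T w)) * indicator A w \<partial>Pc)"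
    by (rule nn_integral_law_at[OF T]) measurable
  also have "\<dots> = (\<integral>\<^sup>+w. f (w (T w)) * indicator {w \<in> A. w (T w) \<in> B} w \<partial>Pc)"
    by (intro nn_integral_cong) (auto simp: indicator_def)
  also have "\<dots> = (\<integral>\<^sup>+x. f x \<partial>law_at {w \<in> A. w (T w) \<in> B} T)"
    by (rule nn_integral_law_at[symmetric]) (intro optional_on_Int_eval T B f)+
  finally show ?thesis ..
qed

text \<open>The induction keeps A and T arbitrary: the first constraint moves into the event, the
  base time advances to T + s, and \<open>strong_markov\<close> expresses the law there through the
  law at T.\<close>

lemma emeasure_cyl:
  assumes "optional_on A T" "l \<in> lists ({0..} \<times> sets M)"
  shows "emeasure Pc {w \<in> A. cyl l (T w) w} = (\<integral>\<^sup>+x. fdd l x \<partial>law_at A T)"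
  using assms
proof (induction l arbitrary: A T)
  case Nil
  then show ?case
    using nn_integral_law_at[OF Nil(1), of "\<lambda>_. 1"] optional_on_sets[OF Nil(1)] by simp
next
  case (Cons sB l)
  define s B where "s = fst sB" and "B = snd sB"
  have s: "0 \<le> s" and B [measurable]: "B \<in> sets M" and l: "l \<in> lists ({0..} \<times> sets M)"
    using Cons.prems(2) by (auto simp: s_def B_def)
  note T = Cons.prems(1)
  note Ts = optional_on_shift[OF T s]
  note [measurable] = fdd_measurable[OF l]
  have fx: "fdd (sB # l) = (\<lambda>x. \<integral>\<^sup>+y. indicator B y * fdd l y \<partial>p s x)"
    by (rule ext) (simp add: s_def B_def)
  have "emeasure Pc {w \<in> A. cyl (sB # l) (T w) w} =
      emeasure Pc {w \<in> {w \<in> A. w (T w + s) \<in> B}. cyl l (T w + s) w}"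
    by (intro arg_cong[where f = "emeasure Pc"]) (auto simp: s_def B_def)
  also have "\<dots> = (\<integral>\<^sup>+x. fdd l x \<partial>law_at {w \<in> A. w (T w + s) \<in> B} (\<lambda>w. T w + s))"
    by (intro Cons.IH optional_on_Int_eval Ts B l)
  also have "\<dots> = (\<integral>\<^sup>+x. indicator B x * fdd l x \<partial>law_at A (\<lambda>w. T w + s))"
    by (intro nn_integral_law_at_Int Ts B) measurable
  also have "\<dots> = (\<integral>\<^sup>+x. indicator B x * fdd l x \<partial>(law_at A T \<bind> p s))"
    by (simp add: strong_markov[OF T s])
  also have "\<dots> = (\<integral>\<^sup>+x. fdd (sB # l) x \<partial>law_at A T)"
    using p_subprob[OF s]
    unfolding fx by (intro nn_integral_bind[where B = M]) (auto cong: measurable_cong_sets)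
  finally show ?case .
qed

lemma optional_on_const: "0 \<le> s \<Longrightarrow> optional_on (cadlag E) (\<lambda>_. s)"
  using sets.top[of "F t" for t] by (auto simp: optional_on_def space_F)

text \<open>This is the marginal clause of \<open>markov_law\<close>, rewritten as an identity of
  measures by testing on the cone.\<close>

lemma law_at_const:
  assumes s: "0 \<le> s"
  shows "law_at (cadlag E) (\<lambda>_. s) = \<mu> \<bind> p s"
proof (rule measure_eqI_Rp)
  have m: "prob_space \<mu>" "sets \<mu> = sets M" using mu by (auto simp: space_prob_algebra)
  have sp: "space \<mu> = E" using sets_eq_imp_space_eq[OF m(2)] by simp
  have ps: "p s \<in> \<mu> \<rightarrow>\<^sub>M subprob_algebra M" using p_subprob[OF s] by (simp add: measurable_cong_sets[OF m(2) refl])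
  show "finite_measure (law_at (cadlag E) (\<lambda>_. s))" by (intro finite_law_at optional_on_const s)
  show "finite_measure (\<mu> \<bind> p s)"
    using subprob_space_bind[OF prob_space_imp_subprob_space[OF m(1)] ps] subprob_space.axioms(1) by blast
  show "sets (\<mu> \<bind> p s) = sets M"
    using E_nonempty p_D(2)[OF s] sp by (intro sets_bind) auto
  fix f assume f: "f \<in> Rp"
  note fb = Rp_D(2)[OF f]
  obtain C where C: "\<forall>x\<in>E. \<bar>f x\<bar> \<le> C" using bounded_measurableD(2)[OF fb] by auto
  note fm = bounded_measurableD(1)[OF fb]
  have "(\<integral>x. f x \<partial>law_at (cadlag E) (\<lambda>_. s)) = (LINT w:cadlag E|Pc. f (w s))"
    by (simp add: integral_law_at[OF optional_on_const[OF s] fm] set_integral_restrict[OF optional_on_sets[OF optional_on_const[OF s]]])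
  also have "\<dots> = (LINT w|Pc. f (w s))"
    unfolding set_lebesgue_integral_def by (intro Bochner_Integration.integral_cong) (auto simp: space_P)
  also have "\<dots> = (LINT w|P \<mu>. f (w s))"
    by (rule integral_completion[OF measurable_compose[OF coord_P[OF s] fm]])
  also have "\<dots> = (LINT x|\<mu>. kernel_op M (p s) f x)"
    using law[OF mu] fb s by (auto simp: markov_law_def)
  also have "\<dots> = (LINT x|\<mu>. \<integral>y. f y \<partial>p s x)"
    by (intro Bochner_Integration.integral_cong) (auto simp: sp kernel_op_p)
  also have "\<dots> = (\<integral>x. f x \<partial>(\<mu> \<bind> p s))"
    using C prob_space.emeasure_space_1[OF p_D(1)[OF s]] m(1)
    by (intro integral_bind[OF fm _ ps, of C 1, symmetric]) (auto simp: sp prob_space_def intro!: AE_I2)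
  finally show "(\<integral>x. f x \<partial>law_at (cadlag E) (\<lambda>_. s)) = (\<integral>x. f x \<partial>(\<mu> \<bind> p s))" .
qed simp

lemma cyl_sets:
  assumes "l \<in> lists ({0..} \<times> sets M)" "0 \<le> a"
  shows "{w \<in> cadlag E. cyl l a w} \<in> sets (P \<mu>)"
  using assms(2,1)
proof (induction l arbitrary: a)
  case Nil
  then show ?case using sets.top[of "P \<mu>"] by (simp add: space_P)
next
  case (Cons sB l)
  have "{w \<in> cadlag E. cyl (sB # l) a w} = ((\<lambda>w. w (a + fst sB)) -` snd sB \<inter> space (P \<mu>)) \<inter> {w \<in> cadlag E. cyl l (a + fst sB) w}"
    by (auto simp: space_P)
  also have "\<dots> \<in> sets (P \<mu>)"
  proof (rule sets.Int)
    have "0 \<le> a + fst sB" "snd sB \<in> sets M" using Cons.prems by auto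
    then show "(\<lambda>w. w (a + fst sB)) -` snd sB \<inter> space (P \<mu>) \<in> sets (P \<mu>)"
      "{w \<in> cadlag E. cyl l (a + fst sB) w} \<in> sets (P \<mu>)"
      using Cons.prems by (auto intro: measurable_sets[OF coord_P] Cons.IH)
  qed
  finally show ?case .
qed

text \<open>The first constraint is evaluated by the marginal law, which brings in \<mu>; the others
  follow from the Markov property at the constant time s. Applying \<open>emeasure_cyl\<close> at
  time 0 would produce \<open>\<mu> \<bind> p 0\<close> in place of \<mu>.\<close>

lemma emeasure_P_cyl:
  assumes "l \<in> lists ({0..} \<times> sets M)"
  shows "emeasure (P \<mu>) {w \<in> cadlag E. cyl l 0 w} = (\<integral>\<^sup>+x. fdd l x \<partial>\<mu>)"
proof (cases l)
  case Nil
  have m: "prob_space \<mu>" using mu by (auto simp: space_prob_algebra)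
  show ?thesis using Nil prob_space.emeasure_space_1[OF prob_space_P] prob_space.emeasure_space_1[OF m]
    by (simp add: space_P)
next
  case (Cons sB l')
  define s B where "s = fst sB" and "B = snd sB"
  have s: "0 \<le> s" and B [measurable]: "B \<in> sets M" and l': "l' \<in> lists ({0..} \<times> sets M)"
    using assms Cons by (auto simp: s_def B_def)
  have m: "sets \<mu> = sets M" using mu by (auto simp: space_prob_algebra)
  note [measurable] = fdd_measurable[OF l']
  have fx: "fdd l = (\<lambda>x. \<integral>\<^sup>+y. indicator B y * fdd l' y \<partial>p s x)"
    by (rule ext) (simp add: s_def B_def Cons)
  have "emeasure (P \<mu>) {w \<in> cadlag E. cyl l 0 w} = emeasure Pc {w \<in> cadlag E. cyl l 0 w}"
    using cyl_sets[OF assms order_refl] by (simp add: main_part_sets)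
  also have "\<dots> = emeasure Pc {w \<in> {w \<in> cadlag E. w s \<in> B}. cyl l' s w}"
    by (intro arg_cong[where f = "emeasure Pc"]) (auto simp: s_def B_def Cons)
  also have "\<dots> = (\<integral>\<^sup>+x. fdd l' x \<partial>law_at {w \<in> cadlag E. w s \<in> B} (\<lambda>_. s))"
    using optional_on_Int_eval[OF optional_on_const[OF s] B] by (intro emeasure_cyl l')
  also have "\<dots> = (\<integral>\<^sup>+x. indicator B x * fdd l' x \<partial>law_at (cadlag E) (\<lambda>_. s))"
    using nn_integral_law_at_Int[OF optional_on_const[OF s] B] by measurable
  also have "\<dots> = (\<integral>\<^sup>+x. indicator B x * fdd l' x \<partial>(\<mu> \<bind> p s))"
    by (simp add: law_at_const[OF s])
  also have "\<dots> = (\<integral>\<^sup>+x. fdd l x \<partial>\<mu>)"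
    using p_subprob[OF s]
    unfolding fx by (intro nn_integral_bind[where B = M]) (auto simp: measurable_cong_sets[OF m refl])
  finally show ?thesis .
qed

lemma shift_measurable:
  assumes T: "optional_on A T"
  shows "(\<lambda>w. shift (T w) w) \<in> restrict_space Pc A \<rightarrow>\<^sub>M G0"
  unfolding coord_algebra_def
proof (rule measurable_measure_of)
  show "(\<lambda>w. shift (T w) w) \<in> space (restrict_space Pc A) \<rightarrow> cadlag E"
    using T by (auto simp: space_optional_on[OF T] optional_on_def intro: shift_cadlag)
  fix X assume "X \<in> {(\<lambda>w. w t) -` B \<inter> cadlag E |t B. t \<in> {0..} \<and> B \<in> sets M}"
  then obtain t B where X: "X = (\<lambda>w. w t) -` B \<inter> cadlag E" "0 \<le> t" "B \<in> sets M" by auto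
  have "(\<lambda>w. shift (T w) w) -` X \<inter> space (restrict_space Pc A) =
      (\<lambda>w. w (T w + t)) -` B \<inter> space (restrict_space Pc A)"
  proof -
    have "shift (T w) w \<in> cadlag E" if "w \<in> A" for w
      using T that by (intro shift_cadlag) (auto simp: optional_on_def)
    moreover have "shift (T w) w t = w (T w + t)" for w using X(2) by (simp add: shift_def)
    ultimately show ?thesis by (auto simp: X(1) space_optional_on[OF T])
  qed
  then show "(\<lambda>w. shift (T w) w) -` X \<inter> space (restrict_space Pc A) \<in> sets (restrict_space Pc A)"
    using measurable_sets[OF optional_on_eval[OF optional_on_shift[OF T X(2)]] X(3)] by simp
qed auto

end

section \<open>Path laws as mixtures of the laws started from points\<close>

context engelbert_process
begin

text \<open>The laws \<open>P \<mu>\<close> are given separately for each \<mu>. That \<kappa> is a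
  measurable kernel, and that \<open>P \<mu>\<close> is its mixture under \<mu>, has to be derived
  from cylinder masses.\<close>

definition \<kappa> :: "'a \<Rightarrow> (real \<Rightarrow> 'a) measure" where
  "\<kappa> x = P (return M x)"

lemma engelbert_lawI: "\<mu> \<in> space (prob_algebra M) \<Longrightarrow> engelbert_law E u Rp p P \<mu>"
  by unfold_locales

lemma return_in: "x \<in> E \<Longrightarrow> return M x \<in> space (prob_algebra M)"
  by (auto simp: space_prob_algebra intro!: prob_space_return)

lemma \<kappa>_D:
  assumes "x \<in> E"
  shows "prob_space (\<kappa> x)" "sets (\<kappa> x) = sets G0" "space (\<kappa> x) = cadlag E"
proof -
  show "prob_space (\<kappa> x)" "sets (\<kappa> x) = sets G0"
    using P_in[OF return_in[OF assms]] by (auto simp: \<kappa>_def space_prob_algebra)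
  from sets_eq_imp_space_eq[OF this(2)] show "space (\<kappa> x) = cadlag E" by simp
qed

lemma emeasure_\<kappa>_cyl:
  assumes "l \<in> lists ({0..} \<times> sets M)" "x \<in> E"
  shows "emeasure (\<kappa> x) {w \<in> cadlag E. cyl l 0 w} = fdd l x"
  unfolding \<kappa>_def engelbert_law.emeasure_P_cyl[OF engelbert_lawI[OF return_in[OF assms(2)]] assms(1)]
  using assms(2) fdd_measurable[OF assms(1)] by (simp add: nn_integral_return)

text \<open>It suffices to test on the generating cylinders, whose masses as functions of x are the
  measurable functions \<open>fdd l\<close>.\<close>

lemma \<kappa>_measurable [measurable]: "\<kappa> \<in> M \<rightarrow>\<^sub>M prob_algebra G0"
proof (rule measurable_prob_algebra_generated[OF sets_coord_cylinders cylinders_Int_stable cylinders_subset])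
  fix X assume "X \<in> cylinders E"
  then obtain l where l: "l \<in> lists ({0..} \<times> sets M)" "X = {w \<in> cadlag E. cyl l 0 w}"
    using cylinders_cyl by blast
  show "(\<lambda>x. emeasure (\<kappa> x) X) \<in> borel_measurable M"
    using fdd_measurable[OF l(1)] emeasure_\<kappa>_cyl[OF l(1)] unfolding l(2)
    by (subst measurable_cong) auto
qed (simp_all add: \<kappa>_D)

text \<open>Serves both \<open>P \<mu>\<close> and the law of the path shifted by T on an event; the
  latter requires m to be a sub-probability measure.\<close>

lemma bind_\<kappa>_eqI:
  assumes m: "subprob_space m" "sets m = sets M" and N: "sets N = sets G0"
    and eq: "\<And>l. l \<in> lists ({0..} \<times> sets M) \<Longrightarrow> emeasure N {w \<in> cadlag E. cyl l 0 w} = (\<integral>\<^sup>+x. fdd l x \<partial>m)"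
  shows "N = m \<bind> \<kappa>"
proof -
  have sp: "space m = E" using sets_eq_imp_space_eq[OF m(2)] by simp
  have ne: "space m \<noteq> {}" by (rule subprob_space.subprob_not_empty[OF m(1)])
  have k: "\<kappa> \<in> m \<rightarrow>\<^sub>M subprob_algebra G0"
    using measurable_prob_algebraD[OF \<kappa>_measurable] by (simp add: measurable_cong_sets[OF m(2) refl])
  have s: "sets (m \<bind> \<kappa>) = sets G0" by (rule sets_bind[OF sets_kernel[OF k] ne])
  have em: "emeasure N X = emeasure (m \<bind> \<kappa>) X" if "X \<in> cylinders E" for X
  proof -
    obtain l where l: "l \<in> lists ({0..} \<times> sets M)" "X = {w \<in> cadlag E. cyl l 0 w}"
      using \<open>X \<in> cylinders E\<close> cylinders_cyl by blast
    have X: "X \<in> sets G0" using that by (auto simp: sets_coord_cylinders)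
    show ?thesis
      unfolding emeasure_bind[OF ne k X] unfolding l(2) eq[OF l(1)]
      by (intro nn_integral_cong) (simp add: sp emeasure_\<kappa>_cyl[OF l(1)])
  qed
  show ?thesis
  proof (rule measure_eqI_generator_eq[OF cylinders_Int_stable cylinders_subset em, where A = "\<lambda>_. cadlag E"])
    show "emeasure N (cadlag E) \<noteq> \<infinity>"
      unfolding em[OF cadlag_cylinders]
      using subprob_space.emeasure_space_le_1[OF subprob_space_bind[OF m(1) k]] sets_eq_imp_space_eq[OF s]
      by (auto simp: top_unique)
  qed (use N s in \<open>auto simp: sets_coord_cylinders cadlag_cylinders\<close>)
qed

end

context engelbert_law
begin

lemma P_eq_bind: "P \<mu> = \<mu> \<bind> \<kappa>"
  using mu emeasure_P_cyl sets_P by (intro bind_\<kappa>_eqI) (auto simp: space_prob_algebra prob_space_imp_subprob_space)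

text \<open>A cylinder for the shifted path is a cylinder with base time T for the original one, so
  its mass is known from \<open>emeasure_cyl\<close>. This is the strong Markov property for whole
  paths.\<close>

lemma shift_law:
  assumes T: "optional_on A T"
  shows "distr (restrict_space Pc A) G0 (\<lambda>w. shift (T w) w) = law_at A T \<bind> \<kappa>"
proof (rule bind_\<kappa>_eqI[OF subprob_law_at[OF T] sets_law_at])
  fix l :: "(real \<times> 'a set) list" assume l: "l \<in> lists ({0..} \<times> sets M)"
  let ?X = "{w \<in> cadlag E. cyl l 0 w}"
  have X: "?X \<in> sets G0" using cyl_sets[OF l, of 0] by (simp add: sets_P)
  have A: "A \<in> sets Pc" by (rule optional_on_sets[OF T])
  have eq: "(\<lambda>w. shift (T w) w) -` ?X \<inter> space (restrict_space Pc A) = {w \<in> A. cyl l (T w) w}"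
    using T cyl_shift[OF l, of 0] by (auto simp: space_optional_on[OF T] optional_on_def intro: shift_cadlag)
  have "emeasure (distr (restrict_space Pc A) G0 (\<lambda>w. shift (T w) w)) ?X =
      emeasure (restrict_space Pc A) {w \<in> A. cyl l (T w) w}"
    unfolding emeasure_distr[OF shift_measurable[OF T] X] eq ..
  also have "\<dots> = emeasure Pc {w \<in> A. cyl l (T w) w}"
    using A by (intro emeasure_restrict_space) (auto simp only: sets.Int_space_eq2)
  also have "\<dots> = (\<integral>\<^sup>+x. fdd l x \<partial>law_at A T)" by (rule emeasure_cyl[OF T l])
  finally show "emeasure (distr (restrict_space Pc A) G0 (\<lambda>w. shift (T w) w)) ?X = (\<integral>\<^sup>+x. fdd l x \<partial>law_at A T)" .
qed simp

end

section \<open>Right continuity of the augmented filtration\<close>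

context engelbert_law
begin

text \<open>At a constant time t the inequality t < s is either always or never true, so only
  membership of A in \<open>F s\<close> for s > t is demanded. Events of the right limit of the
  filtration are therefore covered by the strong Markov property at t.\<close>

lemma optional_on_constI:
  assumes "0 \<le> t" "A \<subseteq> cadlag E" "\<And>s. t < s \<Longrightarrow> A \<in> sets (F s)"
  shows "optional_on A (\<lambda>_. t)"
  unfolding optional_on_def
proof (intro conjI ballI allI impI)
  fix s :: real assume "0 < s"
  show "{w \<in> A. t < s} \<in> sets (F s)" using assms(3)[of s] by (cases "t < s") auto
qed (use assms in auto)

lemma emeasure_shift:
  assumes T: "optional_on A T" and X: "X \<in> sets G0"
  shows "emeasure Pc {w \<in> A. shift (T w) w \<in> X} = (\<integral>\<^sup>+w. emeasure (\<kappa> (w (T w))) X * indicator A w \<partial>Pc)"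
proof -
  have A: "A \<in> sets Pc" by (rule optional_on_sets[OF T])
  have k: "\<kappa> \<in> law_at A T \<rightarrow>\<^sub>M subprob_algebra G0"
    using measurable_prob_algebraD[OF \<kappa>_measurable] by (simp cong: measurable_cong_sets)
  have "emeasure Pc {w \<in> A. shift (T w) w \<in> X} = emeasure (restrict_space Pc A) {w \<in> A. shift (T w) w \<in> X}"
    using A by (intro emeasure_restrict_space[symmetric]) (auto simp only: sets.Int_space_eq2)
  also have "\<dots> = emeasure (distr (restrict_space Pc A) G0 (\<lambda>w. shift (T w) w)) X"
    unfolding emeasure_distr[OF shift_measurable[OF T] X]
    by (intro arg_cong[where f = "emeasure _"]) (auto simp: space_optional_on[OF T])
  also have "\<dots> = (\<integral>\<^sup>+x. emeasure (\<kappa> x) X \<partial>law_at A T)"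
    unfolding shift_law[OF T] using E_nonempty by (intro emeasure_bind[OF _ k X]) simp
  also have "\<dots> = (\<integral>\<^sup>+w. emeasure (\<kappa> (w (T w))) X * indicator A w \<partial>Pc)"
    by (intro nn_integral_law_at T measurable_emeasure_kernel[OF measurable_prob_algebraD[OF \<kappa>_measurable] X])
  finally show ?thesis .
qed

text \<open>For \<open>A\<close> in the right limit of the filtration at \<open>t\<close>, the strong Markov property at the constant
  time \<open>t\<close> shows that \<open>\<P>(A \<inter> X) = \<integral>\<^sub>X \<P>(A | \<G>\<^sup>0\<^sub>t)\<close> for all cylinders \<open>X\<close>.\<close>

lemma F_right_continuous:
  assumes t: "0 \<le> t" and AF: "\<And>s. t < s \<Longrightarrow> A \<in> sets (F s)"
  shows "A \<in> sets (F t)"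
proof -
  interpret Q: prob_space "P \<mu>" by (rule prob_space_P)
  let ?G = "coord_algebra E {0..t}"
  have GG0: "sets ?G \<subseteq> sets G0" by (rule sets_coord_algebra_mono) auto
  have sub: "subalgebra (P \<mu>) ?G" using GG0 by (simp add: subalgebra_def space_P sets_P)
  interpret sub: finite_measure_subalgebra "P \<mu>" ?G by unfold_locales (rule sub)
  have GF: "sets ?G \<subseteq> sets (F s)" if "t < s" for s
    using F_mono[of t s] that coord_F_sub[of t] by auto
  have APc: "A \<in> sets Pc" using AF[of "t + 1"] F_Pc by auto
  have Acad: "A \<subseteq> cadlag E" using sets.sets_into_space[OF APc] by (simp add: space_P)
  obtain A0 where A0: "A0 \<in> sets (coord_algebra E {0..t + 1})" "AE w in Pc. w \<in> A \<longleftrightarrow> w \<in> A0"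
    using F_approx[OF AF[of "t + 1"]] by auto
  have A0Q [measurable]: "A0 \<in> sets (P \<mu>)"
    using A0(1) sets_coord_algebra_mono[of "{0..t + 1}" "{0..}" E] by (auto simp: sets_P)
  \<comment> \<open>The conditional probability of A given the raw past up to t. The goal is that it
    agrees almost surely with the indicator of A.\<close>
  define a where "a = nn_cond_exp (P \<mu>) ?G (indicator A0)"
  have aG [measurable]: "a \<in> borel_measurable ?G" by (simp add: a_def)
  have aQ [measurable]: "a \<in> borel_measurable (P \<mu>)" by (rule measurable_from_subalg[OF sub aG])
  have eq: "emeasure (density (P \<mu>) (indicator A0)) X = emeasure (density (P \<mu>) a) X" if X: "X \<in> cylinders E" for X
  proof -
    obtain I B where IB: "X = {w \<in> cadlag E. \<forall>s\<in>I. w s \<in> B s}" "finite I" "I \<subseteq> {0..}" "\<forall>s\<in>I. B s \<in> sets M"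
      using X unfolding cylinders_def by blast
    \<comment> \<open>The cylinder is split at t: \<open>C\<close> constrains times up to t,
      \<open>D\<close> the later ones, and \<open>D'\<close> is \<open>D\<close> with its times
      moved back by t, so that D is the preimage of \<open>D'\<close> under the shift.\<close>
    define C where "C = {w \<in> cadlag E. \<forall>s\<in>I \<inter> {..t}. w s \<in> B s}"
    define D where "D = {w \<in> cadlag E. \<forall>s\<in>I \<inter> {t<..}. w s \<in> B s}"
    define D' where "D' = {w \<in> cadlag E. \<forall>s\<in>(\<lambda>s. s - t) ` (I \<inter> {t<..}). w s \<in> B (t + s)}"
    have "I = (I \<inter> {..t}) \<union> (I \<inter> {t<..})" by auto
    then have XCD: "X = C \<inter> D" unfolding IB(1) C_def D_def by blast
    have cyl0: "cylinders E \<subseteq> sets G0" by (auto simp: sets_coord_cylinders)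
    have "D \<in> cylinders E" "D' \<in> cylinders E"
      unfolding cylinders_def D_def D'_def using IB(2-4) t
      by (blast intro: finite_Int, intro CollectI exI[of _ "(\<lambda>s. s - t) ` (I \<inter> {t<..})"] exI[of _ "\<lambda>s. B (t + s)"]) auto
    then have D'0: "D' \<in> sets G0" and DQ [measurable]: "D \<in> sets (P \<mu>)" using cyl0 by (auto simp: sets_P)
    have CG [measurable]: "C \<in> sets ?G"
    proof -
      have "{w \<in> space ?G. \<forall>s\<in>I \<inter> {..t}. w s \<in> B s} \<in> sets ?G"
      proof (rule sets.sets_Collect_finite_All)
        fix s assume "s \<in> I \<inter> {..t}"
        then show "{w \<in> space ?G. w s \<in> B s} \<in> sets ?G"
          using measurable_sets[OF coord_measurable[of "{0..t}" s E], of "B s"] IB(3,4)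
          by (auto simp: vimage_def Int_def conj_commute)
      qed (use IB(2) in simp)
      then show ?thesis by (simp add: C_def)
    qed
    have CQ [measurable]: "C \<in> sets (P \<mu>)" using CG GG0 by (auto simp: sets_P)
    have shD: "shift t w \<in> D' \<longleftrightarrow> w \<in> D" if "w \<in> cadlag E" for w
      using that shift_cadlag[OF that t] by (auto simp: D_def D'_def shift_def)
    define k where "k w = emeasure (\<kappa> (w t)) D'" for w
    have kG [measurable]: "k \<in> borel_measurable ?G"
      unfolding k_def[abs_def]
      by (rule measurable_compose[OF coord_measurable measurable_emeasure_kernel[OF measurable_prob_algebraD[OF \<kappa>_measurable] D'0]])
        (use t in auto)
    have kQ [measurable]: "k \<in> borel_measurable (P \<mu>)" by (rule measurable_from_subalg[OF sub kG])
    \<comment> \<open>The same formula is used twice: for H in the raw past it identifies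
      \<open>k\<close> as the conditional probability of D, and for H = A \<inter> C it evaluates
      the left side of \<open>eq\<close>.\<close>
    have markov: "emeasure Pc (H \<inter> D) = (\<integral>\<^sup>+w. k w * indicator H w \<partial>Pc)"
      if H: "\<And>s. t < s \<Longrightarrow> H \<in> sets (F s)" "H \<subseteq> cadlag E" for H
    proof -
      have "H \<inter> D = {w \<in> H. shift t w \<in> D'}" using shD H(2) by auto
      then show ?thesis unfolding k_def using emeasure_shift[OF optional_on_constI[OF t H(2,1)] D'0] by simp
    qed
    have ceD: "AE w in P \<mu>. k w = nn_cond_exp (P \<mu>) ?G (indicator D) w"
    proof (rule sub.nn_cond_exp_charact)
      fix H assume H: "H \<in> sets ?G"
      have [measurable]: "H \<in> sets (P \<mu>)" using H GG0 by (auto simp: sets_P)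
      have "(\<integral>\<^sup>+w\<in>H. indicator D w \<partial>P \<mu>) = (\<integral>\<^sup>+w. indicator (H \<inter> D) w \<partial>P \<mu>)"
        by (intro nn_integral_cong) (auto simp: indicator_def)
      also have "\<dots> = emeasure (P \<mu>) (H \<inter> D)" by (rule nn_integral_indicator) measurable
      also have "\<dots> = emeasure Pc (H \<inter> D)" by (simp add: main_part_sets)
      also have "\<dots> = (\<integral>\<^sup>+w. k w * indicator H w \<partial>Pc)"
        using H GF sets.sets_into_space[OF H] by (intro markov) auto
      also have "\<dots> = (\<integral>\<^sup>+w\<in>H. k w \<partial>P \<mu>)" by (rule nn_integral_completion)
      finally show "(\<integral>\<^sup>+w\<in>H. indicator D w \<partial>P \<mu>) = (\<integral>\<^sup>+w\<in>H. k w \<partial>P \<mu>)" .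
    qed measurable
    have XQ [measurable]: "X \<in> sets (P \<mu>)" using X cyl0 by (auto simp: sets_P)
    have "emeasure (density (P \<mu>) (indicator A0)) X = (\<integral>\<^sup>+w. indicator A0 w * indicator X w \<partial>P \<mu>)"
      by (rule emeasure_density) measurable
    also have "\<dots> = (\<integral>\<^sup>+w. indicator A0 w * indicator X w \<partial>Pc)" by (rule nn_integral_completion[symmetric])
    also have "\<dots> = (\<integral>\<^sup>+w. indicator ((A \<inter> C) \<inter> D) w \<partial>Pc)"
    proof (rule nn_integral_cong_AE)
      show "AE w in Pc. indicator A0 w * indicator X w = (indicator ((A \<inter> C) \<inter> D) w :: ennreal)"
        using A0(2) by eventually_elim (auto simp: indicator_def XCD)
    qed
    also have "\<dots> = emeasure Pc ((A \<inter> C) \<inter> D)" using APc CQ DQ by (intro nn_integral_indicator sets.Int) auto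
    also have "\<dots> = (\<integral>\<^sup>+w. k w * indicator (A \<inter> C) w \<partial>Pc)"
    proof (rule markov)
      show "A \<inter> C \<in> sets (F s)" if "t < s" for s
        using AF[OF that] CG GF[OF that] by (intro sets.Int) auto
    qed (use Acad in auto)
    also have "\<dots> = (\<integral>\<^sup>+w. (k w * indicator C w) * indicator A0 w \<partial>Pc)"
    proof (rule nn_integral_cong_AE)
      show "AE w in Pc. k w * indicator (A \<inter> C) w = (k w * indicator C w) * indicator A0 w"
        using A0(2) by eventually_elim (auto simp: indicator_def)
    qed
    also have "\<dots> = (\<integral>\<^sup>+w. (k w * indicator C w) * indicator A0 w \<partial>P \<mu>)" by (rule nn_integral_completion)
    \<comment> \<open>Both \<open>k\<close> and the indicator of C are measurable in the raw past,
      so A may be replaced by its conditional probability; afterwards \<open>k\<close> is traded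
      back for D in the same way.\<close>
    also have "\<dots> = (\<integral>\<^sup>+w. (k w * indicator C w) * a w \<partial>P \<mu>)"
      unfolding a_def by (rule sub.nn_cond_exp_intg[symmetric]) measurable
    also have "\<dots> = (\<integral>\<^sup>+w. (a w * indicator C w) * nn_cond_exp (P \<mu>) ?G (indicator D) w \<partial>P \<mu>)"
    proof (rule nn_integral_cong_AE)
      show "AE w in P \<mu>. (k w * indicator C w) * a w = (a w * indicator C w) * nn_cond_exp (P \<mu>) ?G (indicator D) w"
        using ceD by eventually_elim (simp add: mult_ac)
    qed
    also have "\<dots> = (\<integral>\<^sup>+w. (a w * indicator C w) * indicator D w \<partial>P \<mu>)"
      by (rule sub.nn_cond_exp_intg) measurable
    also have "\<dots> = (\<integral>\<^sup>+w. a w * indicator X w \<partial>P \<mu>)"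
      by (intro nn_integral_cong) (auto simp: XCD indicator_def)
    also have "\<dots> = emeasure (density (P \<mu>) a) X" by (rule emeasure_density[symmetric]) measurable
    finally show ?thesis .
  qed
  have fin: "emeasure (density (P \<mu>) (indicator A0)) Y \<noteq> \<infinity>" if [measurable]: "Y \<in> sets (P \<mu>)" for Y
  proof -
    have "emeasure (density (P \<mu>) (indicator A0)) Y = (\<integral>\<^sup>+w. indicator A0 w * indicator Y w \<partial>P \<mu>)"
      by (rule emeasure_density) measurable
    also have "\<dots> \<le> (\<integral>\<^sup>+w. 1 \<partial>P \<mu>)" by (intro nn_integral_mono) (auto simp: indicator_def)
    finally show ?thesis using Q.emeasure_space_1 by (auto simp: top_unique)
  qed
  \<comment> \<open>Cylinders generate the full path algebra, and not only the past of t; uniqueness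
    of densities then forces the indicator to equal \<open>a\<close> almost surely.\<close>
  have "density (P \<mu>) (indicator A0) = density (P \<mu>) a"
    by (rule measure_eqI_generator_eq[OF cylinders_Int_stable cylinders_subset eq, where A = "\<lambda>_. cadlag E"])
      (use fin[OF sets.top] in \<open>auto simp: sets_P sets_coord_cylinders cadlag_cylinders space_P\<close>)
  then have "AE w in P \<mu>. indicator A0 w = a w" by (subst (asm) Q.density_unique_iff) auto
  then have "AE w in Pc. indicator A0 w = a w" by (rule AE_completion)
  with A0(2) AE_space have "AE w in Pc. w \<in> A \<longleftrightarrow> w \<in> a -` {1} \<inter> space ?G"
    by eventually_elim (auto simp: space_P indicator_def split: if_splits)
  moreover have "a -` {1} \<inter> space ?G \<in> sets (F t)"
    using measurable_sets[OF aG, of "{1}"] coord_F_sub by auto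
  ultimately show ?thesis by (rule F_I_AE[OF APc, rotated])
qed

end

text \<open>The preimages differ only inside a null set, all of whose subsets are measurable in the
  completion.\<close>

lemma borel_measurable_completion_AE:
  fixes f g :: "'a \<Rightarrow> 'b::topological_space"
  assumes f: "f \<in> borel_measurable (completion M)" and eq: "AE x in M. f x = g x"
  shows "g \<in> borel_measurable (completion M)"
proof (rule measurableI)
  obtain N where N: "N \<in> null_sets M" "{x \<in> space M. f x \<noteq> g x} \<subseteq> N"
    using eq by (auto simp: eventually_ae_filter)
  fix B :: "'b set" assume B: "B \<in> sets borel"
  have "g -` B \<inter> space M = ((f -` B \<inter> space (completion M)) - N) \<union> (g -` B \<inter> space M \<inter> N)"
    using N(2) by auto
  moreover have "(f -` B \<inter> space (completion M)) - N \<in> sets (completion M)"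
    using N(1) by (intro sets.Diff measurable_sets[OF f B]) auto
  moreover have "g -` B \<inter> space M \<inter> N \<in> sets (completion M)"
    by (rule null_sets_completion[OF N(1)]) auto
  ultimately show "g -` B \<inter> space (completion M) \<in> sets (completion M)"
    by (metis sets.Un space_completion)
qed simp

context engelbert_process
begin

lemma sets_aug_at': "sets (aug_at E P t) =
    {A. A \<subseteq> cadlag E \<and> (\<forall>\<mu>\<in>space (prob_algebra M). A \<in> sets (aug_mu E P \<mu> t))}"
  by (rule sets_aug_at) (rule P_in)

lemma sets_aug_all': "sets (aug_all E P) =
    {A. A \<subseteq> cadlag E \<and> (\<forall>\<mu>\<in>space (prob_algebra M). A \<in> sets (completion (P \<mu>)))}"
  by (rule sets_aug_all) (rule P_in)

text \<open>Membership is tested for each \<mu> separately, and intersections over \<mu> and over s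
  commute.\<close>

lemma aug_right_continuous:
  assumes "0 \<le> t"
  shows "sets (aug_at E P t) = (\<Inter>s\<in>{t<..}. sets (aug_at E P s))"
proof (rule antisym)
  show "sets (aug_at E P t) \<subseteq> (\<Inter>s\<in>{t<..}. sets (aug_at E P s))"
  proof (rule INT_greatest, rule subsetI)
    fix s A assume s: "s \<in> {t<..}" and A: "A \<in> sets (aug_at E P t)"
    have "A \<in> sets (aug_mu E P \<mu> s)" if "\<mu> \<in> space (prob_algebra M)" for \<mu>
      using engelbert_law.F_mono[OF engelbert_lawI[OF that], of t s] A s that by (auto simp: sets_aug_at')
    then show "A \<in> sets (aug_at E P s)" using A by (simp add: sets_aug_at')
  qed
  show "(\<Inter>s\<in>{t<..}. sets (aug_at E P s)) \<subseteq> sets (aug_at E P t)"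
  proof
    fix A assume A: "A \<in> (\<Inter>s\<in>{t<..}. sets (aug_at E P s))"
    then have "A \<in> sets (aug_at E P (t + 1))" by simp
    then have "A \<subseteq> cadlag E" by (simp add: sets_aug_at')
    moreover have "A \<in> sets (aug_mu E P \<mu> t)" if "\<mu> \<in> space (prob_algebra M)" for \<mu>
      using A that by (intro engelbert_law.F_right_continuous[OF engelbert_lawI[OF that] assms]) (auto simp: sets_aug_at')
    ultimately show "A \<in> sets (aug_at E P t)" by (simp add: sets_aug_at')
  qed
qed

end

section \<open>Stopping times\<close>

context engelbert_law
begin

lemma subalgebra_aug: "subalgebra Pc (aug_all E P)"
proof -
  have "space (aug_all E P) = cadlag E" by (rule space_aug_all) (rule P_in)
  then show ?thesis using mu by (auto simp: subalgebra_def space_P sets_aug_all')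
qed

lemma sets_ext_law: "sets (ext_law E P \<mu>) = sets (aug_all E P)"
  unfolding ext_law_def by (rule sets_restr_to_subalg[OF subalgebra_aug])

lemma space_ext_law: "space (ext_law E P \<mu>) = cadlag E"
  unfolding ext_law_def by (simp add: space_restr_to_subalg space_P)

lemma prob_space_ext_law: "prob_space (ext_law E P \<mu>)"
  unfolding ext_law_def by (intro prob_space_restr_to_subalg subalgebra_aug Pc.prob_space_axioms)

lemma integral_ext_law:
  fixes f :: "(real \<Rightarrow> 'a) \<Rightarrow> real"
  shows "f \<in> borel_measurable (aug_all E P) \<Longrightarrow> (\<integral>w. f w \<partial>ext_law E P \<mu>) = (\<integral>w. f w \<partial>Pc)"
  unfolding ext_law_def by (rule integral_subalgebra2[OF subalgebra_aug])

end

section \<open>Borel modifications of universally measurable functions\<close>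

context engelbert_process
begin

lemma G0_aug: "sets G0 \<subseteq> sets (aug_all E P)"
proof
  fix X assume X: "X \<in> sets G0"
  have "X \<in> sets (completion (P \<mu>))" if "\<mu> \<in> space (prob_algebra M)" for \<mu>
    using engelbert_law.sets_P[OF engelbert_lawI[OF that]] X by (intro sets_completionI_sets) simp
  then show "X \<in> sets (aug_all E P)" using sets.sets_into_space[OF X] by (simp add: sets_aug_all')
qed

text \<open>Universal measurability refers to the laws \<open>P \<nu>\<close> of probability
  measures \<nu>, whereas the law at T on an event may have smaller mass.\<close>

lemma normalize_in_prob_algebra:
  assumes m: "subprob_space m" "sets m = sets M" and ne: "emeasure m E \<noteq> 0"
  shows "scale_measure (inverse (emeasure m E)) m \<in> space (prob_algebra M)"
proof -
  have sp: "space m = E" using sets_eq_imp_space_eq[OF m(2)] by simp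
  have "emeasure m E \<noteq> top"
    using subprob_space.emeasure_space_le_1[OF m(1)] by (auto simp: sp top_unique)
  then have "inverse (emeasure m E) * emeasure m E = 1"
    using ne ennreal_divide_self[of "emeasure m E"] by (simp add: divide_ennreal_def mult.commute less_top)
  then show ?thesis
    using m(2) by (auto simp: space_prob_algebra sp space_scale_measure intro!: prob_spaceI)
qed

lemma stopping_time_aug': "stopping_time (aug_filtration E P) \<tau> \<longleftrightarrow>
    (\<forall>t\<ge>0. {w \<in> cadlag E. \<tau> w \<le> ennreal t} \<in> sets (aug_at E P t))"
  by (rule stopping_time_aug) (rule P_in)

text \<open>Z is measurable for the completion of \<open>P \<nu>\<close>, with \<nu> the normalized
  m, so it agrees with a Borel function off a null set N. As \<open>P \<nu>\<close> is the mixture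
  of \<kappa> under \<nu>, N is null for \<open>\<kappa> x\<close> at m-almost every x.\<close>

lemma aug_modification:
  assumes Z: "Z \<in> bounded_measurable (aug_all E P)" and m: "subprob_space m" "sets m = sets M"
  obtains Z' C N where "Z' \<in> borel_measurable G0" "\<And>w. \<bar>Z' w\<bar> \<le> C" "N \<in> sets G0"
    "\<And>w. w \<in> cadlag E - N \<Longrightarrow> Z w = Z' w" "AE x in m. emeasure (\<kappa> x) N = 0"
proof -
  have sp: "space m = E" using sets_eq_imp_space_eq[OF m(2)] by simp
  \<comment> \<open>If m vanishes, any starting point will do, because every property holds m-almost
    everywhere.\<close>
  define \<nu> where "\<nu> = (if emeasure m E = 0 then return M (SOME x. x \<in> E)
    else scale_measure (inverse (emeasure m E)) m)"
  have "E \<noteq> {}" using subprob_space.subprob_not_empty[OF m(1)] sp by simp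
  then have \<nu>: "\<nu> \<in> space (prob_algebra M)"
    unfolding \<nu>_def using return_in[OF someI_ex[of "\<lambda>x. x \<in> E"]] normalize_in_prob_algebra[OF m] by auto
  then interpret N: engelbert_law E u Rp p P \<nu> by (rule engelbert_lawI)
  have "Z \<in> borel_measurable (completion (P \<nu>))"
    using Z by (intro measurable_from_subalg[OF N.subalgebra_aug]) (simp add: bounded_measurable_def)
  from completion_ex_borel_measurable_real[OF this]
  obtain Y where Y: "Y \<in> borel_measurable (P \<nu>)" "AE w in P \<nu>. Z w = Y w" by blast
  obtain N where N: "N \<in> null_sets (P \<nu>)" "{w \<in> space (P \<nu>). Z w \<noteq> Y w} \<subseteq> N"
    using Y(2) by (auto simp: eventually_ae_filter)
  have spZ: "space (aug_all E P) = cadlag E" by (rule space_aug_all) (rule P_in)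
  obtain C where C: "\<And>w. w \<in> cadlag E \<Longrightarrow> \<bar>Z w\<bar> \<le> C"
    using Z by (auto simp: bounded_measurable_def bounded_iff spZ)
  \<comment> \<open>Truncation bounds the Borel version everywhere and changes nothing on paths
    where it agrees with Z.\<close>
  define Z' where "Z' w = max (- \<bar>C\<bar>) (min \<bar>C\<bar> (Y w))" for w
  have NG: "N \<in> sets G0" using N(1) N.sets_P by auto
  have m\<nu>: "AE x in m. Q x" if ae: "AE x in \<nu>. Q x" for Q
  proof (cases "emeasure m E = 0")
    case True
    then have "E \<in> null_sets m" using m(2) sets.top[of m] sp by (auto simp: null_sets_def)
    then show ?thesis by (rule AE_I') (use sp in auto)
  next
    case False
    then have eq: "\<nu> = scale_measure (inverse (emeasure m E)) m" by (simp add: \<nu>_def)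
    obtain X where X: "X \<in> null_sets \<nu>" "{x \<in> space \<nu>. \<not> Q x} \<subseteq> X"
      using ae by (auto simp: eventually_ae_filter)
    have "emeasure m E \<noteq> top"
      using subprob_space.emeasure_space_le_1[OF m(1)] by (auto simp: sp top_unique)
    then have "X \<in> null_sets m" using X(1) unfolding eq by (auto simp: null_sets_def)
    then show ?thesis by (rule AE_I') (use X(2) in \<open>simp add: eq space_scale_measure\<close>)
  qed
  have k: "\<kappa> \<in> M \<rightarrow>\<^sub>M subprob_algebra G0" by (rule measurable_prob_algebraD[OF \<kappa>_measurable])
  have s\<nu>: "sets \<nu> = sets M" using \<nu> by (simp add: space_prob_algebra)
  have "space \<nu> = E" using sets_eq_imp_space_eq[OF s\<nu>] by simp
  then have "emeasure (P \<nu>) N = (\<integral>\<^sup>+x. emeasure (\<kappa> x) N \<partial>\<nu>)"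
    unfolding N.P_eq_bind using \<open>E \<noteq> {}\<close> k NG
    by (intro emeasure_bind[where N = G0]) (auto simp: measurable_cong_sets[OF s\<nu> refl])
  then have "(\<integral>\<^sup>+x. emeasure (\<kappa> x) N \<partial>\<nu>) = 0" using N(1) by auto
  then have "AE x in \<nu>. emeasure (\<kappa> x) N = 0"
    using measurable_emeasure_kernel[OF k NG]
    by (subst (asm) nn_integral_0_iff_AE) (auto simp: measurable_cong_sets[OF s\<nu> refl])
  then have "AE x in m. emeasure (\<kappa> x) N = 0" by (rule m\<nu>)
  moreover have "Z' \<in> borel_measurable G0"
    using Y(1) unfolding Z'_def[abs_def] measurable_cong_sets[OF N.sets_P refl] by measurable
  moreover have "\<bar>Z' w\<bar> \<le> \<bar>C\<bar>" for w by (auto simp: Z'_def)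
  moreover have "Z w = Z' w" if "w \<in> cadlag E - N" for w
  proof -
    have "Z w = Y w" using N(2) that N.space_P by auto
    then show ?thesis using C[of w] that by (auto simp: Z'_def)
  qed
  ultimately show ?thesis using that NG by blast
qed

lemma expect_from_eq:
  assumes x: "x \<in> E" and Z: "Z \<in> bounded_measurable (aug_all E P)" and Z': "Z' \<in> borel_measurable G0"
    and N: "N \<in> sets G0" "\<And>w. w \<in> cadlag E - N \<Longrightarrow> Z w = Z' w" "emeasure (\<kappa> x) N = 0"
  shows "expect_from E P x Z = (\<integral>w. Z' w \<partial>\<kappa> x)"
proof -
  interpret X: engelbert_law E u Rp p P "return M x" by (rule engelbert_lawI[OF return_in[OF x]])
  have Zm: "Z \<in> borel_measurable (aug_all E P)" using Z by (simp add: bounded_measurable_def)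
  have Z'm: "Z' \<in> borel_measurable (\<kappa> x)" using Z' by (simp add: measurable_cong_sets[OF \<kappa>_D(2)[OF x] refl])
  have null: "N \<in> null_sets (\<kappa> x)" using N(1,3) \<kappa>_D(2)[OF x] by (auto simp: null_sets_def)
  have ae: "AE w in \<kappa> x. Z w = Z' w"
    by (rule AE_I'[OF null]) (use N(2) \<kappa>_D(3)[OF x] in auto)
  have "expect_from E P x Z = (\<integral>w. Z w \<partial>completion (\<kappa> x))"
    unfolding expect_from_def X.integral_ext_law[OF Zm] \<kappa>_def ..
  also have "\<dots> = (\<integral>w. Z' w \<partial>completion (\<kappa> x))"
  proof (rule integral_cong_AE)
    show "Z \<in> borel_measurable (completion (\<kappa> x))"
      using measurable_from_subalg[OF X.subalgebra_aug Zm] by (simp add: \<kappa>_def)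
    show "Z' \<in> borel_measurable (completion (\<kappa> x))" by (rule measurable_completion[OF Z'm])
    show "AE w in completion (\<kappa> x). Z w = Z' w" by (rule AE_completion[OF ae])
  qed
  also have "\<dots> = (\<integral>w. Z' w \<partial>\<kappa> x)" by (rule integral_completion[OF Z'm])
  finally show ?thesis .
qed

end

context engelbert_law
begin

text \<open>An exceptional set for the completion need not lie in \<open>aug_all E P\<close>, but a
  null set of \<open>G0\<close> covering it does.\<close>

lemma AE_ext_law:
  assumes "AE w in Pc. Q w"
  shows "AE w in ext_law E P \<mu>. Q w"
proof -
  have "AE w in P \<mu>. Q w" using assms by (simp add: AE_completion_iff)
  then obtain N where N: "N \<in> null_sets (P \<mu>)" "{w \<in> space (P \<mu>). \<not> Q w} \<subseteq> N"
    by (auto simp: eventually_ae_filter)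
  have "N \<in> null_sets (ext_law E P \<mu>)"
    unfolding ext_law_def null_sets_restr_to_subalg[OF subalgebra_aug]
    using N(1) sets_P G0_aug by (auto intro: null_sets_completionI)
  then show ?thesis by (rule AE_I') (use N(2) in \<open>auto simp: space_ext_law space_P\<close>)
qed

text \<open>Rationals q below t turn the events \<tau> \<le> q into \<tau> < t. The event excludes
  \<tau> = \<infinity>, where \<open>enn2real\<close> would return 0.\<close>

lemma stopping_optional_on:
  assumes \<tau>: "stopping_time (aug_filtration E P) \<tau>" and S: "S \<in> sets (stopped_algebra E P \<tau>)"
  shows "optional_on {w \<in> S. \<tau> w < \<infinity>} (\<lambda>w. enn2real (\<tau> w))"
proof -
  have S': "S \<in> sets (aug_all E P)" "\<And>t. 0 \<le> t \<Longrightarrow> {w \<in> S. \<tau> w \<le> ennreal t} \<in> sets (aug_at E P t)"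
    using S sets_pre_sigma_aug[OF P_in \<tau>] by auto
  have Scad: "S \<subseteq> cadlag E" using S'(1) by (simp add: sets_aug_all')
  have SF: "{w \<in> S. \<tau> w \<le> ennreal t} \<in> sets (F t)" if "0 \<le> t" for t
    using S'(2)[OF that] mu by (simp add: sets_aug_at')
  show ?thesis
    unfolding optional_on_def
  proof (intro conjI ballI allI impI)
    fix t :: real assume t: "0 < t"
    have "{w \<in> {w \<in> S. \<tau> w < \<infinity>}. enn2real (\<tau> w) < t} = (\<Union>q\<in>\<rat> \<inter> {0..<t}. {w \<in> S. \<tau> w \<le> ennreal q})"
    proof (intro equalityI subsetI)
      fix w assume w: "w \<in> {w \<in> {w \<in> S. \<tau> w < \<infinity>}. enn2real (\<tau> w) < t}"
      then obtain q where q: "q \<in> \<rat>" "enn2real (\<tau> w) < q" "q < t" using Rats_dense_in_real by blast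
      have "\<tau> w = ennreal (enn2real (\<tau> w))" using w by simp
      also have "\<dots> \<le> ennreal q" using q(2) by (intro ennreal_leI) simp
      finally show "w \<in> (\<Union>q\<in>\<rat> \<inter> {0..<t}. {w \<in> S. \<tau> w \<le> ennreal q})"
        using q w order.trans[OF enn2real_nonneg less_imp_le[OF q(2)]] by auto
    next
      fix w assume "w \<in> (\<Union>q\<in>\<rat> \<inter> {0..<t}. {w \<in> S. \<tau> w \<le> ennreal q})"
      then obtain q where q: "0 \<le> q" "q < t" "w \<in> S" "\<tau> w \<le> ennreal q" by auto
      then have "enn2real (\<tau> w) < t" using enn2real_leI[of q "\<tau> w"] by linarith
      moreover have "\<tau> w < \<infinity>" using q(4) by (rule order.strict_trans1) simp
      ultimately show "w \<in> {w \<in> {w \<in> S. \<tau> w < \<infinity>}. enn2real (\<tau> w) < t}" using q by blast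
    qed
    moreover have "(\<Union>q\<in>\<rat> \<inter> {0..<t}. {w \<in> S. \<tau> w \<le> ennreal q}) \<in> sets (F t)"
    proof (rule sets.countable_UN')
      show "countable (\<rat> \<inter> {0..<t})" using countable_rat by blast
      show "(\<lambda>q. {w \<in> S. \<tau> w \<le> ennreal q}) ` (\<rat> \<inter> {0..<t}) \<subseteq> sets (F t)"
      proof (rule image_subsetI)
        fix q assume "q \<in> \<rat> \<inter> {0..<t}"
        then have "0 \<le> q" "q \<le> t" by auto
        then show "{w \<in> S. \<tau> w \<le> ennreal q} \<in> sets (F t)" using SF[of q] F_mono[of q t] by blast
      qed
    qed
    ultimately show "{w \<in> {w \<in> S. \<tau> w < \<infinity>}. enn2real (\<tau> w) < t} \<in> sets (F t)" by simp
  qed (use Scad in auto)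
qed

end

section \<open>Position and shifted functional at a stopping time\<close>

context engelbert_process
begin

lemma cadlag_stopped: "cadlag E \<in> sets (stopped_algebra E P \<tau>)"
  using sets.top[of "stopped_algebra E P \<tau>"] filtration.space_pre_sigma[OF filtration_aug[of E P, OF P_in], of \<tau>] by simp

text \<open>Optional times control only the strict events \<tau> < s. They place the part with
  \<tau> \<le> t in \<open>F s\<close> for every s > t, and right continuity of the filtration
  brings it down to \<open>F t\<close>.\<close>

lemma eval_stopped:
  assumes \<tau>: "stopping_time (aug_filtration E P) \<tau>" and B: "B \<in> sets M"
  shows "{w \<in> cadlag E. \<tau> w < \<infinity> \<and> w (enn2real (\<tau> w)) \<in> B} \<in> sets (stopped_algebra E P \<tau>)"
proof -
  let ?X = "{w \<in> cadlag E. \<tau> w < \<infinity> \<and> w (enn2real (\<tau> w)) \<in> B}"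
  have optional_on: "engelbert_law.optional_on E P \<mu> ?X (\<lambda>w. enn2real (\<tau> w))" if "\<mu> \<in> space (prob_algebra M)" for \<mu>
  proof -
    interpret engelbert_law E u Rp p P \<mu> by (rule engelbert_lawI[OF that])
    have "{w \<in> {w \<in> cadlag E. \<tau> w < \<infinity>}. w (enn2real (\<tau> w)) \<in> B} = ?X" by auto
    then show ?thesis using optional_on_Int_eval[OF stopping_optional_on[OF \<tau> cadlag_stopped] B] by simp
  qed
  have "?X \<in> sets (aug_all E P)"
    using engelbert_law.optional_on_sets[OF engelbert_lawI optional_on] by (auto simp: sets_aug_all')
  moreover have "{w \<in> ?X. \<tau> w \<le> ennreal t} \<in> sets (aug_at E P t)" if t: "0 \<le> t" for t
  proof -
    have "{w \<in> ?X. \<tau> w \<le> ennreal t} \<in> sets (aug_mu E P \<mu> t)" if \<mu>: "\<mu> \<in> space (prob_algebra M)" for \<mu>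
    proof -
      interpret engelbert_law E u Rp p P \<mu> by (rule engelbert_lawI[OF \<mu>])
      show ?thesis
      proof (rule F_right_continuous[OF t])
        fix s assume s: "t < s"
        have "{w \<in> ?X. enn2real (\<tau> w) < s} \<in> sets (F s)" using optional_on[OF \<mu>] s t by (simp add: optional_on_def)
        moreover have "{w \<in> cadlag E. \<tau> w \<le> ennreal t} \<in> sets (F s)"
          using \<tau> t \<mu> F_mono[of t s] s by (auto simp: sets_aug_at' stopping_time_aug')
        moreover have "{w \<in> ?X. \<tau> w \<le> ennreal t} = {w \<in> ?X. enn2real (\<tau> w) < s} \<inter> {w \<in> cadlag E. \<tau> w \<le> ennreal t}"
        proof -
          have "enn2real (\<tau> w) < s" if "\<tau> w \<le> ennreal t" for w
            using enn2real_leI[OF t that] s by linarith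
          then show ?thesis by blast
        qed
        ultimately show "{w \<in> ?X. \<tau> w \<le> ennreal t} \<in> sets (F s)" by simp
      qed
    qed
    then show ?thesis by (auto simp: sets_aug_at')
  qed
  ultimately show ?thesis using sets_pre_sigma_aug[OF P_in \<tau>] by simp
qed

lemma eval_stopped_measurable:
  fixes h :: "'a \<Rightarrow> real"
  assumes \<tau>: "stopping_time (aug_filtration E P) \<tau>" and h: "h \<in> borel_measurable M"
  shows "(\<lambda>w. if \<tau> w < \<infinity> then h (w (enn2real (\<tau> w))) else 0) \<in> borel_measurable (stopped_algebra E P \<tau>)"
proof (rule measurableI)
  let ?S = "stopped_algebra E P \<tau>" and ?g = "\<lambda>w. if \<tau> w < \<infinity> then h (w (enn2real (\<tau> w))) else 0"
  have sp: "space ?S = cadlag E" by (rule filtration.space_pre_sigma[OF filtration_aug[of E P, OF P_in]])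
  fix B :: "real set" assume "B \<in> sets borel"
  then have hB: "h -` B \<inter> E \<in> sets M" using measurable_sets[OF h] by simp
  have E: "E \<in> sets M" using sets.top[of M] by simp
  have wE: "w (enn2real (\<tau> w)) \<in> E" if "w \<in> cadlag E" for w by (rule cadlagD(1)[OF that enn2real_nonneg])
  let ?X = "\<lambda>B. {w \<in> cadlag E. \<tau> w < \<infinity> \<and> w (enn2real (\<tau> w)) \<in> B}"
  \<comment> \<open>\<open>?X E\<close> is the event that \<tau> is finite; off it the default value
    0 decides membership.\<close>
  have "?g -` B \<inter> space ?S = ?X (h -` B \<inter> E) \<union> (if 0 \<in> B then cadlag E - ?X E else {})"
  proof (rule set_eqI)
    show "w \<in> ?g -` B \<inter> space ?S \<longleftrightarrow> w \<in> ?X (h -` B \<inter> E) \<union> (if 0 \<in> B then cadlag E - ?X E else {})" for w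
      using wE[of w] by (cases "\<tau> w < \<infinity>"; cases "0 \<in> B") (auto simp: sp)
  qed
  also have "\<dots> \<in> sets ?S"
    using eval_stopped[OF \<tau> hB] eval_stopped[OF \<tau> E] cadlag_stopped by auto
  finally show "?g -` B \<inter> space ?S \<in> sets ?S" .
qed simp

end

context engelbert_law
begin

text \<open>The shifted path has law \<open>law_at \<bind> \<kappa>\<close> on the event, which
  gives N no mass. A modification off N is therefore harmless after the shift too.\<close>

lemma shift_rv_AE:
  assumes \<tau>: "stopping_time (aug_filtration E P) \<tau>" and S: "S \<in> sets (stopped_algebra E P \<tau>)"
    and N: "N \<in> sets G0" "AE x in law_at {w \<in> S. \<tau> w < \<infinity>} (\<lambda>w. enn2real (\<tau> w)). emeasure (\<kappa> x) N = 0"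
  shows "AE w in Pc. w \<in> S \<and> \<tau> w < \<infinity> \<longrightarrow> shift (enn2real (\<tau> w)) w \<notin> N"
proof -
  let ?A = "{w \<in> S. \<tau> w < \<infinity>}" and ?T = "\<lambda>w. enn2real (\<tau> w)"
  have optional_on: "optional_on ?A ?T" by (rule stopping_optional_on[OF \<tau> S])
  have k: "\<kappa> \<in> law_at ?A ?T \<rightarrow>\<^sub>M subprob_algebra G0"
    using measurable_prob_algebraD[OF \<kappa>_measurable] by (simp cong: measurable_cong_sets)
  let ?Y = "(\<lambda>w. shift (?T w) w) -` N \<inter> space (restrict_space Pc ?A)"
  have "emeasure (restrict_space Pc ?A) ?Y = emeasure (distr (restrict_space Pc ?A) G0 (\<lambda>w. shift (?T w) w)) N"
    by (rule emeasure_distr[OF shift_measurable[OF optional_on] N(1), symmetric])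
  also have "\<dots> = (\<integral>\<^sup>+x. emeasure (\<kappa> x) N \<partial>law_at ?A ?T)"
    unfolding shift_law[OF optional_on] using E_nonempty by (intro emeasure_bind[OF _ k N(1)]) simp
  also have "\<dots> = 0"
    using N(2) measurable_emeasure_kernel[OF k N(1)] by (subst nn_integral_0_iff_AE) auto
  finally have "?Y \<in> null_sets (restrict_space Pc ?A)"
    using measurable_sets[OF shift_measurable[OF optional_on] N(1)] by (auto simp: null_sets_def)
  then have "AE w in restrict_space Pc ?A. w \<notin> ?Y" by (rule AE_not_in)
  then have "AE w in restrict_space Pc ?A. shift (?T w) w \<notin> N"
    using AE_space by eventually_elim auto
  moreover have "?A \<inter> space Pc \<in> sets Pc" using optional_on_sets[OF optional_on] by blast
  ultimately show ?thesis by (simp add: AE_restrict_space_iff)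
qed

text \<open>The shift is measurable only into \<open>G0\<close>, so Z cannot be composed with it
  directly. The Borel modification can, and completeness absorbs the difference.\<close>

lemma shift_rv_measurable:
  assumes \<tau>: "stopping_time (aug_filtration E P) \<tau>" and Z: "Z \<in> bounded_measurable (aug_all E P)"
  shows "shift_rv \<tau> Z \<in> borel_measurable Pc"
proof -
  let ?A = "{w \<in> cadlag E. \<tau> w < \<infinity>}" and ?T = "\<lambda>w. enn2real (\<tau> w)"
  have optional_on: "optional_on ?A ?T" by (rule stopping_optional_on[OF \<tau> cadlag_stopped])
  obtain Z' C N where Z': "Z' \<in> borel_measurable G0" "\<And>w. \<bar>Z' w\<bar> \<le> C" and N: "N \<in> sets G0"
    "\<And>w. w \<in> cadlag E - N \<Longrightarrow> Z w = Z' w" "AE x in law_at ?A ?T. emeasure (\<kappa> x) N = 0"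
    using aug_modification[OF Z subprob_law_at[OF optional_on] sets_law_at] by blast
  have A: "?A \<in> sets Pc" by (rule optional_on_sets[OF optional_on])
  have "(\<lambda>w. Z' (shift (?T w) w)) \<in> borel_measurable (restrict_space Pc ?A)"
    by (rule measurable_compose[OF shift_measurable[OF optional_on] Z'(1)])
  then have "(\<lambda>w. indicator ?A w *\<^sub>R Z' (shift (?T w) w)) \<in> borel_measurable Pc"
    using A by (subst (asm) borel_measurable_restrict_space_iff) (auto simp only: sets.Int_space_eq2)
  then show ?thesis
  proof (rule borel_measurable_completion_AE)
    have "AE w in Pc. w \<in> cadlag E \<and> \<tau> w < \<infinity> \<longrightarrow> shift (?T w) w \<notin> N"
      by (rule shift_rv_AE[OF \<tau> cadlag_stopped N(1,3)])
    then have "AE w in P \<mu>. w \<in> cadlag E \<and> \<tau> w < \<infinity> \<longrightarrow> shift (?T w) w \<notin> N"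
      by (simp add: AE_completion_iff)
    then show "AE w in P \<mu>. indicator ?A w *\<^sub>R Z' (shift (?T w) w) = shift_rv \<tau> Z w"
      using AE_space
    proof eventually_elim
      case (elim w)
      then show ?case
        using N(2)[of "shift (?T w) w"] shift_cadlag[of w E "?T w"]
        by (auto simp: shift_rv_def space_P indicator_def)
    qed
  qed
qed

end

context engelbert_process
begin

text \<open>The modification depends on \<mu>, but the preimages under
  \<open>shift_rv \<tau> Z\<close> do not, so they lie in all the completions.\<close>

lemma shift_rv_aug_measurable:
  assumes \<tau>: "stopping_time (aug_filtration E P) \<tau>" and Z: "Z \<in> bounded_measurable (aug_all E P)"
  shows "shift_rv \<tau> Z \<in> borel_measurable (aug_all E P)"
proof (rule measurableI)
  have sp: "space (aug_all E P) = cadlag E" by (rule space_aug_all) (rule P_in)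
  fix B :: "real set" assume B: "B \<in> sets borel"
  have "shift_rv \<tau> Z -` B \<inter> cadlag E \<in> sets (completion (P \<mu>))" if "\<mu> \<in> space (prob_algebra M)" for \<mu>
  proof -
    interpret engelbert_law E u Rp p P \<mu> by (rule engelbert_lawI[OF that])
    show ?thesis using measurable_sets[OF shift_rv_measurable[OF \<tau> Z] B] by (simp add: space_P)
  qed
  then show "shift_rv \<tau> Z -` B \<inter> space (aug_all E P) \<in> sets (aug_all E P)"
    by (auto simp: sp sets_aug_all')
qed simp

end

context engelbert_law
begin

theorem strong_markov_property:
  assumes \<tau>: "stopping_time (aug_filtration E P) \<tau>" and Z: "Z \<in> bounded_measurable (aug_all E P)"
  shows "integrable (ext_law E P \<mu>) (shift_rv \<tau> Z)"
    and "AE w in ext_law E P \<mu>. \<tau> w < \<infinity> \<longrightarrow>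
      real_cond_exp (ext_law E P \<mu>) (stopped_algebra E P \<tau>) (shift_rv \<tau> Z) w =
        expect_from E P (w (enn2real (\<tau> w))) Z"
proof -
  let ?L = "ext_law E P \<mu>" and ?S = "stopped_algebra E P \<tau>"
  let ?A = "{w \<in> cadlag E. \<tau> w < \<infinity>}" and ?T = "\<lambda>w. enn2real (\<tau> w)"
  interpret L: prob_space ?L by (rule prob_space_ext_law)
  have S_aug: "sets ?S \<subseteq> sets (aug_all E P)" using sets_pre_sigma_aug[OF P_in \<tau>] by auto
  have sub: "subalgebra ?L ?S"
    using S_aug filtration.space_pre_sigma[OF filtration_aug[of E P, OF P_in], of \<tau>]
    by (simp add: subalgebra_def sets_ext_law space_ext_law)
  interpret sub: finite_measure_subalgebra ?L ?S by unfold_locales (rule sub)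
  have optional_on: "optional_on ?A ?T" by (rule stopping_optional_on[OF \<tau> cadlag_stopped])
  \<comment> \<open>One modification, chosen for the law at \<tau> on all paths with finite \<tau>,
    serves every event S of the past.\<close>
  obtain Z' C N where Z': "Z' \<in> borel_measurable G0" "\<And>w. \<bar>Z' w\<bar> \<le> C" and N: "N \<in> sets G0"
    "\<And>w. w \<in> cadlag E - N \<Longrightarrow> Z w = Z' w" "AE x in law_at ?A ?T. emeasure (\<kappa> x) N = 0"
    using aug_modification[OF Z subprob_law_at[OF optional_on] sets_law_at] by blast
  have C0: "0 \<le> C" using Z'(2)[of undefined] by linarith
  define h where "h x = (\<integral>w. Z' w \<partial>\<kappa> x)" for x
  have k: "\<kappa> \<in> M \<rightarrow>\<^sub>M subprob_algebra G0" by (rule measurable_prob_algebraD[OF \<kappa>_measurable])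
  have hm [measurable]: "h \<in> borel_measurable M"
    unfolding h_def[abs_def] by (rule measurable_compose[OF k integral_measurable_subprob_algebra[OF Z'(1)]])
  have h_bd: "\<bar>h x\<bar> \<le> C" if "x \<in> E" for x
  proof -
    interpret K: prob_space "\<kappa> x" by (rule \<kappa>_D[OF that])
    have "\<bar>h x\<bar> \<le> C * measure (\<kappa> x) (space (\<kappa> x))"
      unfolding h_def using Z' by (intro K.abs_integral_le) (auto simp: measurable_cong_sets[OF \<kappa>_D(2)[OF that] refl])
    then show ?thesis by (simp add: K.prob_space)
  qed
  \<comment> \<open>The candidate is built from the Borel function \<open>h\<close>, whose
    measurability is at hand, and not from the expectation of Z. Its value 0 at \<tau> = \<infinity>
    matches \<open>shift_rv\<close>, so integrals over S reduce to \<open>?B\<close>.\<close>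
  define g where "g w = (if \<tau> w < \<infinity> then h (w (?T w)) else 0)" for w
  have gS [measurable]: "g \<in> borel_measurable ?S"
    unfolding g_def[abs_def] by (rule eval_stopped_measurable[OF \<tau> hm])
  have gL [measurable]: "g \<in> borel_measurable ?L" by (rule measurable_from_subalg[OF sub gS])
  have fA: "shift_rv \<tau> Z \<in> borel_measurable (aug_all E P)" by (rule shift_rv_aug_measurable[OF \<tau> Z])
  then have fL [measurable]: "shift_rv \<tau> Z \<in> borel_measurable ?L"
    by (simp add: measurable_cong_sets[OF sets_ext_law refl])
  have fPc: "shift_rv \<tau> Z \<in> borel_measurable Pc" by (rule shift_rv_measurable[OF \<tau> Z])
  have spZ: "space (aug_all E P) = cadlag E" by (rule space_aug_all) (rule P_in)
  obtain D where D: "\<And>w. w \<in> cadlag E \<Longrightarrow> \<bar>Z w\<bar> \<le> D"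
    using Z by (auto simp: bounded_measurable_def bounded_iff spZ)
  show fint: "integrable ?L (shift_rv \<tau> Z)"
  proof (rule L.integrable_const_bound[where B = "\<bar>D\<bar>"])
    show "AE w in ?L. norm (shift_rv \<tau> Z w) \<le> \<bar>D\<bar>"
    proof (rule AE_I2)
      fix w assume "w \<in> space ?L"
      then have "shift (?T w) w \<in> cadlag E" by (simp add: space_ext_law shift_cadlag)
      then show "norm (shift_rv \<tau> Z w) \<le> \<bar>D\<bar>" using D[of "shift (?T w) w"] by (auto simp: shift_rv_def)
    qed
  qed (rule fL)
  have gint: "integrable ?L g"
  proof (rule L.integrable_const_bound[where B = C])
    show "AE w in ?L. norm (g w) \<le> C"
    proof (rule AE_I2)
      fix w assume "w \<in> space ?L"
      then have "w (?T w) \<in> E" using cadlagD(1)[of w E "?T w"] by (simp add: space_ext_law)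
      then show "norm (g w) \<le> C" using h_bd C0 by (simp add: g_def)
    qed
  qed (rule gL)
  have "AE w in ?L. real_cond_exp ?L ?S (shift_rv \<tau> Z) w = g w"
  proof (rule sub.real_cond_exp_charact)
    fix S assume S: "S \<in> sets ?S"
    let ?B = "{w \<in> S. \<tau> w < \<infinity>}"
    have optional_on': "optional_on ?B ?T" by (rule stopping_optional_on[OF \<tau> S])
    have B: "?B \<in> sets Pc" by (rule optional_on_sets[OF optional_on'])
    have Saug [measurable]: "S \<in> sets (aug_all E P)" using S S_aug by blast
    have Scad: "S \<subseteq> cadlag E" using Saug by (simp add: sets_aug_all')
    have gA [measurable]: "g \<in> borel_measurable (aug_all E P)"
      using gL by (simp add: measurable_cong_sets[OF sets_ext_law refl])
    note fA [measurable]
    have L_int: "(LINT w:S|?L. f w) = (\<integral>w. indicator ?B w *\<^sub>R f w \<partial>Pc)"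
      if [measurable]: "f \<in> borel_measurable (aug_all E P)" and f0: "\<And>w. \<not> \<tau> w < \<infinity> \<Longrightarrow> f w = 0" for f :: "_ \<Rightarrow> real"
    proof -
      have "(LINT w:S|?L. f w) = (LINT w:S|Pc. f w)"
        unfolding set_lebesgue_integral_def by (rule integral_ext_law) measurable
      also have "\<dots> = (\<integral>w. indicator ?B w *\<^sub>R f w \<partial>Pc)"
        unfolding set_lebesgue_integral_def using f0
        by (intro Bochner_Integration.integral_cong refl) (auto simp: indicator_def)
      finally show ?thesis .
    qed
    have zm: "(\<lambda>w. Z' (shift (?T w) w)) \<in> borel_measurable (restrict_space Pc ?B)"
      by (rule measurable_compose[OF shift_measurable[OF optional_on'] Z'(1)])
    have "(LINT w:S|?L. shift_rv \<tau> Z w) = (\<integral>w. indicator ?B w *\<^sub>R shift_rv \<tau> Z w \<partial>Pc)"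
      by (intro L_int fA) (simp add: shift_rv_def)
    also have "\<dots> = (\<integral>w. indicator ?B w *\<^sub>R Z' (shift (?T w) w) \<partial>Pc)"
    proof (rule integral_cong_AE)
      show "(\<lambda>w. indicator ?B w *\<^sub>R shift_rv \<tau> Z w) \<in> borel_measurable Pc"
        using B fPc by measurable
      show "(\<lambda>w. indicator ?B w *\<^sub>R Z' (shift (?T w) w)) \<in> borel_measurable Pc"
        using B zm by (subst (asm) borel_measurable_restrict_space_iff) (auto simp only: sets.Int_space_eq2)
      show "AE w in Pc. indicator ?B w *\<^sub>R shift_rv \<tau> Z w = indicator ?B w *\<^sub>R Z' (shift (?T w) w)"
        using shift_rv_AE[OF \<tau> cadlag_stopped N(1,3)]
      proof eventually_elim
        case (elim w)
        then show ?case
          using N(2)[of "shift (?T w) w"] shift_cadlag[of w E "?T w"] Scad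
          by (auto simp: shift_rv_def indicator_def)
      qed
    qed
    also have "\<dots> = (\<integral>w. Z' (shift (?T w) w) \<partial>restrict_space Pc ?B)"
      using B by (intro integral_restrict_space[symmetric]) (auto simp only: sets.Int_space_eq2)
    also have "\<dots> = (\<integral>w. Z' w \<partial>distr (restrict_space Pc ?B) G0 (\<lambda>w. shift (?T w) w))"
      by (rule integral_distr[OF shift_measurable[OF optional_on'] Z'(1), symmetric])
    \<comment> \<open>The path-level strong Markov property on \<open>?B\<close> replaces
      conditioning: integrating out \<kappa> leaves \<open>h\<close> at the position at
      \<tau>.\<close>
    also have "\<dots> = (\<integral>x. h x \<partial>law_at ?B ?T)"
      unfolding shift_law[OF optional_on'] h_def
    proof (rule integral_bind[OF Z'(1)])
      show "\<kappa> \<in> law_at ?B ?T \<rightarrow>\<^sub>M subprob_algebra G0" using k by (simp cong: measurable_cong_sets)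
      show "finite_measure (law_at ?B ?T)" by (rule finite_law_at[OF optional_on'])
      show "AE x in law_at ?B ?T. emeasure (\<kappa> x) (space (\<kappa> x)) \<le> ennreal 1"
        using \<kappa>_D(1) by (intro AE_I2) (simp add: prob_space.emeasure_space_1)
    qed (rule Z'(2))
    also have "\<dots> = (\<integral>w. h (w (?T w)) \<partial>restrict_space Pc ?B)" by (rule integral_law_at[OF optional_on' hm])
    also have "\<dots> = (\<integral>w. indicator ?B w *\<^sub>R h (w (?T w)) \<partial>Pc)"
      using B by (intro integral_restrict_space) (auto simp only: sets.Int_space_eq2)
    also have "\<dots> = (\<integral>w. indicator ?B w *\<^sub>R g w \<partial>Pc)"
      by (intro Bochner_Integration.integral_cong refl) (simp add: g_def indicator_def)
    also have "\<dots> = (LINT w:S|?L. g w)"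
      by (intro L_int[symmetric] gA) (simp add: g_def)
    finally show "(LINT w:S|?L. shift_rv \<tau> Z w) = (LINT w:S|?L. g w)" .
  qed (fact fint gint gS)+
  \<comment> \<open>\<open>h x\<close> is the expectation of Z from x only where N is null for
    \<open>\<kappa> x\<close>; almost surely the position at \<tau> is such a point.\<close>
  moreover have "AE w in ?L. \<tau> w < \<infinity> \<longrightarrow> g w = expect_from E P (w (?T w)) Z"
  proof (rule AE_ext_law)
    have ms: "{x \<in> space M. emeasure (\<kappa> x) N = 0} \<in> sets M"
      using measurable_emeasure_kernel[OF k N(1)] by measurable
    have "AE w in restrict_space Pc ?A. emeasure (\<kappa> (w (?T w))) N = 0"
      using N(3) unfolding law_at_def
      by (subst (asm) AE_distr_iff[OF optional_on_eval[OF optional_on] ms]) simp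
    moreover have "?A \<inter> space Pc \<in> sets Pc" using optional_on_sets[OF optional_on] by blast
    ultimately have "AE w in Pc. w \<in> ?A \<longrightarrow> emeasure (\<kappa> (w (?T w))) N = 0" by (simp add: AE_restrict_space_iff)
    then show "AE w in Pc. \<tau> w < \<infinity> \<longrightarrow> g w = expect_from E P (w (?T w)) Z"
      using AE_space
    proof eventually_elim
      case (elim w)
      then have "w (?T w) \<in> E" using cadlagD(1)[of w E "?T w"] by (simp add: space_P)
      then show ?case
        using expect_from_eq[OF _ Z Z'(1) N(1,2), of "w (?T w)"] elim by (simp add: g_def h_def space_P)
    qed
  qed
  ultimately show "AE w in ?L. \<tau> w < \<infinity> \<longrightarrow> real_cond_exp ?L ?S (shift_rv \<tau> Z) w = expect_from E P (w (?T w)) Z"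
    by eventually_elim simp
qed

end

theorem theorem3p14:
  fixes E :: "'a::euclidean_space set"
    and u :: "real \<Rightarrow> 'a \<Rightarrow> 'a measure"
    and Rp :: "('a \<Rightarrow> real) set"
    and p :: "real \<Rightarrow> 'a \<Rightarrow> 'a measure"
    and P :: "'a measure \<Rightarrow> (real \<Rightarrow> 'a) measure"
  assumes "closed E"
    and "engelbert_resolvent E u Rp"
    and "C_zero E \<subseteq> sup_closure E (cone_diff E Rp)"
    and "engelbert_transition_function E u Rp p"
    and "\<And>\<mu>. \<mu> \<in> space (prob_algebra (borel_of E)) \<Longrightarrow> markov_law E p \<mu> (P \<mu>)"
  shows "(\<forall>\<mu>\<in>space (prob_algebra (borel_of E)). \<forall>\<tau> :: (real \<Rightarrow> 'a) \<Rightarrow> ennreal.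
            \<forall>Z\<in>bounded_measurable (aug_all E P).
            stopping_time (aug_filtration E P) \<tau> \<longrightarrow>
              integrable (ext_law E P \<mu>) (shift_rv \<tau> Z) \<and>
              (AE w in ext_law E P \<mu>. \<tau> w < \<infinity> \<longrightarrow>
                 real_cond_exp (ext_law E P \<mu>) (stopped_algebra E P \<tau>) (shift_rv \<tau> Z) w =
                   expect_from E P (w (enn2real (\<tau> w))) Z)) \<and>
         (\<forall>t\<ge>0. sets (aug_at E P t) = (\<Inter>s\<in>{t<..}. sets (aug_at E P s)))"
proof -
  interpret engelbert_process E u Rp p P
    using assms by unfold_locales
  show ?thesis
    using engelbert_law.strong_markov_property[OF engelbert_lawI] aug_right_continuous by blast
qed

end
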